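(* Let $n\ge 2$ and let $\mathbb{H}^n$ be the hyperbolic space of constant sectional curvature $-1$. Let $\mathcal{A}\in C^1[0,\infty)$ satisfy (i) $\mathcal{A}(0)=0$ and $\mathcal{A}'(s)>0$ for all $s>0$; (ii) there exist $C>0$ and $p\ge 1$ such that $\mathcal{A}(s)\le C(s^{p-1}+1)$ for all $s>0$; (iii) there exist positive numbers $q,\delta_0,\bar D$ such that $\mathcal{A}(s)>\bar D s^q$ for $s\in[0,\delta_0]$ (at $s=0$ read as $\geq$); (iv) for some $K_0>0$, $\displaystyle\int_0^{K_0}\frac{\mathcal{A}^{-1}(t)}{\sqrt{K_0-t}}\,dt=+\infty$. Let $p_1,\dots,p_k\in\partial_\infty\mathbb{H}^n$ be finitely many points and let $m\in C^\infty(\mathbb{H}^n)\cap C^0(\overline{\mathbb{H}^n}\setminus\{p_1,\dots,p_k\})$ be a solution of $$\operatorname{div}\left(\frac{\mathcal{A}(|\nabla m|)}{|\nabla m|}\nabla m\right)=0\quad\text{in }\mathbb{H}^n.$$ If $m|_{\partial_\infty\mathbb{H}^n\setminus\{p_1,\dots,p_k\}}$ extends continuously to $p_i$ for every $i=1,\dots,k$, then $m\in C^0(\overline{\mathbb{H}^n})$.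
   Context: $\partial_\infty\mathbb{H}^n$ denotes the asymptotic boundary (sphere at infinity) of $\mathbb{H}^n$ and $\overline{\mathbb{H}^n}=\mathbb{H}^n\cup\partial_\infty\mathbb{H}^n$ its geometric compactification with the cone topology (in the Poincaré ball model, the closed unit ball). For $X\subset\overline{\mathbb{H}^n}$ containing $\mathbb{H}^n$, $m\in C^0(X)$ means that $m$ extends to a continuous real-valued function on $X$, still denoted $m$. $\operatorname{div}$ and $\nabla$ are the divergence and gradient of $\mathbb{H}^n$. The vector field $\frac{\mathcal{A}(|\nabla u|)}{|\nabla u|}\nabla u$ is taken to be $0$ where $\nabla u=0$, and the equation is understood in the weak (distributional) sense. $\mathcal{A}^{-1}$ is the inverse of $\mathcal{A}:[0,\infty)\to[0,\sup\mathcal{A})$, and in (iv) it is understood that $K_0\le\sup\mathcal{A}$, so that $\mathcal{A}^{-1}$ is defined on $[0,K_0)$. *)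

theory Defs
  imports "HOL-Analysis.Analysis"
begin

text \<open>
  Hyperbolic space of constant curvature \<open>-1\<close> is the Poincare ball model: the open unit ball with the
  metric \<open>(2 / (1 - |x|^2))^2 (dx_1^2 + \<dots> + dx_n^2)\<close>. The asymptotic boundary is the unit sphere,
  and the compactification with the cone topology is the closed unit ball.
\<close>

abbreviation hyp_space :: "'a::euclidean_space set"  (\<open>\<H>\<close>)
  where "\<H> \<equiv> ball 0 1"

abbreviation hyp_boundary :: "'a::euclidean_space set"  (\<open>\<partial>\<H>\<close>)
  where "\<partial>\<H> \<equiv> sphere 0 1"

abbreviation hyp_closure :: "'a::euclidean_space set"  (\<open>cl\<H>\<close>)
  where "cl\<H> \<equiv> cball 0 1"

definition conf_factor :: "'a::euclidean_space \<Rightarrow> real"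
  where "conf_factor x = 2 / (1 - (norm x)\<^sup>2)"

definition hyp_inner :: "'a::euclidean_space \<Rightarrow> 'a \<Rightarrow> 'a \<Rightarrow> real"
  where "hyp_inner x u v = (conf_factor x)\<^sup>2 * (u \<bullet> v)"

definition hyp_norm :: "'a::euclidean_space \<Rightarrow> 'a \<Rightarrow> real"
  where "hyp_norm x v = sqrt (hyp_inner x v v)"

text \<open>The Riemannian volume; its density with respect to Lebesgue measure is the square root of
  the determinant of the metric.\<close>

definition hyp_volume :: "'a::euclidean_space measure"
  where "hyp_volume =
    density (restrict_space lborel \<H>) (\<lambda>x. ennreal (conf_factor x ^ DIM('a)))"

definition hyp_grad :: "('a::euclidean_space \<Rightarrow> real) \<Rightarrow> 'a \<Rightarrow> 'a"
  where "hyp_grad f x = (THE w. \<forall>v. hyp_inner x w v = frechet_derivative f (at x) v)"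

lemma hyp_grad_unique:
  assumes "x \<in> \<H>" "\<And>v. hyp_inner x w v = frechet_derivative f (at x) v"
  shows "hyp_grad f x = w"
  unfolding hyp_grad_def
proof (rule the_equality)
  fix u assume u: "\<forall>v. hyp_inner x u v = frechet_derivative f (at x) v"
  have "(norm x)\<^sup>2 < 1"
    using assms(1) by (simp add: power_less_one_iff)
  hence "conf_factor x \<noteq> 0"
    by (simp add: conf_factor_def)
  moreover have "hyp_inner x u v = hyp_inner x w v" for v
    using u assms(2) by simp
  ultimately have "\<forall>v. u \<bullet> v = w \<bullet> v"
    by (simp add: hyp_inner_def)
  thus "u = w"
    by (metis vector_eq_rdot)
qed (use assms(2) in blast)

lemma hyp_grad_eq:
  assumes "x \<in> \<H>" "f differentiable (at x)"
  shows "hyp_grad f x =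
    (\<Sum>b\<in>Basis. (((1 - (norm x)\<^sup>2) / 2)\<^sup>2 * frechet_derivative f (at x) b) *\<^sub>R b)" (is "_ = ?w")
proof (rule hyp_grad_unique[OF assms(1)])
  fix v
  let ?D = "frechet_derivative f (at x)"
  let ?c = "((1 - (norm x)\<^sup>2) / 2)\<^sup>2"
  interpret linear ?D
    using assms(2) by (rule linear_frechet_derivative)
  have "(norm x)\<^sup>2 < 1"
    using assms(1) by (simp add: power_less_one_iff)
  hence c: "(conf_factor x)\<^sup>2 * ?c = 1"
    by (simp add: conf_factor_def power2_eq_square)
  have "?D v = ?D (\<Sum>b\<in>Basis. (v \<bullet> b) *\<^sub>R b)"
    by (simp add: euclidean_representation)
  also have "\<dots> = (\<Sum>b\<in>Basis. (v \<bullet> b) * ?D b)"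
    by (simp add: sum scale)
  finally have D: "?D v = (\<Sum>b\<in>Basis. (v \<bullet> b) * ?D b)" .
  have "?w \<bullet> v = (\<Sum>b\<in>Basis. ?c * ((v \<bullet> b) * ?D b))"
    by (simp add: inner_sum_left inner_commute[of v] mult_ac)
  also have "\<dots> = ?c * ?D v"
    by (simp only: D sum_distrib_left)
  finally have "?w \<bullet> v = ?c * ?D v" .
  hence "hyp_inner x ?w v = (conf_factor x)\<^sup>2 * ?c * ?D v"
    by (simp add: hyp_inner_def)
  thus "hyp_inner x ?w v = ?D v"
    by (simp only: c mult_1)
qed

text \<open>Continuous differentiability of order \<open>k\<close>, meant for open \<open>S\<close>. The identity is a global chart
  of the ball model, so smoothness on hyperbolic space is smoothness on the open ball.\<close>

primrec Ck_on :: "nat \<Rightarrow> 'a::euclidean_space set \<Rightarrow> ('a \<Rightarrow> real) \<Rightarrow> bool" where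
  "Ck_on 0 S f \<longleftrightarrow> continuous_on S f"
| "Ck_on (Suc k) S f \<longleftrightarrow>
     (\<forall>x\<in>S. f differentiable (at x)) \<and>
     (\<forall>b\<in>Basis. Ck_on k S (\<lambda>x. frechet_derivative f (at x) b))"

definition smooth_on :: "'a::euclidean_space set \<Rightarrow> ('a \<Rightarrow> real) \<Rightarrow> bool"
  where "smooth_on S f \<longleftrightarrow> (\<forall>k. Ck_on k S f)"

definition test_function :: "('a::euclidean_space \<Rightarrow> real) \<Rightarrow> bool"
  where "test_function \<phi> \<longleftrightarrow>
    smooth_on \<H> \<phi> \<and> (\<exists>K. compact K \<and> K \<subseteq> \<H> \<and> (\<forall>x\<in>\<H> - K. \<phi> x = 0))"

text \<open>\<open>div X = f\<close> in hyperbolic space, in the sense of distributions. The integrability clauses hold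
  automatically for continuous \<open>X\<close> and \<open>f\<close>; they exclude the default value 0 of the Bochner
  integral.\<close>

definition has_weak_div :: "('a::euclidean_space \<Rightarrow> 'a) \<Rightarrow> ('a \<Rightarrow> real) \<Rightarrow> bool"
  where "has_weak_div X f \<longleftrightarrow>
    (\<forall>\<phi>. test_function \<phi> \<longrightarrow>
       integrable hyp_volume (\<lambda>x. hyp_inner x (X x) (hyp_grad \<phi> x)) \<and>
       integrable hyp_volume (\<lambda>x. f x * \<phi> x) \<and>
       (\<integral>x. hyp_inner x (X x) (hyp_grad \<phi> x) \<partial>hyp_volume) = - (\<integral>x. f x * \<phi> x \<partial>hyp_volume))"

definition flux :: "(real \<Rightarrow> real) \<Rightarrow> ('a::euclidean_space \<Rightarrow> real) \<Rightarrow> 'a \<Rightarrow> 'a"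
  where "flux A u x =
    (if hyp_grad u x = 0 then 0
     else (A (hyp_norm x (hyp_grad u x)) / hyp_norm x (hyp_grad u x)) *\<^sub>R hyp_grad u x)"

definition extends_continuously ::
    "('a::topological_space \<Rightarrow> 'b::topological_space) \<Rightarrow> 'a set \<Rightarrow> 'a set \<Rightarrow> bool"
  where "extends_continuously f S T \<longleftrightarrow>
    (\<exists>F. continuous_on T F \<and> (\<forall>x\<in>S. F x = f x))"

end

theory Submission
  imports Defs "HOL-Real_Asymp.Real_Asymp"
begin

text \<open>
  The proof compares \<open>m\<close> with explicit strict supersolutions whose level sets are either totally
  geodesic hypersurfaces or geodesic spheres.

  In the hyperboloid model both kinds of hypersurface are level sets of a linear function. Restricted
  to the hyperboloid such a function \<open>F\<close> satisfies \<open>Hess F = F g\<close> and \<open>|grad F|^2 = F^2 + \<sigma>\<close> with a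
  constant \<open>\<sigma>\<close>; after scaling, \<open>\<sigma> = 1\<close> gives \<open>F = sinh d\<close> with \<open>d\<close> the signed distance to a
  hyperplane, and \<open>\<sigma> = -1\<close> gives \<open>F = cosh d\<close> with \<open>d\<close> the distance to a point. For \<open>w = G \<circ> F\<close> with
  \<open>G' = \<tau> h\<close>, \<open>\<tau> = \<plusminus>1\<close>, \<open>h > 0\<close>, put \<open>s = sqrt (F^2 + \<sigma>)\<close> and \<open>A (h s) = \<kappa>\<close>. The flux of \<open>w\<close> is
  \<open>\<tau> (\<kappa> / s) grad F\<close>, and its divergence is \<open>(\<tau> / s) (\<kappa>' s^2 + (n - 1) \<kappa> F)\<close>. So the sign of the
  operator on \<open>w\<close> depends on \<open>\<kappa>\<close> alone, and \<open>\<kappa>\<close> can be prescribed (strict_supersolution_not_touched).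

  The equation for \<open>m\<close> is given weakly, with smooth test functions, whereas \<open>w\<close> is only twice
  differentiable. The comparison therefore takes place at a point. The gradient of \<open>w\<close> never
  vanishes, so at a point where \<open>m - w\<close> has a local maximum the gradient of \<open>m\<close> does not vanish
  either; there the flux of \<open>m\<close> is differentiable, and testing with bump functions that shrink to the
  point shows that its divergence is zero (smooth_weak_imp_pointwise_solution). Ellipticity and the
  second derivative test then bound the divergence of the flux of \<open>w\<close> below by zero, which
  contradicts strictness.

  Two barriers are used. With \<open>\<sigma> = 1\<close>, \<open>\<tau> = -1\<close> and \<open>\<kappa>(F) = 2 K\<^sub>0 / sqrt (4 + F^2)\<close>, the function \<open>G\<close> blows
  up at the hyperplane \<open>F = 0\<close>, because the substitution \<open>t = \<kappa>(F)\<close> turns the divergent integral of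
  \<open>A\<^sup>-\<^sup>1(t) / sqrt (K\<^sub>0 - t)\<close> into \<open>\<integral> h\<close> near \<open>0\<close>; and \<open>G\<close> tends to \<open>0\<close> at infinity, because \<open>A\<close> dominates
  a power near \<open>0\<close> (hyperplane_barrier). Hence boundary values on the asymptotic boundary of a half
  space control \<open>m\<close> deep inside it, whatever \<open>m\<close> does on the bounding hyperplane (hyperplane_bound).
  With \<open>\<sigma> = -1\<close>, \<open>\<tau> = 1\<close> and \<open>\<kappa>\<close> proportional to \<open>(F^2 - 1)^(-n/2)\<close> one obtains a quantitative strong
  maximum principle in geodesic balls (interior_gap).

  Let \<open>L\<close> be the limit of the boundary values at an exceptional point \<open>p\<close>.
  \<^item> A shrinking sequence of half spaces around \<open>p\<close> is cut out, with the barrier on the remaining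
    side. In the limit the barrier disappears, so \<open>m\<close> is bounded above near \<open>p\<close> (bounded_near).
  \<^item> Let \<open>M\<close> be the upper limit of \<open>m\<close> at \<open>p\<close> and suppose \<open>L < M\<close>. A half space close to \<open>p\<close> that does not
    have \<open>p\<close> in its closure contains points where \<open>m\<close> is at most \<open>(L + M) / 2\<close> (deep_bound). Every
    point near \<open>p\<close> is either such a point or lies at a uniformly bounded hyperbolic distance from a
    ball of such points. The strong maximum principle then pushes \<open>m\<close> below \<open>M\<close> by a fixed amount
    near \<open>p\<close>, a contradiction (improve_bound, limsup_le_boundary_limit).

  The equation is odd, so the same bound for \<open>-m\<close> gives the limit of \<open>m\<close> at \<open>p\<close>.
\<close>

section \<open>Smooth functions and bump functions\<close>

lemma Ck_on_cong:
  assumes "open S" "\<And>x. x \<in> S \<Longrightarrow> f x = g x"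
  shows "Ck_on k S f \<longleftrightarrow> Ck_on k S g"
  using assms(2)
proof (induction k arbitrary: f g)
  case 0
  then show ?case by (simp cong: continuous_on_cong)
next
  case (Suc k)
  have d: "f differentiable (at x) \<longleftrightarrow> g differentiable (at x)" if "x \<in> S" for x
    unfolding differentiable_def
    using has_derivative_transform_within_open[OF _ assms(1) that] Suc.prems by (metis (no_types))
  have fd: "frechet_derivative f (at x) = frechet_derivative g (at x)"
    if "x \<in> S" "f differentiable (at x)" for x
    using frechet_derivative_transform_within_open[OF that(2) assms(1) that(1)] Suc.prems by blast
  show ?case
  proof (cases "\<forall>x\<in>S. f differentiable (at x)")
    case True
    have "Ck_on k S (\<lambda>x. frechet_derivative f (at x) b) \<longleftrightarrow>
          Ck_on k S (\<lambda>x. frechet_derivative g (at x) b)" for b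
      by (rule Suc.IH) (use fd True in auto)
    then show ?thesis using True d by auto
  next
    case False
    then show ?thesis using d by auto
  qed
qed

text \<open>
  Any explicit derivative may replace the chosen one in the definition of \<open>Ck_on\<close>; this is the form in
  which smoothness is proved by induction on the order.
\<close>
lemma Ck_on_SucI:
  assumes "open S" "\<And>x. x \<in> S \<Longrightarrow> (f has_derivative f' x) (at x)"
    "\<And>b. b \<in> Basis \<Longrightarrow> Ck_on k S (\<lambda>x. f' x b)"
  shows "Ck_on (Suc k) S f"
proof -
  have "Ck_on k S (\<lambda>x. frechet_derivative f (at x) b)" if "b \<in> Basis" for b
  proof -
    have "Ck_on k S (\<lambda>x. frechet_derivative f (at x) b) \<longleftrightarrow> Ck_on k S (\<lambda>x. f' x b)"
      by (rule Ck_on_cong[OF assms(1)]) (use frechet_derivative_at[OF assms(2)] in auto)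
    then show ?thesis using assms(3) that by auto
  qed
  then show ?thesis using assms(2) by (auto simp: differentiable_def)
qed

lemma Ck_on_SucD:
  assumes "Ck_on (Suc k) S f"
  shows "Ck_on k S f"
  using assms
proof (induction k arbitrary: f)
  case 0
  then show ?case
    by (auto intro!: continuous_at_imp_continuous_on dest: differentiable_imp_continuous_within)
next
  case (Suc k)
  show ?case
    using Ck_on.simps(2)[THEN iffD1, OF Suc.prems] Suc.IH
    by (intro Ck_on.simps(2)[THEN iffD2]) blast
qed

lemma Ck_on_const: "open S \<Longrightarrow> Ck_on k S (\<lambda>x. c)"
proof (induction k arbitrary: c)
  case (Suc k)
  then show ?case by (intro Ck_on_SucI[where f'="\<lambda>x h. 0"]) auto
qed simp

lemma Ck_on_inner: "open S \<Longrightarrow> Ck_on k S (\<lambda>x. (x - a) \<bullet> b)"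
proof (cases k)
  case (Suc k)
  assume "open S"
  then show ?thesis unfolding Suc
    by (intro Ck_on_SucI[where f'="\<lambda>x h. h \<bullet> b"] Ck_on_const) (auto intro!: derivative_eq_intros)
qed (auto intro!: continuous_intros)

lemma Ck_on_add:
  assumes "open S"
  shows "Ck_on k S f \<Longrightarrow> Ck_on k S g \<Longrightarrow> Ck_on k S (\<lambda>x. f x + g x)"
proof (induction k arbitrary: f g)
  case (Suc k)
  show ?case
    using Suc.prems assms
    by (intro Ck_on_SucI[where f'="\<lambda>x h. frechet_derivative f (at x) h + frechet_derivative g (at x) h"]
        Suc.IH has_derivative_add) (auto simp: frechet_derivative_works)
qed (auto intro!: continuous_intros)

lemma Ck_on_mult:
  assumes "open S"
  shows "Ck_on k S f \<Longrightarrow> Ck_on k S g \<Longrightarrow> Ck_on k S (\<lambda>x. f x * g x)"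
proof (induction k arbitrary: f g)
  case (Suc k)
  show ?case
    using Suc.prems Ck_on_SucD[OF Suc.prems(1)] Ck_on_SucD[OF Suc.prems(2)] assms
    by (intro Ck_on_SucI[where f'="\<lambda>x h. f x * frechet_derivative g (at x) h + frechet_derivative f (at x) h * g x"]
        Ck_on_add Suc.IH has_derivative_mult) (auto simp: frechet_derivative_works)
qed (auto intro!: continuous_intros)

text \<open>
  The family \<open>t^(-j) exp (-1/t)\<close>, extended by zero to the left half line. The index makes the family
  closed under differentiation, so smoothness of all members follows by one induction.
\<close>
definition flat_exp :: "nat \<Rightarrow> real \<Rightarrow> real"
  where "flat_exp j t = (if t \<le> 0 then 0 else exp (- 1 / t) / t ^ j)"

text \<open>
  At the origin the difference quotient is \<open>t^(-j-1) exp (-1/t)\<close> on the right and zero on the left,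
  so it tends to zero.
\<close>
lemma flat_exp_deriv:
  "(flat_exp j has_real_derivative (flat_exp (j + 2) t - real j * flat_exp (j + 1) t)) (at t)"
proof -
  consider "t < 0" | "t > 0" | "t = 0" by linarith
  then show ?thesis
  proof cases
    case 1
    have "((\<lambda>_. 0) has_real_derivative 0) (at t)" by simp
    then have "(flat_exp j has_real_derivative 0) (at t)"
      by (rule DERIV_cong_ev[THEN iffD1, rotated -1, OF _ refl _ refl])
         (use 1 in \<open>auto simp: flat_exp_def eventually_nhds intro!: exI[of _ "{..<0}"]\<close>)
    then show ?thesis using 1 by (simp add: flat_exp_def)
  next
    case 2
    have "((\<lambda>t. exp (- 1 / t) * inverse t ^ j) has_real_derivative
        (flat_exp (j + 2) t - real j * flat_exp (j + 1) t)) (at t)"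
    proof -
      have 1: "((\<lambda>t. exp (- 1 / t)) has_real_derivative exp (- 1 / t) * (inverse t)\<^sup>2) (at t)"
        using 2 by (auto intro!: derivative_eq_intros simp: field_simps power2_eq_square)
      have 3: "((\<lambda>t. inverse t ^ j) has_real_derivative - (real j * inverse t ^ (j + 1))) (at t)"
        using DERIV_power[OF DERIV_inverse, of t j] 2
        by (cases j) (simp_all add: power2_eq_square mult_ac)
      have e: "exp (- 1 / t) * (inverse t)\<^sup>2 * inverse t ^ j + - (real j * inverse t ^ (j + 1)) * exp (- 1 / t) =
          flat_exp (j + 2) t - real j * flat_exp (j + 1) t"
        using 2 by (simp add: flat_exp_def field_simps power2_eq_square)
      show ?thesis
        by (rule DERIV_cong[OF DERIV_mult[OF 1 3] e])
    qed
    then show ?thesis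
      by (rule DERIV_cong_ev[THEN iffD1, rotated -1, OF _ refl _ refl])
         (use 2 in \<open>auto simp: flat_exp_def eventually_nhds field_simps intro!: exI[of _ "{0<..}"]\<close>)
  next
    case 3
    have r: "((\<lambda>h. flat_exp j h / h) \<longlongrightarrow> 0) (at_right 0)"
    proof (rule Lim_transform_eventually)
      show "((\<lambda>h::real. exp (- 1 / h) / h ^ Suc j) \<longlongrightarrow> 0) (at_right 0)" by real_asymp
      show "\<forall>\<^sub>F h in at_right 0. exp (- 1 / h) / h ^ Suc j = flat_exp j h / h"
        by (auto simp: eventually_at_right_less flat_exp_def eventually_at_filter mult.commute)
    qed
    have l: "((\<lambda>h. flat_exp j h / h) \<longlongrightarrow> 0) (at_left 0)"
      by (rule Lim_transform_eventually[OF tendsto_const])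
         (auto simp: flat_exp_def eventually_at_filter)
    show ?thesis
      using filterlim_split_at[OF l r] 3 by (simp add: DERIV_def flat_exp_def)
  qed
qed

lemma continuous_flat_exp: "continuous_on UNIV (flat_exp j)"
  by (meson DERIV_isCont continuous_at_imp_continuous_on flat_exp_deriv)

definition bump_arg :: "'a::euclidean_space \<Rightarrow> real \<Rightarrow> 'a \<Rightarrow> real"
  where "bump_arg a e x = 1 - (norm (x - a))\<^sup>2 / e\<^sup>2"

lemma flat_exp_bump_deriv:
  fixes a :: "'a::euclidean_space"
  shows "((\<lambda>x. flat_exp j (bump_arg a e x)) has_derivative
    (\<lambda>h. (flat_exp (j + 2) (bump_arg a e x) - real j * flat_exp (j + 1) (bump_arg a e x)) *
         (- 2 / e\<^sup>2 * ((x - a) \<bullet> h)))) (at x)"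
proof -
  have "(bump_arg a e has_derivative (\<lambda>h. - 2 / e\<^sup>2 * ((x - a) \<bullet> h))) (at x)"
    unfolding bump_arg_def power2_norm_eq_inner divide_inverse
    by (rule derivative_eq_intros refl | simp add: inner_commute algebra_simps)+
  from has_derivative_compose[OF this flat_exp_deriv[unfolded has_field_derivative_def]]
  show ?thesis by simp
qed

text \<open>
  The derivative of a member of the family composed with \<open>bump_arg\<close> is a combination of later members
  times an affine function, which makes the induction on the order go through for all indices at once.
\<close>
lemma Ck_on_bump:
  fixes a :: "'a::euclidean_space"
  assumes "open S"
  shows "Ck_on k S (\<lambda>x. flat_exp j (bump_arg a e x))"
proof (induction k arbitrary: j)
  case 0
  show ?case
    by (auto simp: bump_arg_def divide_inverse intro!: continuous_intros
        continuous_on_compose2[OF continuous_flat_exp])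
next
  case (Suc k)
  have "Ck_on k S (\<lambda>x. (flat_exp (j + 2) (bump_arg a e x) + (- real j) * flat_exp (j + 1) (bump_arg a e x)) *
         (- 2 / e\<^sup>2 * ((x - a) \<bullet> b)))" for b
    by (intro Ck_on_mult Ck_on_add Suc Ck_on_const Ck_on_inner assms)
  then show ?case
    by (intro Ck_on_SucI[OF assms flat_exp_bump_deriv]) simp
qed

section \<open>Integration by parts for bump functions\<close>

lemma integral_lborel_affine:
  fixes f :: "'a::euclidean_space \<Rightarrow> real"
  assumes "c \<noteq> 0" "integrable lborel f"
  shows "integrable lborel (\<lambda>x. f (t + c *\<^sub>R x))"
    and "(\<integral>x. f x \<partial>lborel) = \<bar>c\<bar> ^ DIM('a) * (\<integral>x. f (t + c *\<^sub>R x) \<partial>lborel)"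
proof -
  have [measurable]: "f \<in> borel_measurable borel"
    using assms(2) by (auto dest: borel_measurable_integrable)
  have e: "ennreal \<bar>c\<bar> ^ DIM('a) = ennreal (\<bar>c\<bar> ^ DIM('a))" by (simp add: ennreal_power)
  have L: "(lborel::'a measure) = density (distr lborel borel (\<lambda>x. t + c *\<^sub>R x)) (\<lambda>_. ennreal (\<bar>c\<bar> ^ DIM('a)))"
    using lborel_affine[OF assms(1), of t] e by simp
  have "integrable (density (distr lborel borel (\<lambda>x. t + c *\<^sub>R x)) (\<lambda>_. ennreal (\<bar>c\<bar> ^ DIM('a)))) f"
    using assms(2) L by simp
  then show "integrable lborel (\<lambda>x. f (t + c *\<^sub>R x))"
    using assms(1) by (subst (asm) integrable_density) (auto simp: integrable_distr_eq)
  show "(\<integral>x. f x \<partial>lborel) = \<bar>c\<bar> ^ DIM('a) * (\<integral>x. f (t + c *\<^sub>R x) \<partial>lborel)"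
    by (subst L, subst integral_density) (auto simp: integral_distr)
qed

lemma integrable_compact_support:
  fixes f :: "'a::euclidean_space \<Rightarrow> real"
  assumes "continuous_on UNIV f" "\<And>z. norm z > 1 \<Longrightarrow> f z = 0"
  shows "integrable lborel f"
proof -
  have "integrable lborel (\<lambda>x. indicator (cball 0 1) x *\<^sub>R f x)"
    by (rule borel_integrable_compact) (use assms in \<open>auto intro: continuous_on_subset\<close>)
  also have "(\<lambda>x. indicator (cball 0 1) x *\<^sub>R f x) = f"
    using assms(2) by (auto simp: fun_eq_iff indicator_def)
  finally show ?thesis .
qed

text \<open>
  The integral of \<open>f\<close> does not change under translation, so the integral of every difference quotient
  is zero. The bound on the derivative makes the quotients uniformly Lipschitz, and dominated convergence
  passes to the derivative.
\<close>
lemma integral_partial_derivative_eq_0: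
  fixes f :: "'a::euclidean_space \<Rightarrow> real"
  assumes d: "\<And>z. (f has_derivative f' z) (at z)"
    and b: "\<And>z. \<bar>f' z i\<bar> \<le> C" and i: "i \<in> Basis"
    and supp: "\<And>z. norm z > 1 \<Longrightarrow> f z = 0"
  shows "(\<integral>z. f' z i \<partial>lborel) = 0"
proof -
  define s where "s k z = (f (i /\<^sub>R real (Suc k) + z) - f z) * real (Suc k)" for k z
  have cont: "continuous_on UNIV f"
    using d has_derivative_continuous continuous_at_imp_continuous_on by blast
  have fi: "integrable lborel f" by (rule integrable_compact_support[OF cont supp])
  note ff = integral_lborel_affine[of 1, OF _ fi, simplified]
  have s0: "(\<integral>z. s k z \<partial>lborel) = 0" for k
    unfolding s_def using fi ff(1) ff(2)[of "i /\<^sub>R real (Suc k)"] by simp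
  have lim: "(\<lambda>k. s k z) \<longlonglongrightarrow> f' z i" for z
  proof -
    have "((\<lambda>t. f (z + t *\<^sub>R i)) has_derivative (\<lambda>h. f' z (h *\<^sub>R i))) (at 0)"
      by (rule has_derivative_compose[where g=f and f="\<lambda>t. z + t *\<^sub>R i", of "\<lambda>h. h *\<^sub>R i", simplified])
         (auto intro!: derivative_eq_intros d)
    moreover have "f' z (h *\<^sub>R i) = h * f' z i" for h
      using has_derivative_bounded_linear[OF d] by (metis bounded_linear.linear linear_cmul real_scaleR_def)
    ultimately have "((\<lambda>t. f (z + t *\<^sub>R i)) has_real_derivative f' z i) (at 0)"
      by (simp add: has_field_derivative_def mult.commute[of _ "f' z i"])
    then have "((\<lambda>t. (f (z + t *\<^sub>R i) - f z) / t) \<longlongrightarrow> f' z i) (at 0)"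
      by (simp add: DERIV_def)
    from filterlim_compose[OF this, of "\<lambda>k. 1 / real (Suc k)" sequentially]
    have "(\<lambda>k. (f (z + (1 / real (Suc k)) *\<^sub>R i) - f z) / (1 / real (Suc k))) \<longlonglongrightarrow> f' z i"
      using LIMSEQ_inverse_real_of_nat by (auto simp: filterlim_at inverse_eq_divide)
    then show ?thesis by (simp add: s_def add.commute inverse_eq_divide)
  qed
  have lip: "\<bar>s k z\<bar> \<le> C" for k z
  proof -
    let ?t = "inverse (real (Suc k))"
    have g: "((\<lambda>t. f (z + t *\<^sub>R i)) has_real_derivative f' (z + t *\<^sub>R i) i) (at t)" for t
    proof -
      have "((\<lambda>t. f (z + t *\<^sub>R i)) has_derivative (\<lambda>h. f' (z + t *\<^sub>R i) (h *\<^sub>R i))) (at t)"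
        by (rule has_derivative_compose[where g=f and f="\<lambda>t. z + t *\<^sub>R i", of "\<lambda>h. h *\<^sub>R i", simplified])
           (auto intro!: derivative_eq_intros d)
      moreover have "f' (z + t *\<^sub>R i) (h *\<^sub>R i) = h * f' (z + t *\<^sub>R i) i" for h
        using has_derivative_bounded_linear[OF d] by (metis bounded_linear.linear linear_cmul real_scaleR_def)
      ultimately show ?thesis
        by (simp add: has_field_derivative_def mult.commute[of _ "f' _ i"])
    qed
    have "0 < ?t" by simp
    from MVT2[OF this, of "\<lambda>t. f (z + t *\<^sub>R i)" "\<lambda>t. f' (z + t *\<^sub>R i) i"] g
    obtain \<xi> where "f (z + ?t *\<^sub>R i) - f z = ?t * f' (z + \<xi> *\<^sub>R i) i" by auto
    then have "s k z = f' (z + \<xi> *\<^sub>R i) i" by (simp add: s_def add.commute)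
    then show ?thesis using b by simp
  qed
  have sb: "\<bar>s k z\<bar> \<le> C * indicator (cball 0 2) z" for k z
  proof (cases "norm z \<le> 2")
    case True then show ?thesis using lip[of k z] by simp
  next
    case False
    have "norm (i /\<^sub>R real (Suc k)) \<le> 1" using i by (simp add: field_simps)
    then have "norm (i /\<^sub>R real (Suc k) + z) > 1"
      using False norm_triangle_ineq2[of z "- (i /\<^sub>R real (Suc k))"] by (simp add: add.commute)
    then have "f (i /\<^sub>R real (Suc k) + z) = 0" by (rule supp)
    moreover have "f z = 0" using False supp by auto
    ultimately show ?thesis using False by (simp add: s_def)
  qed
  have [measurable]: "f \<in> borel_measurable borel" by (rule borel_measurable_continuous_onI[OF cont])
  have sm: "s k \<in> borel_measurable lborel" for k unfolding s_def by measurable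
  have fm: "(\<lambda>z. f' z i) \<in> borel_measurable lborel"
    by (rule borel_measurable_LIMSEQ_real[OF lim sm])
  have "(\<lambda>k. \<integral>z. s k z \<partial>lborel) \<longlonglongrightarrow> (\<integral>z. f' z i \<partial>lborel)"
  proof (rule integral_dominated_convergence[where w="\<lambda>z. C * indicator (cball 0 2) z"])
    show "integrable lborel (\<lambda>z. C * indicator (cball 0 2) (z::'a))"
      using borel_integrable_compact[of "cball (0::'a) 2" "\<lambda>_. C"] by (simp add: mult.commute)
  qed (use sm fm lim sb in auto)
  then show ?thesis by (simp add: s0 LIMSEQ_const_iff)
qed

text \<open>
  With \<open>\<phi>(z) = exp (-1 / (1 - |z|^2))\<close> one has \<open>grad \<phi> = -2 k(z) z\<close>. Integrating the partial derivatives of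
  \<open>\<phi>(z) (T z + v)\<close> to zero gives \<open>2 \<integral> k (T z + v) \<bullet> z = tr T \<integral> \<phi>\<close>: testing an affine field with the bump
  function sees the divergence of the field and nothing else.
\<close>
lemma integral_bump_gradient_linear:
  fixes T :: "'a::euclidean_space \<Rightarrow> 'a" and v :: 'a
  defines "k \<equiv> \<lambda>z. flat_exp 2 (bump_arg 0 1 z)"
  assumes T: "linear T"
  obtains c where "c > 0" "(\<integral>z. k z * ((T z + v) \<bullet> z) \<partial>lborel) = c * (\<Sum>b\<in>Basis. T b \<bullet> b)"
    "integrable lborel (\<lambda>z. k z * ((T z + v) \<bullet> z))"
proof -
  define \<phi> where "\<phi> z = flat_exp 0 (bump_arg (0::'a) 1 z)" for z
  have bl: "bounded_linear T" using T by (rule linear_conv_bounded_linear[THEN iffD1])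
  note [continuous_intros] = linear_continuous_on[OF bl]
  have ck: "continuous_on UNIV k" "continuous_on UNIV \<phi>"
    using Ck_on_bump[of UNIV 0 2 0 1] Ck_on_bump[of UNIV 0 0 0 1] by (auto simp: k_def \<phi>_def[abs_def])
  have supp: "k z = 0" "\<phi> z = 0" if "norm z > 1" for z
    using that by (auto simp: k_def \<phi>_def bump_arg_def flat_exp_def)
  have d\<phi>: "(\<phi> has_derivative (\<lambda>h. - 2 * k z * (z \<bullet> h))) (at z)" for z
    using flat_exp_bump_deriv[of 0 0 1 z] by (simp add: \<phi>_def[abs_def] k_def mult_ac flip: numeral_2_eq_2)
  have \<phi>i: "integrable lborel \<phi>"
    by (rule integrable_compact_support) (use ck supp in auto)
  have Ii: "integrable lborel (\<lambda>z. k z * (((T z + v) \<bullet> i) * (z \<bullet> i)))" for i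
    by (rule integrable_compact_support) (use ck supp in \<open>auto intro!: continuous_intros\<close>)
  have part: "2 * (\<integral>z. k z * (((T z + v) \<bullet> i) * (z \<bullet> i)) \<partial>lborel) = (T i \<bullet> i) * (\<integral>z. \<phi> z \<partial>lborel)"
    if i: "i \<in> Basis" for i
  proof -
    define f' where "f' z h = \<phi> z * (T h \<bullet> i) + (- 2 * k z * (z \<bullet> h)) * ((T z + v) \<bullet> i)" for z h
    have d: "((\<lambda>z. \<phi> z * ((T z + v) \<bullet> i)) has_derivative f' z) (at z)" for z
      unfolding f'_def
      by (auto intro!: derivative_eq_intros d\<phi> bounded_linear.has_derivative[OF bl])
    have f'c: "continuous_on UNIV (\<lambda>z. f' z i)"
      unfolding f'_def using ck by (auto intro!: continuous_intros)
    have f's: "f' z i = 0" if "norm z > 1" for z using supp that by (simp add: f'_def)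
    have "compact ((\<lambda>z. f' z i) ` cball 0 1)"
      by (rule compact_continuous_image) (use f'c continuous_on_subset in auto)
    then obtain C where C: "\<And>z. z \<in> cball 0 1 \<Longrightarrow> \<bar>f' z i\<bar> \<le> C" "0 < C"
      by (metis (no_types, lifting) bounded_pos compact_imp_bounded imageI real_norm_def)
    have Cb: "\<bar>f' z i\<bar> \<le> C" for z
      using C f's[of z] by (cases "norm z \<le> 1") auto
    have "(\<integral>z. f' z i \<partial>lborel) = 0"
      by (rule integral_partial_derivative_eq_0[OF d Cb i]) (use supp in auto)
    moreover have "f' z i = \<phi> z * (T i \<bullet> i) - 2 * (k z * (((T z + v) \<bullet> i) * (z \<bullet> i)))" for z
      by (simp add: f'_def)
    ultimately have "(\<integral>z. \<phi> z * (T i \<bullet> i) - 2 * (k z * (((T z + v) \<bullet> i) * (z \<bullet> i))) \<partial>lborel) = 0"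
      by simp
    then show ?thesis using \<phi>i Ii[of i] by (simp add: mult.commute)
  qed
  have "\<phi> z \<ge> 0" for z by (simp add: \<phi>_def flat_exp_def)
  have pos: "(\<integral>z. \<phi> z \<partial>lborel) > 0"
  proof -
    have "(\<integral>z. \<phi> z \<partial>lborel) \<ge> 0" using \<open>\<And>z. \<phi> z \<ge> 0\<close> by simp
    moreover have "(\<integral>z. \<phi> z \<partial>lborel) \<noteq> 0"
    proof
      assume "(\<integral>z. \<phi> z \<partial>lborel) = 0"
      then have "AE z in lborel. \<phi> z = 0"
        using integral_nonneg_eq_0_iff_AE[OF \<phi>i] \<open>\<And>z. \<phi> z \<ge> 0\<close> by auto
      then have "AE z in lborel. z \<notin> ball (0::'a) 1"
      proof eventually_elim
        case (elim z)
        have "(norm z)\<^sup>2 < 1" if "norm z < 1" using that by (simp add: power_less_one_iff)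
        with elim show ?case
          by (auto simp: \<phi>_def flat_exp_def bump_arg_def split: if_splits)
      qed
      then have "emeasure lborel (ball (0::'a) 1) = 0"
        by (subst (asm) AE_iff_measurable[where N="ball 0 1"]) auto
      then show False using emeasure_lborel_ball_finite content_ball_pos[of 1 "0::'a"]
        by (simp add: measure_def emeasure_lborel_ball_finite)
    qed
    ultimately show ?thesis by simp
  qed
  have e: "k z * ((T z + v) \<bullet> z) = (\<Sum>i\<in>Basis. k z * (((T z + v) \<bullet> i) * (z \<bullet> i)))" for z
    by (subst euclidean_inner) (simp add: sum_distrib_left)
  show thesis
  proof
    show "(\<integral>z. \<phi> z \<partial>lborel) / 2 > 0" using pos by simp
    show "(\<integral>z. k z * ((T z + v) \<bullet> z) \<partial>lborel) = (\<integral>z. \<phi> z \<partial>lborel) / 2 * (\<Sum>b\<in>Basis. T b \<bullet> b)"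
      unfolding e using Ii part by (simp add: sum_distrib_left algebra_simps)
    show "integrable lborel (\<lambda>z. k z * ((T z + v) \<bullet> z))"
      unfolding e using Ii by auto
  qed
qed

section \<open>From the weak equation to a pointwise one\<close>

lemma conf_factor_pos: "x \<in> \<H> \<Longrightarrow> conf_factor x > 0"
proof -
  assume "x \<in> \<H>"
  then have "(norm x)\<^sup>2 < 1" by (simp add: power_less_one_iff)
  then show ?thesis by (simp add: conf_factor_def)
qed

text \<open>
  The vector field whose Euclidean divergence is \<open>conf_factor ^ n\<close> times the hyperbolic divergence of the
  flux, written as a function of the point and of the Euclidean gradient.
\<close>
definition euclid_flux :: "(real \<Rightarrow> real) \<Rightarrow> 'a::euclidean_space \<Rightarrow> 'a \<Rightarrow> 'a"
  where "euclid_flux A x v =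
    (conf_factor x ^ (DIM('a) - 1) * (A (norm v / conf_factor x) / norm v)) *\<^sub>R v"

text \<open>
  The equation is imposed only at points where the gradient is nonzero. Elsewhere the flux need not be
  differentiable, and comparison with functions that have no critical points never looks there. The last
  clause holds for every candidate derivative \<open>T\<close>, so it says nothing about differentiability of the flux.
\<close>
definition pointwise_solution :: "(real \<Rightarrow> real) \<Rightarrow> ('a::euclidean_space \<Rightarrow> real) \<Rightarrow> bool"
  where "pointwise_solution A m \<longleftrightarrow> (\<exists>g.
     (\<forall>x\<in>\<H>. (m has_derivative (\<lambda>h. g x \<bullet> h)) (at x)) \<and>
     (\<forall>x\<in>\<H>. g differentiable (at x)) \<and>
     (\<forall>x\<in>\<H>. \<forall>T. g x \<noteq> 0 \<longrightarrow> ((\<lambda>z. euclid_flux A z (g z)) has_derivative T) (at x) \<longrightarrow>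
        (\<Sum>b\<in>Basis. T b \<bullet> b) = 0))"

lemma hyp_grad_gradient:
  assumes "x \<in> \<H>" "(f has_derivative (\<lambda>h. w \<bullet> h)) (at x)"
  shows "hyp_grad f x = w /\<^sub>R (conf_factor x)\<^sup>2"
  using conf_factor_pos[OF assms(1)]
  by (intro hyp_grad_unique[OF assms(1)]) (simp add: hyp_inner_def flip: frechet_derivative_at[OF assms(2)])

text \<open>
  The hyperbolic gradient is the Euclidean one divided by the square of the conformal factor, and the
  hyperbolic norm multiplies by that factor once; the powers combine to \<open>n - 1\<close>.
\<close>
lemma flux_eq_euclid_flux:
  fixes x :: "'a::euclidean_space"
  assumes "x \<in> \<H>" "(m has_derivative (\<lambda>h. w \<bullet> h)) (at x)"
  shows "conf_factor x ^ DIM('a) *\<^sub>R flux A m x = euclid_flux A x w"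
proof -
  let ?c = "conf_factor x"
  have c: "?c > 0" by (rule conf_factor_pos[OF assms(1)])
  have n: "hyp_norm x (w /\<^sub>R ?c\<^sup>2) = norm w / ?c"
  proof -
    have "?c\<^sup>2 * ((w /\<^sub>R ?c\<^sup>2) \<bullet> (w /\<^sub>R ?c\<^sup>2)) = (norm w / ?c)\<^sup>2"
      using c by (simp add: power2_norm_eq_inner power_divide) (simp add: field_simps power2_eq_square)
    then show ?thesis unfolding hyp_norm_def hyp_inner_def
      using c by simp
  qed
  have p: "?c ^ DIM('a) = ?c * ?c ^ (DIM('a) - 1)"
    by (metis DIM_positive power_minus_mult mult.commute)
  show ?thesis
  proof (cases "w = 0")
    case True
    then show ?thesis
      unfolding flux_def hyp_grad_gradient[OF assms] by (simp add: euclid_flux_def)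
  next
    case False
    then show ?thesis
      unfolding flux_def hyp_grad_gradient[OF assms] n euclid_flux_def p
      using c by (simp add: field_simps power2_eq_square)
  qed
qed

lemma integral_hyp_volume:
  fixes f :: "'a::euclidean_space \<Rightarrow> real"
  assumes "integrable hyp_volume f"
  shows "integrable lborel (\<lambda>x. indicator \<H> x * (conf_factor x ^ DIM('a) * f x))"
    "(\<integral>x. f x \<partial>hyp_volume) = (\<integral>x. indicator \<H> x * (conf_factor x ^ DIM('a) * f x) \<partial>lborel)"
proof -
  let ?R = "restrict_space lborel (\<H> :: 'a set)"
  have f: "f \<in> borel_measurable ?R"
    using borel_measurable_integrable[OF assms] by (simp add: hyp_volume_def)
  have c: "(\<lambda>x::'a. conf_factor x ^ DIM('a)) \<in> borel_measurable ?R"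
    unfolding conf_factor_def by (intro measurable_restrict_space1) measurable
  have nn: "AE x in ?R. 0 \<le> conf_factor x ^ DIM('a)"
    by (intro AE_I2 zero_le_power less_imp_le conf_factor_pos) (auto simp: space_restrict_space)
  have "integrable ?R (\<lambda>x. conf_factor x ^ DIM('a) *\<^sub>R f x)"
    using assms unfolding hyp_volume_def by (subst (asm) integrable_density[OF f c nn])
  then show "integrable lborel (\<lambda>x. indicator \<H> x * (conf_factor x ^ DIM('a) * f x))"
    by (subst (asm) integrable_restrict_space) auto
  show "(\<integral>x. f x \<partial>hyp_volume) = (\<integral>x. indicator \<H> x * (conf_factor x ^ DIM('a) * f x) \<partial>lborel)"
    unfolding hyp_volume_def by (subst integral_density[OF f c nn], subst integral_restrict_space) auto
qed

lemma test_function_bump: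
  fixes a :: "'a::euclidean_space"
  assumes "0 < e" "cball a e \<subseteq> \<H>"
  shows "test_function (\<lambda>x. flat_exp 0 (bump_arg a e x))"
  unfolding test_function_def smooth_on_def
proof (intro conjI allI exI[of _ "cball a e"] ballI)
  show "Ck_on k \<H> (\<lambda>x. flat_exp 0 (bump_arg a e x))" for k by (rule Ck_on_bump) simp
  fix x assume "x \<in> \<H> - cball a e"
  then have "e\<^sup>2 \<le> (norm (x - a))\<^sup>2" using assms(1) by (intro power_mono) (auto simp: dist_norm norm_minus_commute)
  then have "1 \<le> (norm (x - a))\<^sup>2 / e\<^sup>2" using assms(1) by simp
  then show "flat_exp 0 (bump_arg a e x) = 0"
    by (simp add: flat_exp_def bump_arg_def)
qed (use assms in auto)

text \<open>
  The weak equation for a bump function supported in \<open>cball a e\<close>, rescaled to the unit ball. The scaling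
  leaves a kernel that does not depend on \<open>e\<close>, which prepares the limit \<open>e \<rightarrow> 0\<close>.
\<close>
lemma weak_solution_bump:
  fixes m :: "'a::euclidean_space \<Rightarrow> real"
  assumes w: "has_weak_div (flux A m) (\<lambda>_. 0)"
    and g: "\<And>x. x \<in> \<H> \<Longrightarrow> (m has_derivative (\<lambda>h. g x \<bullet> h)) (at x)"
    and e: "0 < e" "cball a e \<subseteq> \<H>"
  defines "f \<equiv> \<lambda>z. flat_exp 2 (bump_arg 0 1 z) * (euclid_flux A (a + e *\<^sub>R z) (g (a + e *\<^sub>R z)) \<bullet> z)"
  shows "integrable lborel f" "(\<integral>z. f z \<partial>lborel) = 0"
proof -
  let ?\<phi> = "\<lambda>x. flat_exp 0 (bump_arg a e x)"
  let ?k = "\<lambda>x. flat_exp 2 (bump_arg a e x)"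
  let ?Y = "\<lambda>x. euclid_flux A x (g x)"
  let ?h = "\<lambda>x. hyp_inner x (flux A m x) (hyp_grad ?\<phi> x)"
  have d: "(?\<phi> has_derivative (\<lambda>h. ((- 2 / e\<^sup>2 * ?k x) *\<^sub>R (x - a)) \<bullet> h)) (at x)" for x
    using flat_exp_bump_deriv[of 0 a e x] by (simp add: mult_ac flip: numeral_2_eq_2)
  have I: "integrable hyp_volume ?h" "(\<integral>x. ?h x \<partial>hyp_volume) = 0"
    using w test_function_bump[OF e] unfolding has_weak_div_def by auto
  have eq: "indicator \<H> x * (conf_factor x ^ DIM('a) * ?h x) = (- 2 / e\<^sup>2) * (?k x * (?Y x \<bullet> (x - a)))" for x
  proof (cases "x \<in> \<H>")
    case True
    have "?h x = flux A m x \<bullet> ((- 2 / e\<^sup>2 * ?k x) *\<^sub>R (x - a))"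
      using conf_factor_pos[OF True] by (simp add: hyp_grad_gradient[OF True d] hyp_inner_def)
    then have "conf_factor x ^ DIM('a) * ?h x = (conf_factor x ^ DIM('a) *\<^sub>R flux A m x) \<bullet> ((- 2 / e\<^sup>2 * ?k x) *\<^sub>R (x - a))"
      by simp
    then show ?thesis unfolding flux_eq_euclid_flux[OF True g[OF True]] using True by simp
  next
    case False
    then have "x \<notin> cball a e" using e by auto
    then have "e\<^sup>2 \<le> (norm (x - a))\<^sup>2" using e(1) by (intro power_mono) (auto simp: dist_norm norm_minus_commute)
    then have "1 \<le> (norm (x - a))\<^sup>2 / e\<^sup>2" using e(1) by simp
    then have "?k x = 0" by (simp add: flat_exp_def bump_arg_def)
    then show ?thesis using False by simp
  qed
  have J: "integrable lborel (\<lambda>x. (- 2 / e\<^sup>2) * (?k x * (?Y x \<bullet> (x - a))))"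
    "(\<integral>x. (- 2 / e\<^sup>2) * (?k x * (?Y x \<bullet> (x - a))) \<partial>lborel) = 0"
    using integral_hyp_volume[OF I(1)] I(2) unfolding eq by simp_all
  have e0: "e \<noteq> 0" using e by simp
  note K = integral_lborel_affine[OF e0 J(1), of a]
  have b: "bump_arg a e (a + e *\<^sub>R z) = bump_arg 0 1 z" for z
    using e by (simp add: bump_arg_def power_mult_distrib)
  have f: "(- 2 / e\<^sup>2) * (?k (a + e *\<^sub>R z) * (?Y (a + e *\<^sub>R z) \<bullet> (a + e *\<^sub>R z - a))) = (- 2 / e) * f z" for z
    using e unfolding b f_def by (simp add: field_simps power2_eq_square)
  have Z: "integrable lborel (\<lambda>z. (- 2 / e) * f z)" "(\<integral>z. (- 2 / e) * f z \<partial>lborel) = 0"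
    using K J(2) e0 unfolding f by auto
  show "integrable lborel f" "(\<integral>z. f z \<partial>lborel) = 0"
    using integrable_mult_right[OF Z(1), of "- e / 2"] Z(2) e0 by auto
qed

text \<open>
  After subtracting the value at \<open>a\<close>, which integrates to zero against the odd kernel \<open>k(z) z\<close>, and dividing by
  the radius, the integrands converge to \<open>k(z) (T z) \<bullet> z\<close>. Differentiability at the single point \<open>a\<close> gives both
  the pointwise limit and the bound needed for dominated convergence. The limit integral is a positive
  multiple of the trace of \<open>T\<close>.
\<close>
lemma pointwise_divergence_zero:
  fixes Y :: "'a::euclidean_space \<Rightarrow> 'a"
  assumes T: "(Y has_derivative T) (at a)" and e0: "0 < e0"
    and I: "\<And>e. 0 < e \<Longrightarrow> e < e0 \<Longrightarrow> integrable lborel (\<lambda>z. flat_exp 2 (bump_arg 0 1 z) * (Y (a + e *\<^sub>R z) \<bullet> z))"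
      "\<And>e. 0 < e \<Longrightarrow> e < e0 \<Longrightarrow> (\<integral>z. flat_exp 2 (bump_arg 0 1 z) * (Y (a + e *\<^sub>R z) \<bullet> z) \<partial>lborel) = 0"
  shows "(\<Sum>b\<in>Basis. T b \<bullet> b) = 0"
proof -
  define k where "k z = flat_exp 2 (bump_arg (0::'a) 1 z)" for z
  have bT: "bounded_linear T" using T by (rule has_derivative_bounded_linear)
  interpret T: bounded_linear T by fact
  obtain c where c: "c > 0" "(\<integral>z. k z * ((T z + 0) \<bullet> z) \<partial>lborel) = c * (\<Sum>b\<in>Basis. T b \<bullet> b)"
    "integrable lborel (\<lambda>z. k z * ((T z + 0) \<bullet> z))"
    by (rule integral_bump_gradient_linear[OF bounded_linear.linear[OF bT], of 0, folded k_def])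
  have lin0: "linear (\<lambda>z::'a. 0::'a)" by (simp add: linear_iff)
  obtain c' where c': "(\<integral>z. k z * ((0 + Y a) \<bullet> z) \<partial>lborel) = c' * (\<Sum>b\<in>(Basis::'a set). 0 \<bullet> b)"
    "integrable lborel (\<lambda>z. k z * ((0 + Y a) \<bullet> z))"
    by (rule integral_bump_gradient_linear[OF lin0, of "Y a", folded k_def])
  obtain B where B: "B > 0" "\<And>z. norm (T z) \<le> norm z * B" using T.pos_bounded by auto
  obtain d where d: "d > 0" "\<And>y. norm (y - a) < d \<Longrightarrow> norm (Y y - Y a - T (y - a)) \<le> 1 * norm (y - a)"
    using T unfolding has_derivative_at_alt by (metis zero_less_one)
  define \<epsilon> where "\<epsilon> i = (min d e0 / 2) / real (Suc i)" for i
  have \<epsilon>: "0 < \<epsilon> i" "\<epsilon> i < e0" "\<epsilon> i < d" for i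
  proof -
    define \<mu> where "\<mu> = min d e0 / 2"
    have m: "0 < \<mu>" "\<mu> < d" "\<mu> < e0" using d(1) e0 by (auto simp: \<mu>_def min_def)
    have "\<mu> / real (Suc i) \<le> \<mu> / 1"
      using m by (intro divide_left_mono) auto
    moreover have "0 < \<mu> / real (Suc i)" using m by simp
    moreover have "\<epsilon> i = \<mu> / real (Suc i)" by (simp add: \<epsilon>_def \<mu>_def)
    ultimately show "0 < \<epsilon> i" "\<epsilon> i < e0" "\<epsilon> i < d" using m by simp_all
  qed
  have \<epsilon>0: "\<epsilon> \<longlonglongrightarrow> 0"
    unfolding \<epsilon>_def by real_asymp
  define s where "s i z = (k z * (Y (a + \<epsilon> i *\<^sub>R z) \<bullet> z) - k z * ((0 + Y a) \<bullet> z)) / \<epsilon> i" for i z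
  have sI: "integrable lborel (s i)" "(\<integral>z. s i z \<partial>lborel) = 0" for i
    using I[OF \<epsilon>(1,2)] c' unfolding s_def k_def by auto
  have k0: "k z = 0" if "norm z > 1" for z
    using that by (auto simp: k_def bump_arg_def flat_exp_def)
  have knn: "k z \<ge> 0" for z by (simp add: k_def flat_exp_def)
  have kI: "integrable lborel k"
    by (rule integrable_compact_support)
       (use Ck_on_bump[of UNIV 0 2 0 1] k0 in \<open>auto simp: k_def[abs_def]\<close>)
  have s: "s i z = k z * (((Y (a + \<epsilon> i *\<^sub>R z) - Y a) /\<^sub>R \<epsilon> i) \<bullet> z)" for i z
    by (simp add: s_def inner_diff_left right_diff_distrib divide_inverse algebra_simps)
  have bound: "norm (s i z) \<le> k z * (1 + B)" for i z
  proof (cases "norm z > 1")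
    case True then show ?thesis by (simp add: s k0)
  next
    case False
    let ?y = "a + \<epsilon> i *\<^sub>R z"
    have ny: "norm (?y - a) \<le> \<epsilon> i" using False \<epsilon>(1)[of i] by (simp add: mult_left_le)
    then have "norm (?y - a) < d" using \<epsilon>(3)[of i] by simp
    from d(2)[OF this] have "norm (Y ?y - Y a - T (?y - a)) \<le> \<epsilon> i" using ny by simp
    moreover have "norm (T (?y - a)) \<le> \<epsilon> i * B"
      using order_trans[OF B(2)[of "?y - a"] mult_right_mono[OF ny, of B]] B(1) by simp
    ultimately have "norm (Y ?y - Y a) \<le> \<epsilon> i * (1 + B)"
      using norm_triangle_ineq[of "Y ?y - Y a - T (?y - a)" "T (?y - a)"] by (simp add: algebra_simps)
    then have n1: "norm ((Y ?y - Y a) /\<^sub>R \<epsilon> i) \<le> 1 + B"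
      unfolding norm_scaleR using \<epsilon>(1)[of i] by (simp add: pos_divide_le_eq inverse_eq_divide mult.commute)
    have "\<bar>((Y ?y - Y a) /\<^sub>R \<epsilon> i) \<bullet> z\<bar> \<le> norm ((Y ?y - Y a) /\<^sub>R \<epsilon> i) * norm z"
      by (rule Cauchy_Schwarz_ineq2)
    also have "\<dots> \<le> (1 + B) * 1" using n1 False B(1) by (intro mult_mono) auto
    finally show ?thesis unfolding s using knn[of z] by (simp add: abs_mult mult_left_mono)
  qed
  have lim: "(\<lambda>i. s i z) \<longlonglongrightarrow> k z * ((T z + 0) \<bullet> z)" for z
  proof -
    have "((\<lambda>t. Y (a + t *\<^sub>R z)) has_derivative (\<lambda>h. T (h *\<^sub>R z))) (at 0)"
      by (rule has_derivative_compose[where g=Y and f="\<lambda>t. a + t *\<^sub>R z", of "\<lambda>h. h *\<^sub>R z", simplified])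
         (auto intro!: derivative_eq_intros T)
    then have q: "((\<lambda>t. norm (Y (a + t *\<^sub>R z) - Y a - t *\<^sub>R T z) / norm t) \<longlongrightarrow> 0) (at 0)"
      by (simp add: has_derivative_at T.scaleR)
    have eq: "norm (Y (a + t *\<^sub>R z) - Y a - t *\<^sub>R T z) / norm t =
        norm ((Y (a + t *\<^sub>R z) - Y a) /\<^sub>R t - T z)" if "t \<noteq> 0" for t :: real
    proof -
      have "Y (a + t *\<^sub>R z) - Y a - t *\<^sub>R T z = t *\<^sub>R ((Y (a + t *\<^sub>R z) - Y a) /\<^sub>R t - T z)"
        using that by (simp add: scaleR_diff_right)
      then show ?thesis using that by simp
    qed
    have "\<forall>\<^sub>F t in at 0. norm (Y (a + t *\<^sub>R z) - Y a - t *\<^sub>R T z) / norm t =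
        norm ((Y (a + t *\<^sub>R z) - Y a) /\<^sub>R t - T z)"
      using eq unfolding eventually_at_filter by (intro always_eventually) blast
    from Lim_transform_eventually[OF q this]
    have "((\<lambda>t. norm ((Y (a + t *\<^sub>R z) - Y a) /\<^sub>R t - T z)) \<longlongrightarrow> 0) (at 0)" .
    then have "((\<lambda>t. (Y (a + t *\<^sub>R z) - Y a) /\<^sub>R t) \<longlongrightarrow> T z) (at 0)"
      by (simp add: LIM_zero_iff tendsto_norm_zero_iff)
    from filterlim_compose[OF this, of \<epsilon> sequentially]
    have "(\<lambda>i. (Y (a + \<epsilon> i *\<^sub>R z) - Y a) /\<^sub>R \<epsilon> i) \<longlonglongrightarrow> T z"
      using \<epsilon>0 \<epsilon>(1) by (auto simp: filterlim_at less_imp_neq[THEN not_sym])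
    then show ?thesis unfolding s add_0_right by (intro tendsto_intros)
  qed
  have "(\<lambda>i. \<integral>z. s i z \<partial>lborel) \<longlonglongrightarrow> (\<integral>z. k z * ((T z + 0) \<bullet> z) \<partial>lborel)"
    by (rule integral_dominated_convergence[where w="\<lambda>z. k z * (1 + B)"])
       (use sI c(3) kI lim bound in \<open>auto dest: borel_measurable_integrable\<close>)
  then have "c * (\<Sum>b\<in>Basis. T b \<bullet> b) = 0"
    unfolding sI(2) c(2) by (simp add: LIMSEQ_const_iff)
  then show ?thesis using c(1) by simp
qed

lemma smooth_gradient:
  fixes m :: "'a::euclidean_space \<Rightarrow> real"
  assumes "Ck_on 2 \<H> m"
  obtains g where "\<And>x. x \<in> \<H> \<Longrightarrow> (m has_derivative (\<lambda>h. g x \<bullet> h)) (at x)"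
    "\<And>x. x \<in> \<H> \<Longrightarrow> g differentiable (at x)"
proof
  let ?g = "\<lambda>x. \<Sum>b\<in>Basis. frechet_derivative m (at x) b *\<^sub>R b"
  have m: "Ck_on (Suc (Suc 0)) \<H> m" using assms by (simp only: numeral_2_eq_2)
  fix x :: 'a assume x: "x \<in> \<H>"
  then have d: "m differentiable (at x)" using m by auto
  let ?D = "frechet_derivative m (at x)"
  interpret linear ?D using d by (rule linear_frechet_derivative)
  have "?D h = ?g x \<bullet> h" for h
  proof -
    have "?D h = ?D (\<Sum>b\<in>Basis. (h \<bullet> b) *\<^sub>R b)" by (simp add: euclidean_representation)
    then show ?thesis by (simp add: sum scale inner_sum_left inner_commute[of _ h] inner_sum_right mult.commute)
  qed
  then have e: "?D = (\<lambda>h. ?g x \<bullet> h)" by (rule ext)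
  have "(m has_derivative ?D) (at x)" using d frechet_derivative_works by blast
  then show "(m has_derivative (\<lambda>h. ?g x \<bullet> h)) (at x)" by (rule has_derivative_eq_rhs[OF _ e])
  show "?g differentiable (at x)"
    using m x by (intro differentiable_sum differentiable_scaleR) auto
qed

lemma smooth_weak_imp_pointwise_solution:
  fixes m :: "'a::euclidean_space \<Rightarrow> real"
  assumes "smooth_on \<H> m" "has_weak_div (flux A m) (\<lambda>_. 0)"
  shows "pointwise_solution A m"
proof -
  obtain g where g: "\<And>x. x \<in> \<H> \<Longrightarrow> (m has_derivative (\<lambda>h. g x \<bullet> h)) (at x)"
    "\<And>x. x \<in> \<H> \<Longrightarrow> g differentiable (at x)"
    using smooth_gradient[of m] assms(1) unfolding smooth_on_def by metis
  show ?thesis unfolding pointwise_solution_def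
  proof (intro exI[of _ g] conjI ballI allI impI)
    fix x :: 'a and T
    assume x: "x \<in> \<H>" and T: "((\<lambda>z. euclid_flux A z (g z)) has_derivative T) (at x)"
    have e0: "0 < 1 - norm x" using x by simp
    have sub: "cball x e \<subseteq> \<H>" if "e < 1 - norm x" for e
    proof
      fix y assume "y \<in> cball x e"
      then show "y \<in> \<H>" using that norm_triangle_ineq2[of y x] by (auto simp: dist_norm norm_minus_commute)
    qed
    show "(\<Sum>b\<in>Basis. T b \<bullet> b) = 0"
      by (rule pointwise_divergence_zero[OF T e0]; rule weak_solution_bump[OF assms(2) g(1)])
         (use sub in auto)
  qed (use g in auto)
qed

section \<open>Linear functions on the hyperboloid\<close>

lemma conf_factor_deriv:
  fixes x :: "'a::euclidean_space"
  assumes "x \<in> \<H>"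
  shows "((\<lambda>x. conf_factor x ^ k) has_derivative (\<lambda>h. real k * conf_factor x ^ (k + 1) * (x \<bullet> h))) (at x)"
proof -
  have "(norm x)\<^sup>2 < 1" using assms by (simp add: power_less_one_iff)
  then have n: "1 - x \<bullet> x \<noteq> 0" by (simp add: power2_norm_eq_inner)
  have 1: "(conf_factor has_derivative (\<lambda>h. (conf_factor x)\<^sup>2 * (x \<bullet> h))) (at x)"
    unfolding conf_factor_def[abs_def] power2_norm_eq_inner
    using n by (auto intro!: derivative_eq_intros simp: inner_commute power2_eq_square field_simps)
  show ?thesis
  proof (cases k)
    case (Suc j)
    then show ?thesis
      using has_derivative_power[OF 1, of k] by (simp add: power2_eq_square mult_ac)
  qed simp
qed

text \<open>
  In the hyperboloid model a point \<open>x\<close> of the ball becomes \<open>X = ((1 + |x|^2) / (1 - |x|^2), 2 x / (1 - |x|^2))\<close>,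
  and the function below is \<open>\<alpha> X_0 - \<beta> \<bullet> X'\<close>, a general linear function of \<open>X\<close> written with the conformal
  factor.
\<close>
definition lorentz :: "real \<Rightarrow> 'a::euclidean_space \<Rightarrow> 'a \<Rightarrow> real"
  where "lorentz \<alpha> \<beta> x = conf_factor x * (\<alpha> - \<beta> \<bullet> x) - \<alpha>"

text \<open>
  The Euclidean gradient of \<open>lorentz \<alpha> \<beta>\<close> divided by the conformal factor; its Euclidean norm is the
  hyperbolic norm of the hyperbolic gradient.
\<close>
definition lorentz_dir :: "real \<Rightarrow> 'a::euclidean_space \<Rightarrow> 'a \<Rightarrow> 'a"
  where "lorentz_dir \<alpha> \<beta> x = (conf_factor x * (\<alpha> - \<beta> \<bullet> x)) *\<^sub>R x - \<beta>"

lemma lorentz_deriv: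
  assumes "x \<in> \<H>"
  shows "(lorentz \<alpha> \<beta> has_derivative (\<lambda>h. (conf_factor x *\<^sub>R lorentz_dir \<alpha> \<beta> x) \<bullet> h)) (at x)"
  unfolding lorentz_def[abs_def] lorentz_dir_def
  using conf_factor_deriv[OF assms, of 1]
  by (auto intro!: derivative_eq_intros simp: power2_eq_square inner_diff_left algebra_simps)

text \<open>
  The identity \<open>|grad F|^2 = F^2 + \<sigma>\<close>, where \<open>\<sigma>\<close> is the Lorentz square of \<open>(\<alpha>, \<beta>)\<close>.
\<close>
lemma norm_lorentz_dir:
  assumes "x \<in> \<H>"
  shows "lorentz_dir \<alpha> \<beta> x \<bullet> lorentz_dir \<alpha> \<beta> x = (lorentz \<alpha> \<beta> x)\<^sup>2 + ((norm \<beta>)\<^sup>2 - \<alpha>\<^sup>2)"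
proof -
  have "(norm x)\<^sup>2 < 1" using assms by (simp add: power_less_one_iff)
  then have n: "conf_factor x * (x \<bullet> x) = conf_factor x - 2"
    by (simp add: power2_norm_eq_inner conf_factor_def field_simps)
  define L g where "L = conf_factor x" and "g = \<alpha> - \<beta> \<bullet> x"
  have b: "\<beta> \<bullet> x = \<alpha> - g" by (simp add: g_def)
  have "lorentz_dir \<alpha> \<beta> x \<bullet> lorentz_dir \<alpha> \<beta> x = L * g\<^sup>2 * (L * (x \<bullet> x)) - 2 * L * g * (\<beta> \<bullet> x) + \<beta> \<bullet> \<beta>"
    unfolding lorentz_dir_def L_def[symmetric] g_def[symmetric]
    by (simp add: inner_diff_left inner_diff_right inner_commute[of x \<beta>] power2_eq_square algebra_simps)
  also have "\<dots> = (L * g - \<alpha>)\<^sup>2 + (\<beta> \<bullet> \<beta> - \<alpha>\<^sup>2)"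
    unfolding b n[folded L_def] by (simp add: power2_eq_square algebra_simps)
  finally show ?thesis
    unfolding lorentz_def L_def[symmetric] g_def[symmetric] by (simp add: power2_norm_eq_inner)
qed

text \<open>
  The identity \<open>\<Delta> F = n F\<close> for the hyperbolic Laplacian, in Euclidean form.
\<close>
lemma lorentz_field_divergence:
  fixes x :: "'a::euclidean_space"
  assumes "x \<in> \<H>"
  obtains U' where
    "((\<lambda>z. conf_factor z ^ (DIM('a) - 1) *\<^sub>R lorentz_dir \<alpha> \<beta> z) has_derivative U') (at x)"
    "(\<Sum>b\<in>Basis. U' b \<bullet> b) = DIM('a) * conf_factor x ^ DIM('a) * lorentz \<alpha> \<beta> x"
proof
  define k where "k = DIM('a) - 1"
  have n: "DIM('a) = Suc k" by (simp add: k_def)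
  define L g where "L = conf_factor x" and "g = \<alpha> - \<beta> \<bullet> x"
  let ?U' = "\<lambda>h. (real (k + 1) * L ^ (k + 2) * (x \<bullet> h) * g) *\<^sub>R x - (L ^ (k + 1) * (\<beta> \<bullet> h)) *\<^sub>R x
      + (L ^ (k + 1) * g) *\<^sub>R h - (real k * L ^ (k + 1) * (x \<bullet> h)) *\<^sub>R \<beta>"
  have e: "conf_factor z ^ (DIM('a) - 1) *\<^sub>R lorentz_dir \<alpha> \<beta> z =
      (conf_factor z ^ (k + 1) * (\<alpha> - \<beta> \<bullet> z)) *\<^sub>R z - conf_factor z ^ k *\<^sub>R \<beta>" for z
    unfolding k_def[symmetric] by (simp add: lorentz_dir_def scaleR_diff_right mult_ac)
  show "((\<lambda>z. conf_factor z ^ (DIM('a) - 1) *\<^sub>R lorentz_dir \<alpha> \<beta> z) has_derivative ?U') (at x)"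
    unfolding e
    by (rule derivative_eq_intros conf_factor_deriv[OF assms] refl)+
       (simp add: L_def g_def fun_eq_iff algebra_simps)
  have "(norm x)\<^sup>2 < 1" using assms by (simp add: power_less_one_iff)
  then have nx: "L * (x \<bullet> x) = L - 2"
    by (simp add: power2_norm_eq_inner conf_factor_def field_simps L_def)
  have s: "(\<Sum>b\<in>Basis. (u \<bullet> b) * (w \<bullet> b)) = u \<bullet> w" for u w :: 'a by (rule euclidean_inner[symmetric])
  have "(\<Sum>b\<in>Basis. ?U' b \<bullet> b) =
     (\<Sum>b\<in>Basis. real (k + 1) * L ^ (k + 2) * g * ((x \<bullet> b) * (x \<bullet> b)) - L ^ (k + 1) * ((\<beta> \<bullet> b) * (x \<bullet> b))
      + L ^ (k + 1) * g - real k * L ^ (k + 1) * ((x \<bullet> b) * (\<beta> \<bullet> b)))"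
    by (intro sum.cong refl) (simp add: inner_diff_left inner_add_left algebra_simps)
  also have "\<dots> = real (k + 1) * L ^ (k + 1) * g * (L * (x \<bullet> x)) - L ^ (k + 1) * (\<beta> \<bullet> x)
      + real (Suc k) * (L ^ (k + 1) * g) - real k * L ^ (k + 1) * (\<beta> \<bullet> x)"
    by (simp add: sum.distrib sum_subtractf s n inner_commute[of x \<beta>] flip: sum_distrib_left)
  also have "\<dots> = real (Suc k) * L ^ Suc k * (L * g - \<alpha>)"
    unfolding nx by (simp add: g_def algebra_simps)
  finally show "(\<Sum>b\<in>Basis. ?U' b \<bullet> b) = DIM('a) * conf_factor x ^ DIM('a) * lorentz \<alpha> \<beta> x"
    by (simp add: n lorentz_def L_def g_def)
qed

section \<open>The touching principle\<close>

text \<open>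
  By the chain rule the derivative of the flux is affine in the derivative \<open>V'\<close> of the gradient field,
  with coefficients that depend only on \<open>x\<close> and \<open>v\<close>. This is what allows two functions with the same gradient
  at \<open>x\<close> to be compared. The two positivity statements are ellipticity: \<open>c2\<close> is the eigenvalue of the
  coefficient matrix orthogonal to \<open>v\<close>, a multiple of \<open>A\<close>, and \<open>c1 |v|^2 + c2\<close> is the one along \<open>v\<close>, a multiple
  of \<open>A'\<close>.
\<close>
lemma euclid_flux_deriv:
  fixes x v :: "'a::euclidean_space"
  assumes x: "x \<in> \<H>" and v: "v \<noteq> 0"
    and A: "(A has_real_derivative a') (at (norm v / conf_factor x))"
    and pos: "A (norm v / conf_factor x) > 0" "a' > 0"
  obtains c1 c2 l where "c2 > 0" "c1 * (norm v)\<^sup>2 + c2 > 0"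
    "\<And>V V'. V x = v \<Longrightarrow> (V has_derivative V') (at x) \<Longrightarrow>
      ((\<lambda>z. euclid_flux A z (V z)) has_derivative
       (\<lambda>h. (c1 * (v \<bullet> V' h) + l h) *\<^sub>R v + c2 *\<^sub>R V' h)) (at x)"
proof -
  define k where "k = DIM('a) - 1"
  define L N a where "L = conf_factor x" and "N = norm v" and "a = A (N / L)"
  have L: "L > 0" using conf_factor_pos[OF x] by (simp add: L_def)
  have N: "N > 0" using v by (simp add: N_def)
  have a: "a > 0" using pos(1) by (simp add: a_def N_def L_def)
  define c1 where "c1 = L ^ k / L * a' / N\<^sup>2 - L ^ k * a / N ^ 3"
  define c2 where "c2 = L ^ k * a / N"
  define l where "l h = (x \<bullet> h) * (real k * L ^ (k + 1) * a / N - L ^ k * a')" for h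
  show thesis
  proof (rule that[of c2 c1 l])
    show "c2 > 0" using L N a by (simp add: c2_def)
    have "c1 * N\<^sup>2 + c2 = L ^ k / L * a'"
      using L N by (simp add: c1_def c2_def field_simps power2_eq_square power3_eq_cube)
    then show "c1 * (norm v)\<^sup>2 + c2 > 0" using L pos(2) by (simp add: N_def)
    fix V :: "'a \<Rightarrow> 'a" and V' assume Vx: "V x = v" and V: "(V has_derivative V') (at x)"
    have dN: "((\<lambda>z. norm (V z)) has_derivative (\<lambda>h. (v \<bullet> V' h) / N)) (at x)"
      by (rule has_derivative_eq_rhs[OF has_derivative_compose[OF V has_derivative_norm]])
         (use v in \<open>simp_all add: Vx N_def sgn_div_norm inner_commute fun_eq_iff field_simps\<close>)
    have dL: "(conf_factor has_derivative (\<lambda>h. L\<^sup>2 * (x \<bullet> h))) (at x)"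
      using conf_factor_deriv[OF x, of 1] by (simp add: L_def power2_eq_square)
    have dq: "((\<lambda>z. norm (V z) / conf_factor z) has_derivative
        (\<lambda>h. (v \<bullet> V' h) / (N * L) - N * (x \<bullet> h))) (at x)"
      by (rule has_derivative_eq_rhs[OF has_derivative_divide[OF dN dL]])
         (use L N in \<open>auto simp: L_def[symmetric] Vx N_def[symmetric] fun_eq_iff field_simps power2_eq_square\<close>)
    have dA: "((\<lambda>z. A (norm (V z) / conf_factor z)) has_derivative
        (\<lambda>h. a' * ((v \<bullet> V' h) / (N * L) - N * (x \<bullet> h)))) (at x)"
      by (rule has_derivative_compose[OF dq]) (use A in \<open>simp add: Vx has_field_derivative_def\<close>)
    have d\<psi>: "((\<lambda>z. conf_factor z ^ k * (A (norm (V z) / conf_factor z) / norm (V z))) has_derivative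
        (\<lambda>h. c1 * (v \<bullet> V' h) + l h)) (at x)"
      by (rule has_derivative_eq_rhs[OF has_derivative_mult[OF conf_factor_deriv[OF x] has_derivative_divide[OF dA dN]]])
         (use L N in \<open>auto simp: L_def[symmetric] Vx N_def[symmetric] a_def[symmetric] c1_def l_def
             fun_eq_iff field_simps power2_eq_square power3_eq_cube\<close>)
    show "((\<lambda>z. euclid_flux A z (V z)) has_derivative
       (\<lambda>h. (c1 * (v \<bullet> V' h) + l h) *\<^sub>R v + c2 *\<^sub>R V' h)) (at x)"
      unfolding euclid_flux_def k_def[symmetric]
      by (rule has_derivative_eq_rhs[OF has_derivative_scaleR[OF d\<psi> V]])
         (simp add: Vx c2_def fun_eq_iff L_def N_def a_def)
  qed
qed

text \<open>
  The trace of the product of a positive definite matrix with eigenspaces \<open>span v\<close> and its complement, and a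
  matrix with negative semidefinite quadratic form. Applying the quadratic form to the projections of a basis
  to the complement of \<open>v\<close> shows that the trace of \<open>H\<close> is at most its value in the direction of \<open>v\<close>.
\<close>
lemma linear_trace_le:
  fixes H :: "'a::euclidean_space \<Rightarrow> 'a"
  assumes H: "linear H" and neg: "\<And>h. H h \<bullet> h \<le> 0" and v: "v \<noteq> 0"
    and c: "c2 > 0" "c1 * (norm v)\<^sup>2 + c2 > 0"
  shows "(\<Sum>b\<in>Basis. c1 * ((v \<bullet> H b) * (v \<bullet> b)) + c2 * (H b \<bullet> b)) \<le> 0"
proof -
  interpret linear H by fact
  define N2 where "N2 = v \<bullet> v"
  have N2: "N2 > 0" using v by (simp add: N2_def)
  define q where "q = H v \<bullet> v"
  define tr where "tr = (\<Sum>b\<in>Basis. H b \<bullet> b)"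
  have Hv: "H v = (\<Sum>b\<in>Basis. (v \<bullet> b) *\<^sub>R H b)"
    by (subst euclidean_representation[of v, symmetric]) (simp add: sum scale)
  have q1: "(\<Sum>b\<in>Basis. (v \<bullet> H b) * (v \<bullet> b)) = q"
    unfolding q_def Hv by (simp add: inner_sum_left inner_sum_right inner_commute mult.commute)
  have q2: "(\<Sum>b\<in>Basis. (H v \<bullet> b) * (v \<bullet> b)) = q"
    unfolding q_def by (rule euclidean_inner[symmetric])
  have q3: "(\<Sum>b\<in>Basis. (v \<bullet> b) * (v \<bullet> b)) = N2"
    unfolding N2_def by (rule euclidean_inner[symmetric])
  have "(\<Sum>b\<in>Basis. H (b - ((v \<bullet> b) / N2) *\<^sub>R v) \<bullet> (b - ((v \<bullet> b) / N2) *\<^sub>R v)) \<le> 0"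
    by (intro sum_nonpos assms(2))
  also have "(\<Sum>b\<in>Basis. H (b - ((v \<bullet> b) / N2) *\<^sub>R v) \<bullet> (b - ((v \<bullet> b) / N2) *\<^sub>R v)) =
     (\<Sum>b\<in>Basis. H b \<bullet> b - (1 / N2) * ((H v \<bullet> b) * (v \<bullet> b)) - (1 / N2) * ((v \<bullet> H b) * (v \<bullet> b)) + (q / N2\<^sup>2) * ((v \<bullet> b) * (v \<bullet> b)))"
    by (intro sum.cong refl)
       (simp add: diff scale inner_diff_left inner_diff_right q_def inner_commute power2_eq_square algebra_simps)
  also have "\<dots> = tr - q / N2 - q / N2 + q / N2"
    unfolding sum.distrib sum_subtractf sum_distrib_left[symmetric] q1 q2 q3
    using N2 by (simp add: tr_def power2_eq_square)
  finally have t: "tr \<le> q / N2" by simp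
  have "(\<Sum>b\<in>Basis. c1 * ((v \<bullet> H b) * (v \<bullet> b)) + c2 * (H b \<bullet> b)) = c1 * q + c2 * tr"
    by (simp add: sum.distrib q1 tr_def flip: sum_distrib_left)
  also have "\<dots> \<le> c1 * q + c2 * (q / N2)" using mult_left_mono[OF t, of c2] c(1) by simp
  also have "\<dots> = q * ((c1 * N2 + c2) / N2)" using N2 by (simp add: field_simps)
  also have "\<dots> \<le> 0"
    using assms(2)[of v] c(2) N2 by (intro mult_nonpos_nonneg) (auto simp: q_def N2_def power2_norm_eq_inner)
  finally show ?thesis .
qed

lemma local_max_second_derivative:
  fixes f :: "'a::euclidean_space \<Rightarrow> real"
  assumes e: "e > 0" and f: "\<And>z. z \<in> ball x e \<Longrightarrow> (f has_derivative (\<lambda>h. V z \<bullet> h)) (at z)"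
    and V: "(V has_derivative H) (at x)" and mx: "\<And>z. z \<in> ball x e \<Longrightarrow> f z \<le> f x"
  shows "V x = 0" "H h \<bullet> h \<le> 0"
proof -
  have xin: "x \<in> ball x e" using e by simp
  have "(\<lambda>h. V x \<bullet> h) = (\<lambda>h. 0)"
    using differential_zero_maxmin[OF xin open_ball f[OF xin]] mx by blast
  then show V0: "V x = 0" by (metis inner_eq_zero_iff)
  show "H h \<bullet> h \<le> 0"
  proof (rule ccontr)
    assume c: "\<not> ?thesis"
    then have h: "h \<noteq> 0" by auto
    have bl: "bounded_linear H" using V by (rule has_derivative_bounded_linear)
    have "((\<lambda>t. V (x + t *\<^sub>R h)) has_derivative (\<lambda>t. H (t *\<^sub>R h))) (at 0)"
      by (rule has_derivative_compose[where g=V and f="\<lambda>t. x + t *\<^sub>R h", of "\<lambda>t. t *\<^sub>R h", simplified])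
         (auto intro!: derivative_eq_intros V)
    then have "((\<lambda>t. V (x + t *\<^sub>R h) \<bullet> h) has_derivative (\<lambda>t. H (t *\<^sub>R h) \<bullet> h)) (at 0)"
      by (rule has_derivative_inner_left)
    then have "((\<lambda>t. V (x + t *\<^sub>R h) \<bullet> h) has_real_derivative H h \<bullet> h) (at 0)"
      using linear_cmul[OF bounded_linear.linear[OF bl]]
      by (simp add: has_field_derivative_def mult.commute[of _ "H h \<bullet> h"])
    from DERIV_pos_inc_right[OF this] c
    obtain d where d: "d > 0" "\<And>t. 0 < t \<Longrightarrow> t < d \<Longrightarrow> V (x + t *\<^sub>R h) \<bullet> h > 0"
      by (auto simp: V0)
    define t where "t = min (d / 2) (e / (2 * norm h))"
    have t: "0 < t" "t < d" using d(1) e h by (auto simp: t_def)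
    have "t * norm h \<le> e / (2 * norm h) * norm h" unfolding t_def by (intro mult_right_mono) auto
    then have tn: "t * norm h < e" using e h by simp
    have inb: "x + s *\<^sub>R h \<in> ball x e" if "0 \<le> s" "s \<le> t" for s
      using that tn mult_right_mono[OF that(2), of "norm h"] by (simp add: dist_norm)
    have "((\<lambda>s. f (x + s *\<^sub>R h)) has_real_derivative V (x + s *\<^sub>R h) \<bullet> h) (at s)" if "0 \<le> s" "s \<le> t" for s
    proof -
      have "((\<lambda>s. f (x + s *\<^sub>R h)) has_derivative (\<lambda>u. V (x + s *\<^sub>R h) \<bullet> (u *\<^sub>R h))) (at s)"
        by (rule has_derivative_compose[where g=f and f="\<lambda>t. x + t *\<^sub>R h", of "\<lambda>t. t *\<^sub>R h", simplified])
           (use f[OF inb[OF that]] in \<open>auto intro!: derivative_eq_intros\<close>)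
      then show ?thesis by (simp add: has_field_derivative_def mult.commute[of _ "V _ \<bullet> h"])
    qed
    from MVT2[OF t(1) this] obtain \<xi> where \<xi>: "0 < \<xi>" "\<xi> < t"
      "f (x + t *\<^sub>R h) - f x = t * (V (x + \<xi> *\<^sub>R h) \<bullet> h)" by auto
    have "V (x + \<xi> *\<^sub>R h) \<bullet> h > 0" using d(2) \<xi> t by auto
    then have "f (x + t *\<^sub>R h) > f x" using \<xi>(3) t(1) by (metis diff_gt_0_iff_gt mult_pos_pos)
    then show False using mx[OF inb[of t]] t by auto
  qed
qed

text \<open>
  The assumption on \<open>\<kappa>\<close> says that the flux of \<open>G \<circ> F\<close> has negative divergence at \<open>x\<close>. At a local maximum of
  \<open>m - G \<circ> F\<close> the gradients agree and the difference of the Hessians is negative semidefinite, so by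
  ellipticity the flux of \<open>m\<close> would have negative divergence as well.
\<close>
lemma strict_supersolution_not_touched:
  fixes x :: "'a::euclidean_space"
  defines "n \<equiv> real DIM('a)"
  assumes sol: "pointwise_solution A m" and x: "x \<in> \<H>"
    and A: "\<And>s. s > 0 \<Longrightarrow> (A has_real_derivative A' s) (at s)" "\<And>s. s > 0 \<Longrightarrow> A' s > 0" "\<And>s. s > 0 \<Longrightarrow> A s > 0"
    and \<sigma>: "\<sigma> = (norm \<beta>)\<^sup>2 - \<alpha>\<^sup>2"
    and I: "open I" "lorentz \<alpha> \<beta> x \<in> I" and \<tau>: "\<tau> = 1 \<or> \<tau> = - 1"
    and G: "\<And>t. t \<in> I \<Longrightarrow> (G has_real_derivative \<tau> * h t) (at t)"
    and h: "\<And>t. t \<in> I \<Longrightarrow> h t > 0" "\<And>t. t \<in> I \<Longrightarrow> t\<^sup>2 + \<sigma> > 0"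
      "\<And>t. t \<in> I \<Longrightarrow> A (h t * sqrt (t\<^sup>2 + \<sigma>)) = \<kappa> t"
    and h': "(h has_real_derivative h') (at (lorentz \<alpha> \<beta> x))"
    and \<kappa>': "(\<kappa> has_real_derivative \<kappa>') (at (lorentz \<alpha> \<beta> x))"
    and strict: "\<tau> * (\<kappa>' * ((lorentz \<alpha> \<beta> x)\<^sup>2 + \<sigma>) + (n - 1) * \<kappa> (lorentz \<alpha> \<beta> x) * lorentz \<alpha> \<beta> x) < 0"
    and e: "e > 0" "\<And>z. z \<in> ball x e \<Longrightarrow> z \<in> \<H> \<Longrightarrow> m z - G (lorentz \<alpha> \<beta> z) \<le> m x - G (lorentz \<alpha> \<beta> x)"
  shows False
proof -
  let ?F = "lorentz \<alpha> \<beta>"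
  let ?P = "lorentz_dir \<alpha> \<beta>"
  define s where "s t = sqrt (t\<^sup>2 + \<sigma>)" for t
  obtain g where g: "\<And>x. x \<in> \<H> \<Longrightarrow> (m has_derivative (\<lambda>h. g x \<bullet> h)) (at x)"
    "\<And>x. x \<in> \<H> \<Longrightarrow> g differentiable (at x)"
    "\<And>x T. x \<in> \<H> \<Longrightarrow> g x \<noteq> 0 \<Longrightarrow> ((\<lambda>z. euclid_flux A z (g z)) has_derivative T) (at x) \<Longrightarrow>
        (\<Sum>b\<in>Basis. T b \<bullet> b) = 0"
    using sol unfolding pointwise_solution_def by blast
  have dF: "(?F has_derivative (\<lambda>h. (conf_factor z *\<^sub>R ?P z) \<bullet> h)) (at z)" if "z \<in> \<H>" for z
    by (rule lorentz_deriv[OF that])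
  have "isCont ?F x" using dF[OF x] has_derivative_continuous by blast
  then have "\<forall>\<^sub>F z in at x. ?F z \<in> I"
    using topological_tendstoD[OF _ I] by (simp add: isCont_def)
  then have "\<forall>\<^sub>F z in nhds x. ?F z \<in> I"
    unfolding eventually_at_filter by eventually_elim (use I(2) in auto)
  moreover have "\<forall>\<^sub>F z in nhds x. z \<in> \<H>" using x by (intro eventually_nhds_in_open) auto
  ultimately have "\<forall>\<^sub>F z in nhds x. z \<in> \<H> \<and> ?F z \<in> I" by eventually_elim auto
  then obtain d where d: "d > 0" "\<And>z. z \<in> ball x d \<Longrightarrow> z \<in> \<H>" "\<And>z. z \<in> ball x d \<Longrightarrow> ?F z \<in> I"
    by (auto simp: eventually_nhds_metric dist_commute)
  \<comment> \<open>\<open>W\<close> is the Euclidean gradient of \<open>G \<circ> F\<close>.\<close>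
  define W where "W z = (\<tau> * h (?F z)) *\<^sub>R (conf_factor z *\<^sub>R ?P z)" for z
  have dW: "((\<lambda>z. G (?F z)) has_derivative (\<lambda>h. W z \<bullet> h)) (at z)" if "z \<in> ball x d" for z
    using has_derivative_compose[OF dF[OF d(2)[OF that]] G[OF d(3)[OF that], unfolded has_field_derivative_def]]
    by (simp add: W_def mult.assoc)
  obtain g' where g': "(g has_derivative g') (at x)" using g(2)[OF x] by (auto simp: differentiable_def)
  have dC: "(conf_factor has_derivative (\<lambda>h. (conf_factor x)\<^sup>2 * (x \<bullet> h))) (at x)"
    using conf_factor_deriv[OF x, of 1] by (simp add: power2_eq_square)
  have "W differentiable (at x)"
  proof -
    have "(\<lambda>z. h (?F z)) differentiable (at x)"
      using has_derivative_compose[OF dF[OF x] h'[unfolded has_field_derivative_def]]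
      by (auto simp: differentiable_def)
    moreover have "conf_factor differentiable (at x)" using dC by (auto simp: differentiable_def)
    ultimately show ?thesis unfolding W_def[abs_def] lorentz_dir_def by (intro derivative_intros) auto
  qed
  then obtain W' where W': "(W has_derivative W') (at x)" by (auto simp: differentiable_def)
  note mx = local_max_second_derivative[where e="min d e" and f="\<lambda>z. m z - G (?F z)" and x=x
      and V="\<lambda>z. g z - W z" and H="\<lambda>h. g' h - W' h"]
  have mx1: "min d e > 0" using d e by simp
  have mx2: "((\<lambda>z. m z - G (?F z)) has_derivative (\<lambda>h. (g z - W z) \<bullet> h)) (at z)" if "z \<in> ball x (min d e)" for z
    unfolding inner_diff_left by (rule has_derivative_diff[OF g(1) dW]) (use that d in auto)
  have mx3: "((\<lambda>z. g z - W z) has_derivative (\<lambda>h. g' h - W' h)) (at x)"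
    by (rule has_derivative_diff[OF g' W'])
  have mx4: "m z - G (?F z) \<le> m x - G (?F x)" if "z \<in> ball x (min d e)" for z
    using that d e by auto
  have gW: "g x = W x" using mx(1)[OF mx1 mx2 mx3 mx4] by simp
  have neg: "(g' h - W' h) \<bullet> h \<le> 0" for h using mx(2)[OF mx1 mx2 mx3 mx4] by simp
  have sp: "s (?F z) > 0" if "z \<in> ball x d" for z using h(2)[OF d(3)[OF that]] by (simp add: s_def)
  have nP: "norm (?P z) = s (?F z)" if "z \<in> ball x d" for z
    unfolding s_def norm_eq_sqrt_inner norm_lorentz_dir[OF d(2)[OF that]] \<sigma> ..
  have \<tau>1: "\<bar>\<tau>\<bar> = 1" using \<tau> by auto
  have nW: "norm (W z) = h (?F z) * conf_factor z * s (?F z)" if "z \<in> ball x d" for z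
    using h(1)[OF d(3)[OF that]] conf_factor_pos[OF d(2)[OF that]] \<tau>1
    by (simp add: W_def abs_mult nP[OF that])
  have nW2: "norm (W z) / conf_factor z = h (?F z) * s (?F z)" if "z \<in> ball x d" for z
    using conf_factor_pos[OF d(2)[OF that]] by (simp add: nW[OF that])
  have xd: "x \<in> ball x d" using d by simp
  have W0: "W x \<noteq> 0"
    using nW[OF xd] h(1)[OF d(3)[OF xd]] conf_factor_pos[OF x] sp[OF xd] by auto
  have hs: "h (?F x) * s (?F x) > 0" using h(1)[OF d(3)[OF xd]] sp[OF xd] by simp
  obtain c1 c2 l where c: "c2 > 0" "c1 * (norm (W x))\<^sup>2 + c2 > 0"
    "\<And>V V'. V x = W x \<Longrightarrow> (V has_derivative V') (at x) \<Longrightarrow>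
      ((\<lambda>z. euclid_flux A z (V z)) has_derivative
       (\<lambda>h. (c1 * (W x \<bullet> V' h) + l h) *\<^sub>R W x + c2 *\<^sub>R V' h)) (at x)"
    by (rule euclid_flux_deriv[OF x W0, of A "A' (h (?F x) * s (?F x))"])
       (use A hs in \<open>auto simp: nW2[OF xd]\<close>)
  let ?div = "\<lambda>V'. \<Sum>b\<in>Basis. ((c1 * (W x \<bullet> V' b) + l b) *\<^sub>R W x + c2 *\<^sub>R V' b) \<bullet> b"
  have div_g: "?div g' = 0"
    by (rule g(3)[OF x _ c(3)[OF gW g']]) (use gW W0 in simp)
  have "linear (\<lambda>h. g' h - W' h)"
    using mx3 by (rule has_derivative_linear)
  from linear_trace_le[OF this neg W0 c(1,2)]
  have "?div g' - ?div W' \<le> 0"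
    by (simp add: sum_subtractf[symmetric] inner_add_left inner_diff_right inner_diff_left algebra_simps)
  then have div_W: "?div W' \<ge> 0" using div_g by simp
  obtain U' where U: "((\<lambda>z. conf_factor z ^ (DIM('a) - 1) *\<^sub>R ?P z) has_derivative U') (at x)"
    "(\<Sum>b\<in>Basis. U' b \<bullet> b) = DIM('a) * conf_factor x ^ DIM('a) * ?F x"
    by (rule lorentz_field_divergence[OF x])
  \<comment> \<open>The flux of \<open>G \<circ> F\<close> is a function of \<open>F\<close> times a field of known divergence, so its divergence can be computed a second time, independently of \<open>h\<close>.\<close>
  define r where "r t = \<tau> * \<kappa> t / s t" for t
  have hA: "A (h (?F z) * s (?F z)) = \<kappa> (?F z)" if "z \<in> ball x d" for z
    using h(3)[OF d(3)[OF that]] by (simp add: s_def)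
  have fW: "euclid_flux A z (W z) = r (?F z) *\<^sub>R (conf_factor z ^ (DIM('a) - 1) *\<^sub>R ?P z)" if "z \<in> ball x d" for z
    using h(1)[OF d(3)[OF that]] conf_factor_pos[OF d(2)[OF that]] sp[OF that]
    unfolding euclid_flux_def nW2[OF that] nW[OF that]
    unfolding W_def r_def by (simp add: hA[OF that])
  define S K where "S = s (?F x)" and "K = \<kappa> (?F x)"
  have S: "S > 0" "S\<^sup>2 = (?F x)\<^sup>2 + \<sigma>"
    using sp[OF xd] h(2)[OF d(3)[OF xd]] by (simp_all add: S_def s_def)
  define r' where "r' = \<tau> * (\<kappa>' / S - K * ?F x / S ^ 3)"
  have ds: "(s has_real_derivative ?F x / S) (at (?F x))"
    unfolding s_def[abs_def] S_def
    using h(2)[OF d(3)[OF xd]] by (auto intro!: derivative_eq_intros simp: field_simps)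
  have "(r has_real_derivative r') (at (?F x))"
    unfolding r_def[abs_def]
    by (rule DERIV_cong[OF DERIV_divide[OF DERIV_cmult[OF \<kappa>'] ds]])
       (use S(1) in \<open>auto simp: r'_def S_def[symmetric] K_def[symmetric] field_simps power2_eq_square power3_eq_cube\<close>)
  from has_derivative_compose[OF dF[OF x] this[unfolded has_field_derivative_def]]
  have dr: "((\<lambda>z. r (?F z)) has_derivative (\<lambda>h. r' * ((conf_factor x *\<^sub>R ?P x) \<bullet> h))) (at x)" .
  have "((\<lambda>z. r (?F z) *\<^sub>R (conf_factor z ^ (DIM('a) - 1) *\<^sub>R ?P z)) has_derivative
     (\<lambda>h. r (?F x) *\<^sub>R U' h + (r' * ((conf_factor x *\<^sub>R ?P x) \<bullet> h)) *\<^sub>R (conf_factor x ^ (DIM('a) - 1) *\<^sub>R ?P x))) (at x)"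
    (is "(_ has_derivative ?D) _")
    by (rule has_derivative_scaleR[OF dr U(1)])
  then have "((\<lambda>z. euclid_flux A z (W z)) has_derivative ?D) (at x)"
    by (rule has_derivative_transform_within_open[OF _ open_ball xd]) (simp add: fW)
  with c(3)[OF refl W'] have "?div W' = (\<Sum>b\<in>Basis. ?D b \<bullet> b)"
    by (metis (no_types, lifting) has_derivative_unique)
  also have "\<dots> = r (?F x) * (\<Sum>b\<in>Basis. U' b \<bullet> b) +
      r' * (conf_factor x * conf_factor x ^ (DIM('a) - 1)) * (\<Sum>b\<in>Basis. (?P x \<bullet> b) * (?P x \<bullet> b))"
    by (simp add: inner_add_left sum.distrib sum_distrib_left mult_ac)
  also have "(\<Sum>b\<in>Basis. (?P x \<bullet> b) * (?P x \<bullet> b)) = S\<^sup>2"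
    unfolding S(2) \<sigma> norm_lorentz_dir[OF x, symmetric] by (rule euclidean_inner[symmetric])
  also have "conf_factor x * conf_factor x ^ (DIM('a) - 1) = conf_factor x ^ DIM('a)"
    by (metis DIM_positive power_minus_mult mult.commute)
  also have "r (?F x) * (\<Sum>b\<in>Basis. U' b \<bullet> b) + r' * conf_factor x ^ DIM('a) * S\<^sup>2 =
      conf_factor x ^ DIM('a) / S * (\<tau> * (\<kappa>' * S\<^sup>2 + (n - 1) * K * ?F x))"
    unfolding U(2) r_def r'_def n_def S_def[symmetric] K_def[symmetric]
    using S(1) by (simp add: field_simps power2_eq_square power3_eq_cube)
  finally have "?div W' = conf_factor x ^ DIM('a) / S * (\<tau> * (\<kappa>' * S\<^sup>2 + (n - 1) * K * ?F x))" .
  moreover have "\<tau> * (\<kappa>' * S\<^sup>2 + (n - 1) * K * ?F x) < 0"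
    using strict by (simp add: S(2) K_def)
  moreover have "conf_factor x ^ DIM('a) / S > 0" using S(1) conf_factor_pos[OF x] by simp
  ultimately have "?div W' < 0"
    using mult_pos_neg by (metis (no_types, lifting))
  with div_W show False by simp
qed

section \<open>The inverse of the flux law\<close>

locale flux_law =
  fixes A A' :: "real \<Rightarrow> real"
  assumes A_deriv: "\<And>s. s > 0 \<Longrightarrow> (A has_real_derivative A' s) (at s)"
    and A'_pos: "\<And>s. s > 0 \<Longrightarrow> A' s > 0"
    and A_zero: "A 0 = 0"
    and A_cont: "continuous_on {0..} A"
begin

lemma A_less: "0 \<le> s \<Longrightarrow> s < t \<Longrightarrow> A s < A t"
proof (rule DERIV_pos_imp_increasing_open[where f=A])
  assume "0 \<le> s"
  then show "continuous_on {s..t} A" by (auto intro: continuous_on_subset[OF A_cont])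
  show "\<exists>y. (A has_real_derivative y) (at x) \<and> 0 < y" if "s < x" for x
    using A_deriv[of x] A'_pos[of x] that \<open>0 \<le> s\<close> by auto
qed

lemma A_pos: "s > 0 \<Longrightarrow> A s > 0"
  using A_less[of 0 s] A_zero by simp

definition A_inv :: "real \<Rightarrow> real"
  where "A_inv = inv_into {0..} A"

lemma inj_A: "inj_on A {0..}"
  by (rule inj_onI) (metis A_less atLeast_iff less_irrefl linorder_neqE_linordered_idom)

lemma A_inv_A: "s \<ge> 0 \<Longrightarrow> A_inv (A s) = s"
  unfolding A_inv_def by (intro inv_into_f_f inj_A) auto

lemma A_inv:
  assumes "0 \<le> t" "t \<le> A s" "0 \<le> s"
  shows "A (A_inv t) = t" "0 \<le> A_inv t" "A_inv t \<le> s" "0 < t \<Longrightarrow> 0 < A_inv t"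
proof -
  have "\<exists>u\<ge>0. u \<le> s \<and> A u = t"
    using assms A_zero by (intro IVT') (auto intro: continuous_on_subset[OF A_cont])
  then obtain u where "0 \<le> u" "u \<le> s" "A u = t" by auto
  then have "A_inv t = u" using A_inv_A by auto
  then show "A (A_inv t) = t" "0 \<le> A_inv t" "A_inv t \<le> s" "0 < t \<Longrightarrow> 0 < A_inv t"
    using \<open>0 \<le> u\<close> \<open>u \<le> s\<close> \<open>A u = t\<close> A_zero by (auto simp: less_le)
qed

lemma A_inv_deriv:
  assumes t: "0 < t" "t < A s" and s: "0 \<le> s"
  shows "(A_inv has_real_derivative inverse (A' (A_inv t))) (at t)"
proof -
  have u: "A (A_inv t) = t" "0 < A_inv t" using A_inv[of t s] assms by auto
  have "isCont A_inv (A (A_inv t))"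
  proof (rule isCont_inverse_function[where f=A and x="A_inv t" and d="A_inv t / 2"])
    show "0 < A_inv t / 2" using u by simp
    fix z assume z: "\<bar>z - A_inv t\<bar> \<le> A_inv t / 2"
    have "z > 0" using abs_le_D2[OF z] u(2) by (simp add: field_simps)
    then show "A_inv (A z) = z" "isCont A z"
      using A_inv_A[of z] DERIV_isCont[OF A_deriv] by auto
  qed
  then have c: "isCont A_inv t" by (simp add: u)
  show ?thesis
  proof (rule DERIV_inverse_function[OF _ _ t _ c])
    show "(A has_real_derivative A' (A_inv t)) (at (A_inv t))" by (rule A_deriv[OF u(2)])
    show "A' (A_inv t) \<noteq> 0" using A'_pos[OF u(2)] by simp
    show "A (A_inv y) = y" if "0 < y" "y < A s" for y using A_inv(1)[of y s] that s by auto
  qed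
qed

end

section \<open>Comparison\<close>

text \<open>
  The set \<open>K\<close> may reach the sphere at infinity, where \<open>w\<close> has no values. There \<open>m \<le> c \<le> w\<close>, so if \<open>m - w\<close> took a
  positive value \<open>d\<close>, its values that are at least \<open>d\<close> would all lie in the set \<open>m \<ge> c + d\<close>, which is compact and
  stays away from the sphere. The maximum is thus attained at a point of hyperbolic space.
\<close>
lemma comparison:
  fixes m w :: "'a::euclidean_space \<Rightarrow> real"
  assumes K: "compact K" "K \<subseteq> cball 0 1" and m: "continuous_on K m"
    and w: "continuous_on (K \<inter> ball 0 1) w" "\<And>x. x \<in> K \<inter> ball 0 1 \<Longrightarrow> c \<le> w x"
    and bd: "\<And>x. x \<in> K \<Longrightarrow> norm x = 1 \<Longrightarrow> m x \<le> c"
    and nomax: "\<And>x. x \<in> K \<inter> ball 0 1 \<Longrightarrow> w x < m x \<Longrightarrow>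
      (\<And>z. z \<in> K \<inter> ball 0 1 \<Longrightarrow> m z - w z \<le> m x - w x) \<Longrightarrow> False"
    and x: "x \<in> K" "norm x < 1"
  shows "m x \<le> w x"
proof (rule ccontr)
  assume neg: "\<not> m x \<le> w x"
  define d where "d = m x - w x"
  have d: "d > 0" using neg by (simp add: d_def)
  define L where "L = {z \<in> K. m z \<ge> c + d}"
  have "L = K \<inter> m -` {c + d..}" by (auto simp: L_def)
  then have "closedin (top_of_set K) L"
    using continuous_closedin_preimage[OF m closed_atLeast] by simp
  then have cL: "compact L" using K(1) closedin_compact by blast
  have xL: "x \<in> L" using w(2)[of x] x by (auto simp: L_def d_def)
  have LH: "L \<subseteq> K \<inter> ball 0 1"
  proof
    fix z assume "z \<in> L"
    then have z: "z \<in> K" "m z \<ge> c + d" by (auto simp: L_def)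
    then have "norm z \<noteq> 1" using bd[of z] d by auto
    then show "z \<in> K \<inter> ball 0 1" using z(1) K(2) by (auto simp: subset_iff dist_norm)
  qed
  have "continuous_on L (\<lambda>z. m z - w z)"
    using LH by (intro continuous_intros continuous_on_subset[OF m] continuous_on_subset[OF w(1)]) auto
  then obtain z where z: "z \<in> L" "\<And>y. y \<in> L \<Longrightarrow> m y - w y \<le> m z - w z"
    using continuous_attains_sup[OF cL] xL by blast
  have dz: "d \<le> m z - w z" using z(2)[OF xL] by (simp add: d_def)
  show False
  proof (rule nomax[of z])
    show "z \<in> K \<inter> ball 0 1" using z(1) LH by auto
    show "w z < m z" using dz d by simp
    fix y assume y: "y \<in> K \<inter> ball 0 1"
    show "m y - w y \<le> m z - w z"
    proof (cases "y \<in> L")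
      case False
      then have "m y < c + d" using y by (auto simp: L_def)
      then show ?thesis using w(2)[OF y] dz by simp
    qed (rule z(2))
  qed
qed

section \<open>The hyperplane barrier\<close>

context flux_law
begin

text \<open>
  The function \<open>G(t) = \<integral>\<^sub>t\<^sup>\<infinity> h\<close>. The exact solution constant on hypersurfaces equidistant from a hyperplane has
  \<open>\<kappa>\<close> proportional to \<open>(1 + t^2)^(-(n-1)/2)\<close>. The choice \<open>2 K\<^sub>0 / sqrt (4 + t^2)\<close> decreases at a smaller relative rate
  for every \<open>n \<ge> 2\<close>, which makes the supersolution strict. It differs from \<open>K\<^sub>0\<close> by a term of order \<open>t^2\<close> near
  \<open>t = 0\<close>, which transfers the divergence of the given integral to \<open>\<integral> h\<close>, and it decays like \<open>1 / t\<close> at infinity, which makes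
  \<open>h\<close> integrable there.
\<close>
lemma hyperplane_barrier:
  assumes K0: "K\<^sub>0 > 0" and reach: "\<And>t. t < K\<^sub>0 \<Longrightarrow> \<exists>s\<ge>0. t < A s"
    and q: "q > 0" "\<delta> > 0" "D > 0" "\<And>s. s \<in> {0<..\<delta>} \<Longrightarrow> A s > D * s powr q"
    and inf: "(\<integral>\<^sup>+t\<in>{0..<K\<^sub>0}. ennreal (A_inv t / sqrt (K\<^sub>0 - t)) \<partial>lborel) = \<infinity>"
  defines "\<kappa> \<equiv> \<lambda>t. 2 * K\<^sub>0 / sqrt (4 + t\<^sup>2)"
  obtains G h h' where
    "\<And>t. t > 0 \<Longrightarrow> (G has_real_derivative - h t) (at t)"
    "\<And>t. t > 0 \<Longrightarrow> h t > 0"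
    "\<And>t. t > 0 \<Longrightarrow> (h has_real_derivative h' t) (at t)"
    "\<And>t. t > 0 \<Longrightarrow> A (h t * sqrt (t\<^sup>2 + 1)) = \<kappa> t"
    "\<And>t. t > 0 \<Longrightarrow> G t > 0"
    "(G \<longlongrightarrow> 0) at_top"
    "filterlim G at_top (at_right 0)"
proof -
  define h where "h t = A_inv (\<kappa> t) / sqrt (t\<^sup>2 + 1)" for t
  define \<kappa>' where "\<kappa>' t = - (2 * K\<^sub>0 * t / (sqrt (4 + t\<^sup>2)) ^ 3)" for t
  have \<kappa>0: "0 < \<kappa> t" for t unfolding \<kappa>_def using K0 by (simp add: add_pos_nonneg)
  have \<kappa>K: "\<kappa> t < K\<^sub>0" if "t > 0" for t
  proof -
    have "sqrt (4 + t\<^sup>2) > sqrt (2\<^sup>2)" using that by (intro real_sqrt_less_mono) simp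
    then have "sqrt (4 + t\<^sup>2) > 2" by simp
    then have "2 * K\<^sub>0 < K\<^sub>0 * sqrt (4 + t\<^sup>2)" "0 < sqrt (4 + t\<^sup>2)" using K0 by (simp, linarith)
    then show ?thesis unfolding \<kappa>_def by (simp only: pos_divide_less_eq)
  qed
  have \<kappa>d: "(\<kappa> has_real_derivative \<kappa>' t) (at t)" for t
  proof -
    have p: "4 + t\<^sup>2 > 0" by (simp add: add_pos_nonneg)
    then show ?thesis unfolding \<kappa>_def \<kappa>'_def
      by (auto intro!: derivative_eq_intros simp: field_simps power2_eq_square power3_eq_cube)
  qed
  have Ai\<kappa>: "A (A_inv (\<kappa> t)) = \<kappa> t" "A_inv (\<kappa> t) > 0"
    "(A_inv has_real_derivative inverse (A' (A_inv (\<kappa> t)))) (at (\<kappa> t))" if "t > 0" for t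
  proof -
    obtain s where "s \<ge> 0" "\<kappa> t < A s" using reach \<kappa>K[OF \<open>t > 0\<close>] by blast
    then show "A (A_inv (\<kappa> t)) = \<kappa> t" "A_inv (\<kappa> t) > 0"
      "(A_inv has_real_derivative inverse (A' (A_inv (\<kappa> t)))) (at (\<kappa> t))"
      using A_inv[of "\<kappa> t" s] A_inv_deriv[of "\<kappa> t" s] \<kappa>0[of t] by auto
  qed
  have s1: "sqrt (t\<^sup>2 + 1) > 0" for t :: real by (simp add: add_nonneg_pos)
  have hpos: "h t > 0" if "t > 0" for t unfolding h_def using Ai\<kappa>(2)[OF that] s1 by simp
  have hA: "A (h t * sqrt (t\<^sup>2 + 1)) = \<kappa> t" if "t > 0" for t
    using Ai\<kappa>(1)[OF that] s1[of t] by (simp add: h_def)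
  have "\<exists>D. (h has_real_derivative D) (at t)" if "t > 0" for t
  proof -
    have 1: "((\<lambda>t. A_inv (\<kappa> t)) has_real_derivative inverse (A' (A_inv (\<kappa> t))) * \<kappa>' t) (at t)"
      by (rule DERIV_chain2[OF Ai\<kappa>(3)[OF that] \<kappa>d])
    have 2: "((\<lambda>t. sqrt (t\<^sup>2 + 1)) has_real_derivative t / sqrt (t\<^sup>2 + 1)) (at t)"
      using s1[of t] by (auto intro!: derivative_eq_intros simp: field_simps)
    show ?thesis unfolding h_def[abs_def]
      by (rule exI, rule DERIV_divide[OF 1 2]) (use s1[of t] in simp)
  qed
  then obtain h' where h': "\<And>t. t > 0 \<Longrightarrow> (h has_real_derivative h' t) (at t)" by metis
  obtain G0 where G0: "\<And>t. t > 0 \<Longrightarrow> (G0 has_real_derivative h t) (at t)"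
  proof -
    have "\<exists>F. \<forall>x::real. 0 < ereal x \<longrightarrow> ereal x < \<infinity> \<longrightarrow> (F has_vector_derivative h x) (at x)"
      by (rule einterval_antiderivative) (auto intro: DERIV_isCont[OF h'])
    then show thesis using that by (auto simp: has_real_derivative_iff_has_vector_derivative)
  qed
  have G0_less: "G0 s < G0 t" if "0 < s" "s < t" for s t
  proof (rule DERIV_pos_imp_increasing[OF that(2)])
    fix x assume "s \<le> x"
    then have "x > 0" using that by simp
    then show "\<exists>y. (G0 has_real_derivative y) (at x) \<and> 0 < y"
      using G0 hpos by blast
  qed
  have G0_le: "G0 s \<le> G0 t" if "0 < s" "s \<le> t" for s t
    using G0_less[of s t] that by (cases "s = t") auto
  \<comment> \<open>The power lower bound for \<open>A\<close> gives \<open>h t = O(t powr (- 1 / q - 1))\<close>, so a primitive of \<open>h\<close> is bounded above.\<close>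
  obtain B where B: "\<And>t. t > 0 \<Longrightarrow> G0 t \<le> B"
  proof -
    define C where "C = (2 * K\<^sub>0 / D) powr (1 / q)"
    define T where "T = 2 * K\<^sub>0 / A \<delta>"
    have Ad: "A \<delta> > 0" using A_pos q by simp
    have T: "T > 0" using K0 Ad by (simp add: T_def)
    have hb: "h t \<le> C * t powr (- 1 / q - 1)" if t: "t \<ge> T" for t
    proof -
      have t0: "t > 0" using t T by simp
      have "sqrt (t\<^sup>2) \<le> sqrt (4 + t\<^sup>2)" by (intro real_sqrt_le_mono) simp
      then have "t \<le> sqrt (4 + t\<^sup>2)" using t0 by simp
      then have k: "\<kappa> t \<le> 2 * K\<^sub>0 / t" unfolding \<kappa>_def
        using t0 K0 by (intro divide_left_mono mult_pos_pos) (auto simp: add_pos_nonneg)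
      also have "\<dots> \<le> A \<delta>" using t t0 Ad K0 by (simp add: T_def field_simps)
      finally have "\<kappa> t \<le> A \<delta>" .
      then have u: "0 < A_inv (\<kappa> t)" "A_inv (\<kappa> t) \<le> \<delta>" "A (A_inv (\<kappa> t)) = \<kappa> t"
        using A_inv[of "\<kappa> t" \<delta>] \<kappa>0[of t] q by auto
      then have "D * A_inv (\<kappa> t) powr q \<le> 2 * K\<^sub>0 / t" using q(4)[of "A_inv (\<kappa> t)"] k by simp
      then have "A_inv (\<kappa> t) powr q \<le> 2 * K\<^sub>0 / D / t" using q(3) t0 by (simp add: field_simps)
      then have "(A_inv (\<kappa> t) powr q) powr (1 / q) \<le> (2 * K\<^sub>0 / D / t) powr (1 / q)"
        using q by (intro powr_mono2) auto
      then have "A_inv (\<kappa> t) \<le> (2 * K\<^sub>0 / D / t) powr (1 / q)"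
        using u q by (simp add: powr_powr)
      also have "\<dots> = C * t powr (- 1 / q)"
        unfolding C_def using t0 K0 q by (subst powr_divide) (auto simp: powr_minus_divide)
      finally have i: "A_inv (\<kappa> t) \<le> C * t powr (- 1 / q)" .
      have "sqrt (t\<^sup>2) \<le> sqrt (t\<^sup>2 + 1)" by (intro real_sqrt_le_mono) simp
      then have "t \<le> sqrt (t\<^sup>2 + 1)" using t0 by simp
      then have "h t \<le> (C * t powr (- 1 / q)) / t"
        unfolding h_def using i t0 u(1) by (intro frac_le) auto
      then show ?thesis using t0 by (simp add: powr_diff)
    qed
    define E where "E t = G0 t + C * q * t powr (- 1 / q)" for t
    have Ed: "(E has_real_derivative h t - C * t powr (- 1 / q - 1)) (at t)" if "t > 0" for t
      unfolding E_def[abs_def] using that q G0[OF that]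
      by (auto intro!: derivative_eq_intros simp: field_simps)
    have "E t \<le> E T" if "T \<le> t" for t
    proof (rule DERIV_nonpos_imp_nonincreasing[OF that])
      fix x assume "T \<le> x"
      then show "\<exists>y. (E has_real_derivative y) (at x) \<and> y \<le> 0"
        using Ed[of x] hb[of x] T by (intro exI conjI) auto
    qed
    moreover have "G0 t \<le> E t" for t unfolding E_def C_def using q K0 by simp
    ultimately have GE: "G0 t \<le> E T" if "T \<le> t" for t using that by (meson order_trans)
    have "G0 t \<le> E T" if "t > 0" for t
      using G0_le[OF that, of "max t T"] GE[of "max t T"] by simp
    then show thesis using that by blast
  qed
  define L where "L = (SUP t\<in>{0<..}. G0 t)"
  have bdd: "bdd_above (G0 ` {0<..})" using B by (auto simp: bdd_above_def)
  have G0L: "G0 t < L" if "t > 0" for t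
  proof -
    have "G0 (t + 1) \<le> L" unfolding L_def using that by (intro cSUP_upper bdd) auto
    then show ?thesis using G0_less[of t "t + 1"] that by simp
  qed
  have lim: "(G0 \<longlongrightarrow> L) at_top"
  proof (rule increasing_tendsto)
    show "\<forall>\<^sub>F t in at_top. G0 t \<le> L"
      using eventually_gt_at_top[of "0::real"] by eventually_elim (simp add: G0L less_imp_le)
    fix x assume "x < L"
    then obtain s where s: "s > 0" "x < G0 s"
      unfolding L_def using less_cSUP_iff[OF _ bdd] by auto
    show "\<forall>\<^sub>F t in at_top. x < G0 t"
      using eventually_ge_at_top[of s]
    proof eventually_elim
      case (elim t)
      then show ?case using G0_le[OF s(1)] s(2) by (simp add: less_le_trans)
    qed
  qed
  \<comment> \<open>If the primitive were bounded below, then after the substitution \<open>t \<mapsto> \<kappa> t\<close> the primitive \<open>J\<close> of the given integrand would have bounded oscillation, and the given integral would be finite.\<close>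
  have unbdd: "\<exists>t>0. G0 t < - b" for b
  proof (rule ccontr)
    assume "\<not> ?thesis"
    then have lb: "G0 t \<ge> - b" if "t > 0" for t using that by force
    define f where "f t = A_inv t / sqrt (K\<^sub>0 - t)" for t
    have fc: "isCont f t" if t: "0 < t" "t < K\<^sub>0" for t
    proof -
      obtain s where "s \<ge> 0" "t < A s" using reach t by blast
      then have "isCont A_inv t" using A_inv_deriv[OF t(1)] DERIV_isCont by blast
      then show ?thesis unfolding f_def using t by (intro continuous_intros) auto
    qed
    have fn: "f t \<ge> 0" if t: "0 \<le> t" "t < K\<^sub>0" for t
    proof -
      obtain s where "s \<ge> 0" "t < A s" using reach t by blast
      then have "0 \<le> A_inv t" using A_inv(2)[OF t(1), of s] by simp
      then show ?thesis using t by (simp add: f_def)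
    qed
    obtain J where J: "\<And>t. 0 < t \<Longrightarrow> t < K\<^sub>0 \<Longrightarrow> (J has_real_derivative f t) (at t)"
    proof -
      have "\<exists>F. \<forall>x::real. 0 < ereal x \<longrightarrow> ereal x < ereal K\<^sub>0 \<longrightarrow> (F has_vector_derivative f x) (at x)"
        by (rule einterval_antiderivative) (use fc K0 in auto)
      then show thesis using that by (auto simp: has_real_derivative_iff_has_vector_derivative)
    qed
    define C where "C = K\<^sub>0 / sqrt (K\<^sub>0 / 2)"
    have C: "C > 0" using K0 by (simp add: C_def)
    \<comment> \<open>\<open>K\<^sub>0 - \<kappa> t\<close> vanishes to second order and \<open>\<kappa>'\<close> to first order at \<open>t = 0\<close>, so the substitution does not change the order of the integrand.\<close>
    have fk: "f (\<kappa> t) * (- \<kappa>' t) \<le> C * h t" if t: "t > 0" for t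
    proof -
      define R where "R = sqrt (4 + t\<^sup>2)"
      have R2: "R\<^sup>2 = 4 + t\<^sup>2" by (simp add: R_def)
      have "sqrt (2\<^sup>2) \<le> R" unfolding R_def by (intro real_sqrt_le_mono) simp
      then have R: "R \<ge> 2" by simp
      have S: "sqrt (t\<^sup>2 + 1) \<le> R" unfolding R_def by (intro real_sqrt_le_mono) simp
      have "K\<^sub>0 - \<kappa> t = K\<^sub>0 * (R - 2) / R" unfolding \<kappa>_def R_def[symmetric] using R by (simp add: field_simps)
      also have "\<dots> = K\<^sub>0 * t\<^sup>2 / (R * (R + 2))"
      proof -
        have "t\<^sup>2 = (R - 2) * (R + 2)" using R2 by (simp add: power2_eq_square algebra_simps)
        then show ?thesis using R by simp
      qed
      also have "\<dots> \<ge> K\<^sub>0 * t\<^sup>2 / (R * (2 * R))"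
        using R K0 by (intro divide_left_mono mult_left_mono) auto
      finally have "K\<^sub>0 - \<kappa> t \<ge> (t / R)\<^sup>2 * (K\<^sub>0 / 2)" by (simp add: power_divide power2_eq_square field_simps)
      then have "sqrt (K\<^sub>0 - \<kappa> t) \<ge> sqrt ((t / R)\<^sup>2 * (K\<^sub>0 / 2))" by (rule real_sqrt_le_mono)
      moreover have "sqrt ((t / R)\<^sup>2 * (K\<^sub>0 / 2)) = t / R * sqrt (K\<^sub>0 / 2)"
        unfolding real_sqrt_mult using t R by simp
      ultimately have sq: "sqrt (K\<^sub>0 - \<kappa> t) \<ge> t / R * sqrt (K\<^sub>0 / 2)" by metis
      have sqp: "t / R * sqrt (K\<^sub>0 / 2) > 0" using t R K0 by simp
      have "- \<kappa>' t / sqrt (K\<^sub>0 - \<kappa> t) \<le> (2 * K\<^sub>0 * t / R ^ 3) / (t / R * sqrt (K\<^sub>0 / 2))"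
        unfolding \<kappa>'_def R_def[symmetric] using sq sqp t R K0 by (intro frac_le) auto
      also have "\<dots> = C * (2 / R\<^sup>2)"
        unfolding C_def using t R by (simp add: field_simps power2_eq_square power3_eq_cube)
      also have "\<dots> \<le> C * (1 / R)" using R C by (intro mult_left_mono) (auto simp: field_simps power2_eq_square)
      also have "\<dots> \<le> C * (1 / sqrt (t\<^sup>2 + 1))" using S s1[of t] C R by (intro mult_left_mono divide_left_mono mult_pos_pos) auto
      finally have "A_inv (\<kappa> t) * (- \<kappa>' t / sqrt (K\<^sub>0 - \<kappa> t)) \<le> A_inv (\<kappa> t) * (C * (1 / sqrt (t\<^sup>2 + 1)))"
        using Ai\<kappa>(2)[OF t] by (intro mult_left_mono) auto
      then show ?thesis by (simp add: f_def h_def mult_ac)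
    qed
    have osc: "J (\<kappa> s) - J (\<kappa> t) \<le> C * (B + b)" if "0 < s" "s \<le> t" for s t
    proof -
      define E where "E t = J (\<kappa> t) + C * G0 t" for t
      have Ed: "(E has_real_derivative f (\<kappa> t) * \<kappa>' t + C * h t) (at t)" if "t > 0" for t
        unfolding E_def[abs_def]
        by (intro DERIV_add DERIV_cmult G0 that DERIV_chain2[OF J \<kappa>d] \<kappa>0 \<kappa>K)
      have "E s \<le> E t"
      proof (rule DERIV_nonneg_imp_nondecreasing[OF that(2)])
        fix x assume "s \<le> x"
        then have "x > 0" using that by simp
        then show "\<exists>y. (E has_real_derivative y) (at x) \<and> 0 \<le> y"
          using Ed[of x] fk[of x] by (intro exI[of _ "f (\<kappa> x) * \<kappa>' x + C * h x"]) auto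
      qed
      then have "J (\<kappa> s) - J (\<kappa> t) \<le> C * (G0 t - G0 s)" by (simp add: E_def algebra_simps)
      also have "\<dots> \<le> C * (B + b)" using B[of t] lb[of s] that C by (intro mult_left_mono) auto
      finally show ?thesis .
    qed
    define g where "g t = indicator {0<..<K\<^sub>0} t *\<^sub>R f t" for t
    have gm: "g \<in> borel_measurable borel"
      unfolding g_def[abs_def]
      by (intro borel_measurable_continuous_on_indicator) (auto intro!: continuous_at_imp_continuous_on fc)
    define lo hi where "lo k = \<kappa> (real (Suc k))" and "hi k = \<kappa> (1 / real (Suc k))" for k
    have \<kappa>mono: "\<kappa> t \<le> \<kappa> s" if "0 < s" "s \<le> t" for s t
      unfolding \<kappa>_def using that K0
      by (intro divide_left_mono real_sqrt_le_mono add_left_mono power_mono)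
         (auto intro!: mult_pos_pos add_pos_nonneg)
    have ord: "(1::real) / real (Suc k) \<le> real (Suc k)" for k by (simp add: field_simps)
    have loi: "0 < lo k" "hi k < K\<^sub>0" "lo k \<le> hi k" for k
      unfolding lo_def hi_def using \<kappa>0 \<kappa>K \<kappa>mono ord by auto
    define \<mu> where "\<mu> = density lborel (\<lambda>t. ennreal (g t))"
    have piece: "emeasure \<mu> {lo k..hi k} \<le> ennreal (C * (B + b))" for k
    proof -
      have "emeasure \<mu> {lo k..hi k} = (\<integral>\<^sup>+t. ennreal (g t) * indicator {lo k..hi k} t \<partial>lborel)"
        unfolding \<mu>_def using gm by (intro emeasure_density) auto
      also have "\<dots> = ennreal (J (hi k) - J (lo k))"
      proof (rule nn_integral_FTC_Icc[OF gm])
        fix x assume "x \<in> {lo k..hi k}"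
        then have "0 < x" "x < K\<^sub>0" using loi[of k] by auto
        then show "(J has_real_derivative g x) (at x)" "0 \<le> g x"
          using J[of x] fn[of x] by (auto simp: g_def)
      qed (rule loi)
      also have "\<dots> \<le> ennreal (C * (B + b))"
        unfolding lo_def hi_def by (intro ennreal_leI osc ord) simp
      finally show ?thesis .
    qed
    have union: "(\<Union>k. {lo k..hi k}) = {0<..<K\<^sub>0}"
    proof (intro equalityI subsetI)
      fix t assume t: "t \<in> {0<..<K\<^sub>0}"
      have l1: "lo \<longlonglongrightarrow> 0" unfolding lo_def[abs_def] \<kappa>_def by real_asymp
      have l2: "hi \<longlonglongrightarrow> K\<^sub>0" unfolding hi_def[abs_def] \<kappa>_def by real_asymp
      have "\<forall>\<^sub>F k in sequentially. lo k < t" "\<forall>\<^sub>F k in sequentially. t < hi k"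
        using order_tendstoD(2)[OF l1] order_tendstoD(1)[OF l2] t by auto
      then have "\<forall>\<^sub>F k in sequentially. lo k < t \<and> t < hi k" by eventually_elim auto
      then show "t \<in> (\<Union>k. {lo k..hi k})" by (auto dest!: eventually_happens intro: less_imp_le)
    next
      fix t assume "t \<in> (\<Union>k. {lo k..hi k})"
      then obtain k where "lo k \<le> t" "t \<le> hi k" by auto
      then show "t \<in> {0<..<K\<^sub>0}" using loi(1,2)[of k] by simp
    qed
    have "emeasure \<mu> {0<..<K\<^sub>0} \<le> ennreal (C * (B + b))"
    proof -
      have "incseq (\<lambda>k. {lo k..hi k})"
      proof (rule incseq_SucI)
        fix k
        have "lo (Suc k) \<le> lo k" unfolding lo_def by (rule \<kappa>mono) auto
        moreover have "hi k \<le> hi (Suc k)" unfolding hi_def by (rule \<kappa>mono) (auto simp: field_simps)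
        ultimately show "{lo k..hi k} \<subseteq> {lo (Suc k)..hi (Suc k)}" by auto
      qed
      moreover have "range (\<lambda>k. {lo k..hi k}) \<subseteq> sets \<mu>" by (auto simp: \<mu>_def)
      ultimately have "emeasure \<mu> {0<..<K\<^sub>0} = (SUP k. emeasure \<mu> {lo k..hi k})"
        using SUP_emeasure_incseq[of "\<lambda>k. {lo k..hi k}" \<mu>] by (simp add: union)
      then show ?thesis using piece by (auto intro: SUP_least)
    qed
    moreover have "emeasure \<mu> {0<..<K\<^sub>0} = (\<integral>\<^sup>+t. ennreal (g t) * indicator {0<..<K\<^sub>0} t \<partial>lborel)"
      unfolding \<mu>_def using gm by (intro emeasure_density) auto
    moreover have "\<dots> = (\<integral>\<^sup>+t\<in>{0..<K\<^sub>0}. ennreal (A_inv t / sqrt (K\<^sub>0 - t)) \<partial>lborel)"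
    proof (rule nn_integral_cong_AE)
      have "AE t in lborel. t \<noteq> (0::real)" by (rule AE_lborel_singleton)
      then show "AE t in lborel. ennreal (g t) * indicator {0<..<K\<^sub>0} t =
          ennreal (A_inv t / sqrt (K\<^sub>0 - t)) * indicator {0..<K\<^sub>0} t"
        by eventually_elim (auto simp: g_def f_def indicator_def)
    qed
    ultimately show False using inf by (simp add: top_unique)
  qed
  show thesis
  proof (rule that[of "\<lambda>t. L - G0 t" h h'])
    show "((\<lambda>t. L - G0 t) has_real_derivative - h t) (at t)" if "t > 0" for t
      using G0[OF that] by (auto intro!: derivative_eq_intros)
    show "L - G0 t > 0" if "t > 0" for t using G0L[OF that] by simp
    show "((\<lambda>t. L - G0 t) \<longlongrightarrow> 0) at_top" using tendsto_diff[OF tendsto_const lim, of L] by simp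
    show "filterlim (\<lambda>t. L - G0 t) at_top (at_right 0)"
      unfolding filterlim_at_top
    proof
      fix Z
      obtain t0 where t0: "t0 > 0" "G0 t0 < - (Z - L)" using unbdd by blast
      have "\<forall>\<^sub>F t in at_right 0. t \<in> {0<..<t0}" by (rule eventually_at_right_real[OF t0(1)])
      then show "\<forall>\<^sub>F t in at_right 0. Z \<le> L - G0 t"
      proof eventually_elim
        case (elim t)
        then show ?case using G0_le[of t t0] t0 by auto
      qed
    qed
  qed (use hpos h' hA in auto)
qed

end

section \<open>A quantitative strong maximum principle in geodesic balls\<close>

lemma lorentz_eq:
  assumes "x \<in> \<H>"
  shows "lorentz \<alpha> \<beta> x = (\<alpha> * (1 + (norm x)\<^sup>2) - 2 * (\<beta> \<bullet> x)) / (1 - (norm x)\<^sup>2)"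
proof -
  have "(norm x)\<^sup>2 < 1" using assms by (simp add: power_less_one_iff)
  then show ?thesis by (simp add: lorentz_def conf_factor_def field_simps)
qed

lemma continuous_on_lorentz: "S \<subseteq> \<H> \<Longrightarrow> continuous_on S (lorentz \<alpha> \<beta>)"
  by (intro continuous_at_imp_continuous_on ballI has_derivative_continuous[OF lorentz_deriv]) blast

text \<open>
  With these parameters \<open>lorentz\<close> is the hyperbolic cosine of the distance to \<open>y\<close>.
\<close>
lemma lorentz_point:
  fixes y z :: "'a::euclidean_space"
  assumes "y \<in> \<H>" "z \<in> \<H>"
  shows "lorentz (conf_factor y - 1) (conf_factor y *\<^sub>R y) z =
    1 + 2 * (norm (z - y))\<^sup>2 / ((1 - (norm y)\<^sup>2) * (1 - (norm z)\<^sup>2))"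
    and "(norm (conf_factor y *\<^sub>R y))\<^sup>2 - (conf_factor y - 1)\<^sup>2 = - 1"
proof -
  define Y Z where "Y = (norm y)\<^sup>2" and "Z = (norm z)\<^sup>2"
  have YZ: "Y < 1" "Z < 1" "0 \<le> Y" using assms by (simp_all add: Y_def Z_def power_less_one_iff)
  have d: "(norm (z - y))\<^sup>2 = Z - 2 * (y \<bullet> z) + Y"
    by (simp add: Y_def Z_def power2_norm_eq_inner inner_diff_left inner_diff_right inner_commute)
  have c: "conf_factor y = 2 / (1 - Y)" by (simp add: conf_factor_def Y_def)
  show "lorentz (conf_factor y - 1) (conf_factor y *\<^sub>R y) z =
    1 + 2 * (norm (z - y))\<^sup>2 / ((1 - (norm y)\<^sup>2) * (1 - (norm z)\<^sup>2))"
    unfolding lorentz_eq[OF assms(2)] d c Y_def[symmetric] Z_def[symmetric] inner_scaleR_left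
    using YZ by (simp add: divide_simps) (simp add: algebra_simps)
  have q: "(norm (conf_factor y *\<^sub>R y))\<^sup>2 = (conf_factor y)\<^sup>2 * Y"
    by (simp add: power_mult_distrib Y_def)
  have cY: "conf_factor y * (1 - Y) = 2" unfolding c using YZ(1) by (intro nonzero_eq_divide_eq[THEN iffD1, OF _ refl]) simp
  have "(conf_factor y)\<^sup>2 * Y - (conf_factor y - 1)\<^sup>2 =
      2 * conf_factor y - conf_factor y * (conf_factor y * (1 - Y)) - 1"
    by (simp add: power2_eq_square algebra_simps)
  then have "(conf_factor y)\<^sup>2 * Y - (conf_factor y - 1)\<^sup>2 = - 1"
    unfolding cY by simp
  then show "(norm (conf_factor y *\<^sub>R y))\<^sup>2 - (conf_factor y - 1)\<^sup>2 = - 1"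
    by (simp only: q)
qed

lemma pointwise_solution_continuous:
  assumes "pointwise_solution A m" shows "continuous_on \<H> m"
proof -
  obtain g where g: "\<And>x. x \<in> \<H> \<Longrightarrow> (m has_derivative (\<lambda>h. g x \<bullet> h)) (at x)"
    using assms unfolding pointwise_solution_def by blast
  show ?thesis by (intro continuous_at_imp_continuous_on ballI has_derivative_continuous[OF g])
qed

context flux_law
begin

text \<open>
  The exact radial solution has \<open>\<kappa>\<close> proportional to \<open>(t^2 - 1)^(-(n-1)/2)\<close>; the exponent \<open>-n/2\<close> decays faster, which
  makes the increasing function \<open>G\<close> a strict supersolution. The total increase of \<open>G\<close> over \<open>[a, b + 1]\<close> is made
  small through the size \<open>h0\<close> of the argument of \<open>A\<close>, so that the inverse of \<open>A\<close> is only used on values that \<open>A\<close>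
  attains.
\<close>
lemma ball_barrier:
  assumes ab: "1 < a" "a \<le> b" and gap: "gap > 0" and n: "n \<ge> (1::nat)"
  obtains a0 G h h' \<kappa> where "1 < a0" "a0 < a"
    "\<And>t. t > a0 \<Longrightarrow> (G has_real_derivative h t) (at t)"
    "\<And>t. t > a0 \<Longrightarrow> h t > 0"
    "\<And>t. t > a0 \<Longrightarrow> (h has_real_derivative h' t) (at t)"
    "\<And>t. t > a0 \<Longrightarrow> A (h t * sqrt (t\<^sup>2 - 1)) = \<kappa> t"
    "\<And>t. t > a0 \<Longrightarrow> \<kappa> t > 0"
    "\<And>t. t > a0 \<Longrightarrow> (\<kappa> has_real_derivative - (real n * t * \<kappa> t / (t\<^sup>2 - 1))) (at t)"
    "G (b + 1) - G a \<le> gap"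
proof -
  define a0 where "a0 = (1 + a) / 2"
  have a0: "1 < a0" "a0 < a" using ab by (auto simp: a0_def)
  define s where "s t = sqrt (t\<^sup>2 - 1)" for t :: real
  have sq: "t\<^sup>2 > 1" if "t \<ge> a0" for t
    using that a0 by (intro one_less_power) auto
  have sp: "s t > 0" if "t \<ge> a0" for t using sq[OF that] by (simp add: s_def)
  have s_less: "s a0 < s t" if "t > a0" for t
    unfolding s_def using that a0 by (intro real_sqrt_less_mono diff_strict_right_mono power_strict_mono) auto
  define h0 where "h0 = gap * s a0 / (b + 1 - a)"
  have h0: "h0 > 0" using gap sp[of a0] ab by (simp add: h0_def)
  define \<kappa> where "\<kappa> t = A h0 * (s a0 / s t) ^ n" for t
  have \<kappa>pos: "\<kappa> t > 0" if "t > a0" for t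
    using A_pos[OF h0] sp[of a0] sp[of t] that by (simp add: \<kappa>_def)
  have \<kappa>less: "\<kappa> t < A h0" if "t > a0" for t
  proof -
    have "(s a0 / s t) ^ n < 1"
      using s_less[OF that] sp[of a0] sp[of t] that n by (simp add: power_less_one_iff)
    then show ?thesis using A_pos[OF h0] by (simp add: \<kappa>_def)
  qed
  have ds: "(s has_real_derivative t / s t) (at t)" if "t > a0" for t
    unfolding s_def[abs_def] using sq[of t] that
    by (auto intro!: derivative_eq_intros simp: field_simps)
  have \<kappa>d: "(\<kappa> has_real_derivative - (real n * t * \<kappa> t / (t\<^sup>2 - 1))) (at t)" if "t > a0" for t
  proof -
    have s0: "s t \<noteq> 0" "s t > 0" "s a0 > 0" using sp[of t] sp[of a0] that by auto
    have 1: "((\<lambda>t. s a0 / s t) has_real_derivative - (s a0 * t / s t ^ 3)) (at t)"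
      by (rule DERIV_cong[OF DERIV_divide[OF DERIV_const ds[OF that] s0(1)]])
         (use s0 in \<open>simp add: field_simps power3_eq_cube\<close>)
    obtain k where k: "n = Suc k" using n by (cases n) auto
    have s2: "t\<^sup>2 - 1 = s t * s t" using sq[of t] that by (simp add: s_def)
    show ?thesis unfolding \<kappa>_def[abs_def] s2
      by (rule DERIV_cong[OF DERIV_cmult[OF DERIV_power[OF 1]]])
         (use s0 in \<open>simp add: k field_simps power3_eq_cube\<close>)
  qed
  define h where "h t = A_inv (\<kappa> t) / s t" for t
  have Ai: "A (A_inv (\<kappa> t)) = \<kappa> t" "0 < A_inv (\<kappa> t)" "A_inv (\<kappa> t) \<le> h0"
    "(A_inv has_real_derivative inverse (A' (A_inv (\<kappa> t)))) (at (\<kappa> t))" if "t > a0" for t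
    using A_inv[of "\<kappa> t" h0] A_inv_deriv[of "\<kappa> t" h0] \<kappa>pos[OF that] \<kappa>less[OF that] h0 by auto
  have hpos: "h t > 0" if "t > a0" for t using Ai(2)[OF that] sp[of t] that by (simp add: h_def)
  have "\<exists>D. (h has_real_derivative D) (at t)" if "t > a0" for t
    unfolding h_def[abs_def]
    by (rule exI, rule DERIV_divide[OF DERIV_chain2[OF Ai(4)[OF that] \<kappa>d[OF that]] ds[OF that]])
       (use sp[of t] that in simp)
  then obtain h' where h': "\<And>t. t > a0 \<Longrightarrow> (h has_real_derivative h' t) (at t)" by metis
  obtain G where G: "\<And>t. t > a0 \<Longrightarrow> (G has_real_derivative h t) (at t)"
  proof -
    have "\<exists>F. \<forall>x::real. ereal a0 < ereal x \<longrightarrow> ereal x < \<infinity> \<longrightarrow> (F has_vector_derivative h x) (at x)"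
      by (rule einterval_antiderivative) (auto intro: DERIV_isCont[OF h'])
    then show thesis using that by (auto simp: has_real_derivative_iff_has_vector_derivative)
  qed
  have hb: "h t \<le> h0 / s a0" if "t > a0" for t
    unfolding h_def using Ai(2,3)[OF that] s_less[OF that] sp[of a0] by (intro frac_le) auto
  have "a < b + 1" using ab by simp
  from MVT2[OF this, of G h] G a0
  obtain z where z: "a < z" "G (b + 1) - G a = (b + 1 - a) * h z" by auto
  have "(b + 1 - a) * h z \<le> (b + 1 - a) * (h0 / s a0)"
    using hb[of z] z a0 ab by (intro mult_left_mono) auto
  also have "\<dots> = gap" using ab sp[of a0] by (simp add: h0_def)
  finally have "G (b + 1) - G a \<le> gap" using z by simp
  moreover have "A (h t * sqrt (t\<^sup>2 - 1)) = \<kappa> t" if "t > a0" for t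
    using Ai(1)[OF that] sp[of t] that by (simp add: h_def s_def)
  ultimately show thesis using that a0 G hpos h' \<kappa>pos \<kappa>d by blast
qed

text \<open>
  In a geodesic ball around \<open>y\<close> of hyperbolic radius \<open>arcosh (b + 1)\<close> let \<open>m\<close> be at most \<open>N\<close>, and at most \<open>N - gap\<close>
  in the concentric ball of radius \<open>arcosh a\<close>. The barrier \<open>N + G - G (b + 1)\<close> lies above \<open>m\<close> on both boundary
  spheres of the annulus. What matters is that the gain \<open>\<theta>\<close> depends on neither \<open>m\<close> nor \<open>y\<close> nor \<open>N\<close>.
\<close>
lemma interior_gap:
  assumes ab: "1 < a" "a \<le> b" and gap: "gap > 0"
  obtains \<theta> where "\<theta> > 0"
    "\<And>(m::'a::euclidean_space \<Rightarrow> real) y N x.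
      pointwise_solution A m \<Longrightarrow> y \<in> \<H> \<Longrightarrow>
      (\<And>z. z \<in> \<H> \<Longrightarrow> lorentz (conf_factor y - 1) (conf_factor y *\<^sub>R y) z \<le> b + 1 \<Longrightarrow> m z \<le> N) \<Longrightarrow>
      (\<And>z. z \<in> \<H> \<Longrightarrow> lorentz (conf_factor y - 1) (conf_factor y *\<^sub>R y) z \<le> a \<Longrightarrow> m z \<le> N - gap) \<Longrightarrow>
      x \<in> \<H> \<Longrightarrow> lorentz (conf_factor y - 1) (conf_factor y *\<^sub>R y) x \<le> b \<Longrightarrow> m x \<le> N - \<theta>"
proof -
  have n: "DIM('a) \<ge> 1" by (simp add: Suc_leI)
  obtain a0 G h h' \<kappa> where a0: "1 < a0" "a0 < a"
    and G: "\<And>t. t > a0 \<Longrightarrow> (G has_real_derivative h t) (at t)"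
    and hpos: "\<And>t. t > a0 \<Longrightarrow> h t > 0"
    and h': "\<And>t. t > a0 \<Longrightarrow> (h has_real_derivative h' t) (at t)"
    and hA: "\<And>t. t > a0 \<Longrightarrow> A (h t * sqrt (t\<^sup>2 - 1)) = \<kappa> t"
    and \<kappa>: "\<And>t. t > a0 \<Longrightarrow> \<kappa> t > 0"
    and \<kappa>': "\<And>t. t > a0 \<Longrightarrow> (\<kappa> has_real_derivative - (real DIM('a) * t * \<kappa> t / (t\<^sup>2 - 1))) (at t)"
    and Gg: "G (b + 1) - G a \<le> gap"
    by (rule ball_barrier[OF ab gap n]) blast
  have G_less: "G s < G t" if "a0 < s" "s < t" for s t
  proof (rule DERIV_pos_imp_increasing[OF that(2)])
    fix x assume "s \<le> x"
    then show "\<exists>y. (G has_real_derivative y) (at x) \<and> 0 < y" using G[of x] hpos[of x] that by auto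
  qed
  have G_le: "G s \<le> G t" if "a0 < s" "s \<le> t" for s t
    using G_less[of s t] that by (cases "s = t") auto
  define \<theta> where "\<theta> = G (b + 1) - G b"
  have "\<theta> > 0" using G_less[of b "b + 1"] a0 ab by (simp add: \<theta>_def)
  moreover have "\<theta> \<le> gap" using Gg G_le[of a b] a0 ab by (simp add: \<theta>_def)
  moreover have "m x \<le> N - \<theta>"
    if sol: "pointwise_solution A m" and y: "y \<in> \<H>"
      and big: "\<And>z. z \<in> \<H> \<Longrightarrow> lorentz (conf_factor y - 1) (conf_factor y *\<^sub>R y) z \<le> b + 1 \<Longrightarrow> m z \<le> N"
      and small: "\<And>z. z \<in> \<H> \<Longrightarrow> lorentz (conf_factor y - 1) (conf_factor y *\<^sub>R y) z \<le> a \<Longrightarrow> m z \<le> N - gap"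
      and x: "x \<in> \<H>" "lorentz (conf_factor y - 1) (conf_factor y *\<^sub>R y) x \<le> b"
    for m :: "'a \<Rightarrow> real" and y N x
  proof -
    define \<alpha> \<beta> where "\<alpha> = conf_factor y - 1" and "\<beta> = conf_factor y *\<^sub>R y"
    let ?F = "lorentz \<alpha> \<beta>"
    note big = big[folded \<alpha>_def \<beta>_def] and small = small[folded \<alpha>_def \<beta>_def]
    note x = x[folded \<alpha>_def \<beta>_def]
    have unit: "- 1 = (norm \<beta>)\<^sup>2 - \<alpha>\<^sup>2" using lorentz_point(2)[OF y y] by (simp add: \<alpha>_def \<beta>_def)
    show ?thesis
    proof (cases "?F x \<le> a")
      case True
      then show ?thesis using small[OF x(1)] \<open>\<theta> \<le> gap\<close> by simp
    next
      case False
      define num where "num z = \<alpha> * (1 + (norm z)\<^sup>2) - 2 * (\<beta> \<bullet> z)" for z :: 'a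
      define K where "K = cball 0 1 \<inter> ({z. a * (1 - (norm z)\<^sup>2) \<le> num z} \<inter> {z. num z \<le> (b + 1) * (1 - (norm z)\<^sup>2)})"
      have numF: "?F z = num z / (1 - (norm z)\<^sup>2)" if "z \<in> \<H>" for z
        using lorentz_eq[OF that] by (simp add: num_def)
      have u: "1 - (norm z)\<^sup>2 > 0" if "z \<in> \<H>" for z :: 'a using that by (simp add: power_less_one_iff)
      have KF: "z \<in> K \<longleftrightarrow> a \<le> ?F z \<and> ?F z \<le> b + 1" if "z \<in> \<H>" for z
        using u[OF that] that by (simp add: K_def numF[OF that] pos_le_divide_eq pos_divide_le_eq)
      have KH: "K \<subseteq> \<H>"
      proof
        fix z assume z: "z \<in> K"
        have "norm z \<noteq> 1"
        proof
          assume z1: "norm z = 1"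
          then have "2 * \<alpha> \<le> 2 * (\<beta> \<bullet> z)" using z by (simp add: K_def num_def)
          also have "\<beta> \<bullet> z \<le> norm \<beta>" using norm_cauchy_schwarz[of \<beta> z] z1 by simp
          finally have "\<alpha> \<le> norm \<beta>" by simp
          moreover have "(norm y)\<^sup>2 < 1" using y by (simp add: power_less_one_iff)
          then have "\<alpha> \<ge> 0" by (simp add: \<alpha>_def conf_factor_def field_simps)
          ultimately have "\<alpha>\<^sup>2 \<le> (norm \<beta>)\<^sup>2" by (intro power_mono) auto
          then show False using unit by simp
        qed
        then show "z \<in> \<H>" using z by (auto simp: K_def)
      qed
      have cK: "compact K"
        unfolding K_def num_def
        by (intro compact_Int_closed closed_Int compact_cball closed_Collect_le continuous_intros)
      define w where "w z = N + G (?F z) - G (b + 1)" for z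
      have Gc: "continuous_on {a0<..} G"
        by (intro continuous_at_imp_continuous_on ballI DERIV_isCont[OF G]) simp
      have wc: "continuous_on (K \<inter> ball 0 1) w"
        unfolding w_def using KF a0
        by (intro continuous_intros continuous_on_compose2[OF Gc] continuous_on_lorentz) fastforce+
      have "m x \<le> w x"
      proof (rule comparison[of K m w "N + G a - G (b + 1)"])
        show "compact K" "K \<subseteq> cball 0 1" using cK by (auto simp: K_def)
        show "continuous_on K m" using pointwise_solution_continuous[OF sol] KH continuous_on_subset by blast
        show "continuous_on (K \<inter> ball 0 1) w" by (rule wc)
        show "N + G a - G (b + 1) \<le> w z" if "z \<in> K \<inter> ball 0 1" for z
          using KF[of z] that G_le[of a "?F z"] a0 by (simp add: w_def)
        show "m z \<le> N + G a - G (b + 1)" if "z \<in> K" "norm z = 1" for z using that KH by auto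
        show "x \<in> K" using KF[OF x(1)] x(2) False by simp
        show "norm x < 1" using x(1) by simp
        fix z assume z: "z \<in> K \<inter> ball 0 1" and wm: "w z < m z"
          and mx: "\<And>v. v \<in> K \<inter> ball 0 1 \<Longrightarrow> m v - w v \<le> m z - w z"
        have zH: "z \<in> \<H>" using z by simp
        have Fz: "a \<le> ?F z" "?F z \<le> b + 1" using KF[OF zH] z by auto
        have "?F z \<noteq> a" using small[OF zH] wm Gg by (auto simp: w_def)
        moreover have "?F z \<noteq> b + 1" using big[OF zH] wm by (auto simp: w_def)
        ultimately have Fz': "?F z \<in> {a<..<b + 1}" using Fz by auto
        have "open (\<H> \<inter> ?F -` {a<..<b + 1})"
          by (rule continuous_open_preimage[OF continuous_on_lorentz]) auto
        then obtain e where e: "e > 0" "ball z e \<subseteq> \<H> \<inter> ?F -` {a<..<b + 1}"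
          using zH Fz' unfolding open_contains_ball by blast
        have mx': "m v - G (?F v) \<le> m z - G (?F z)" if "v \<in> ball z e" "v \<in> \<H>" for v
        proof -
          have "v \<in> \<H> \<inter> ?F -` {a<..<b + 1}" using that e(2) by blast
          then have "v \<in> K \<inter> ball 0 1" using KF[of v] by auto
          from mx[OF this] show ?thesis by (simp add: w_def)
        qed
        show False
        proof (rule strict_supersolution_not_touched[where \<tau>=1 and I="{a0<..}" and \<sigma>="- 1" and A'=A',
              OF sol zH A_deriv A'_pos A_pos unit _ _ _ _ hpos _ _ h' \<kappa>' _ e(1) mx'])
          show "?F z \<in> {a0<..}" using Fz a0 by simp
          then have gt: "?F z > a0" by simp
          show "?F z > a0" "?F z > a0" using gt by auto
          show "(G has_real_derivative 1 * h t) (at t)" if "t \<in> {a0<..}" for t using G that by simp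
          show "A (h t * sqrt (t\<^sup>2 + - 1)) = \<kappa> t" if "t \<in> {a0<..}" for t using hA that by simp
          have sq: "t\<^sup>2 > 1" if "t > a0" for t :: real using that a0 by (intro one_less_power) auto
          show "t\<^sup>2 + - 1 > 0" if "t \<in> {a0<..}" for t :: real using sq that by simp
          have f: "?F z * \<kappa> (?F z) > 0" using gt a0 \<kappa>[OF gt] by simp
          have "- (real DIM('a) * ?F z * \<kappa> (?F z) / ((?F z)\<^sup>2 - 1)) * ((?F z)\<^sup>2 + - 1) =
              - (real DIM('a) * ?F z * \<kappa> (?F z))" using sq[OF gt] by simp
          then show "1 * (- (real DIM('a) * ?F z * \<kappa> (?F z) / ((?F z)\<^sup>2 - 1)) * ((?F z)\<^sup>2 + - 1) +
              (real DIM('a) - 1) * \<kappa> (?F z) * ?F z) < 0"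
            using f by (simp add: algebra_simps)
        qed auto
      qed
      also have "w x \<le> N - \<theta>" using G_le[of "?F x" b] x False a0 by (simp add: w_def \<theta>_def)
      finally show ?thesis .
    qed
  qed
  ultimately show thesis using that by blast
qed

end

section \<open>Half spaces\<close>

text \<open>
  A flux law together with its hyperplane barrier: \<open>G\<close> is infinite on a hyperplane and zero at infinity, as
  for Scherk's minimal surface.
\<close>
locale scherk_law = flux_law +
  fixes K\<^sub>0 :: real and G h h' :: "real \<Rightarrow> real"
  assumes K0: "K\<^sub>0 > 0"
    and G_deriv: "\<And>t. t > 0 \<Longrightarrow> (G has_real_derivative - h t) (at t)"
    and h_pos: "\<And>t. t > 0 \<Longrightarrow> h t > 0"
    and h_deriv: "\<And>t. t > 0 \<Longrightarrow> (h has_real_derivative h' t) (at t)"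
    and h_eq: "\<And>t. t > 0 \<Longrightarrow> A (h t * sqrt (t\<^sup>2 + 1)) = 2 * K\<^sub>0 / sqrt (4 + t\<^sup>2)"
    and G_pos: "\<And>t. t > 0 \<Longrightarrow> G t > 0"
    and G_top: "(G \<longlongrightarrow> 0) at_top"
    and G_zero: "filterlim G at_top (at_right 0)"
begin

text \<open>
  Since \<open>m\<close> is bounded on the compact set \<open>K\<close> and \<open>G\<close> blows up at zero, the barrier dominates \<open>m\<close> on a
  hypersurface \<open>F = d\<close> with small \<open>d\<close>; the comparison takes place where \<open>F \<ge> d\<close>. No information on \<open>m\<close> at the
  hyperplane \<open>F = 0\<close> enters the bound.
\<close>
lemma hyperplane_bound:
  fixes m :: "'a::euclidean_space \<Rightarrow> real"
  assumes dim: "DIM('a) \<ge> 2" and sol: "pointwise_solution A m"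
    and unit: "(norm \<beta>)\<^sup>2 - \<alpha>\<^sup>2 = 1"
    and K: "compact K" "K \<subseteq> cball 0 1" and m: "continuous_on K m"
    and bd: "\<And>x. x \<in> K \<Longrightarrow> norm x = 1 \<Longrightarrow> m x \<le> c"
    and side: "\<And>x. x \<in> K \<Longrightarrow> norm x < 1 \<Longrightarrow> lorentz \<alpha> \<beta> x > 0 \<Longrightarrow> x \<in> interior K \<or> m x \<le> c"
    and x: "x \<in> K" "norm x < 1" "lorentz \<alpha> \<beta> x > 0"
  shows "m x \<le> c + G (lorentz \<alpha> \<beta> x)"
proof -
  let ?F = "lorentz \<alpha> \<beta>"
  have "bounded (m ` K)" using compact_continuous_image[OF m K(1)] compact_imp_bounded by blast
  then obtain M where M: "\<And>z. z \<in> K \<Longrightarrow> m z \<le> M"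
    unfolding bounded_iff by (metis abs_le_D1 imageI real_norm_def)
  have "\<forall>\<^sub>F t in at_right 0. M - c \<le> G t" using G_zero by (simp add: filterlim_at_top)
  then obtain d0 where d0: "d0 > 0" "\<And>t. 0 < t \<Longrightarrow> t < d0 \<Longrightarrow> M - c \<le> G t"
    unfolding eventually_at_right_field by auto
  define d where "d = min (d0 / 2) (?F x / 2)"
  have d: "0 < d" "d < d0" "d < ?F x" using d0(1) x(3) by (auto simp: d_def)
  \<comment> \<open>Multiplying \<open>F \<ge> d\<close> by \<open>1 - |z|^2\<close> describes a set that is closed up to the sphere at infinity.\<close>
  define num where "num z = \<alpha> * (1 + (norm z)\<^sup>2) - 2 * (\<beta> \<bullet> z)" for z :: 'a
  define K' where "K' = K \<inter> {z. d * (1 - (norm z)\<^sup>2) \<le> num z}"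
  have numF: "?F z = num z / (1 - (norm z)\<^sup>2)" if "z \<in> \<H>" for z
    using lorentz_eq[OF that] by (simp add: num_def)
  have KF: "z \<in> K' \<longleftrightarrow> z \<in> K \<and> d \<le> ?F z" if "z \<in> \<H>" for z
  proof -
    have "1 - (norm z)\<^sup>2 > 0" using that by (simp add: power_less_one_iff)
    then show ?thesis by (simp add: K'_def numF[OF that] pos_le_divide_eq)
  qed
  have cK: "compact K'"
    unfolding K'_def num_def by (intro compact_Int_closed K closed_Collect_le continuous_intros)
  define w where "w z = c + G (?F z)" for z
  have Gc: "continuous_on {0<..} G"
    by (intro continuous_at_imp_continuous_on ballI DERIV_isCont[OF G_deriv]) simp
  have wc: "continuous_on (K' \<inter> ball 0 1) w"
    unfolding w_def using KF d
    by (intro continuous_intros continuous_on_compose2[OF Gc] continuous_on_lorentz) fastforce+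
  have "m x \<le> w x"
  proof (rule comparison[of K' m w c])
    show "compact K'" "K' \<subseteq> cball 0 1" using cK K by (auto simp: K'_def)
    show "continuous_on K' m" by (rule continuous_on_subset[OF m]) (auto simp: K'_def)
    show "continuous_on (K' \<inter> ball 0 1) w" by (rule wc)
    show "c \<le> w z" if "z \<in> K' \<inter> ball 0 1" for z
    proof -
      have "?F z > 0" using KF[of z] that d by auto
      then show ?thesis using G_pos by (simp add: w_def less_imp_le)
    qed
    show "m z \<le> c" if "z \<in> K'" "norm z = 1" for z using that bd by (simp add: K'_def)
    show "x \<in> K'" using KF[of x] x d by simp
    show "norm x < 1" by (rule x)
    fix z assume z: "z \<in> K' \<inter> ball 0 1" and wm: "w z < m z"
      and mx: "\<And>v. v \<in> K' \<inter> ball 0 1 \<Longrightarrow> m v - w v \<le> m z - w z"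
    have zH: "z \<in> \<H>" using z by simp
    have zK: "z \<in> K" "d \<le> ?F z" using KF[OF zH] z by auto
    have "?F z \<noteq> d" using d0(2)[of d] d M[OF zK(1)] wm by (auto simp: w_def)
    then have Fz: "?F z \<in> {d<..}" using zK by simp
    then have Fp: "?F z > 0" using d by simp
    have "z \<in> interior K"
      using side[OF zK(1)] zH Fp wm G_pos[OF Fp] by (auto simp: w_def)
    moreover have "open (\<H> \<inter> ?F -` {d<..})"
      by (rule continuous_open_preimage[OF continuous_on_lorentz]) auto
    ultimately have "open (interior K \<inter> (\<H> \<inter> ?F -` {d<..}))" "z \<in> interior K \<inter> (\<H> \<inter> ?F -` {d<..})"
      using zH Fz by auto
    then obtain e where e: "e > 0" "ball z e \<subseteq> interior K \<inter> (\<H> \<inter> ?F -` {d<..})"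
      unfolding open_contains_ball by blast
    have mx': "m v - G (?F v) \<le> m z - G (?F z)" if "v \<in> ball z e" "v \<in> \<H>" for v
    proof -
      have "v \<in> interior K \<inter> (\<H> \<inter> ?F -` {d<..})" using that e(2) by blast
      then have "v \<in> K' \<inter> ball 0 1" using KF[of v] interior_subset[of K] by auto
      from mx[OF this] show ?thesis by (simp add: w_def)
    qed
    define R where "R = sqrt (4 + (?F z)\<^sup>2)"
    have R: "R > 0" "R\<^sup>2 = 4 + (?F z)\<^sup>2" by (simp_all add: R_def add_pos_nonneg)
    have \<kappa>': "((\<lambda>t. 2 * K\<^sub>0 / sqrt (4 + t\<^sup>2)) has_real_derivative - (2 * K\<^sub>0 * ?F z / R ^ 3)) (at (?F z))"
    proof -
      have "4 + (?F z)\<^sup>2 > 0" by (simp add: add_pos_nonneg)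
      then show ?thesis unfolding R_def
        by (auto intro!: derivative_eq_intros simp: field_simps power2_eq_square power3_eq_cube)
    qed
    show False
    proof (rule strict_supersolution_not_touched[where \<tau>="- 1" and I="{0<..}" and \<sigma>=1 and A'=A',
          OF sol zH A_deriv A'_pos A_pos unit[symmetric] _ _ _ _ h_pos _ _ h_deriv \<kappa>' _ e(1) mx'])
      show "?F z \<in> {0<..}" using Fp by simp
      show "(G has_real_derivative - 1 * h t) (at t)" if "t \<in> {0<..}" for t using G_deriv that by simp
      show "A (h t * sqrt (t\<^sup>2 + 1)) = 2 * K\<^sub>0 / sqrt (4 + t\<^sup>2)" if "t \<in> {0<..}" for t using h_eq that by simp
      show "0 < t\<^sup>2 + 1" for t :: real by (simp add: add_nonneg_pos)
      have "((?F z)\<^sup>2 + 1) / R\<^sup>2 < 1" unfolding R(2) by (simp add: add_pos_nonneg)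
      also have "1 \<le> real DIM('a) - 1" using dim by simp
      finally have less: "2 * K\<^sub>0 * ?F z / R * (((?F z)\<^sup>2 + 1) / R\<^sup>2) < 2 * K\<^sub>0 * ?F z / R * (real DIM('a) - 1)"
        using K0 Fp R(1) by (intro mult_strict_left_mono) auto
      have eq: "- 1 * (- (2 * K\<^sub>0 * ?F z / R ^ 3) * ((?F z)\<^sup>2 + 1) + (real DIM('a) - 1) * (2 * K\<^sub>0 / R) * ?F z) =
          2 * K\<^sub>0 * ?F z / R * (((?F z)\<^sup>2 + 1) / R\<^sup>2) - 2 * K\<^sub>0 * ?F z / R * (real DIM('a) - 1)"
        using R(1) by (simp add: power2_eq_square power3_eq_cube field_simps)
      show "- 1 * (- (2 * K\<^sub>0 * ?F z / R ^ 3) * ((?F z)\<^sup>2 + 1) +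
          (real DIM('a) - 1) * (2 * K\<^sub>0 / sqrt (4 + (?F z)\<^sup>2)) * ?F z) < 0"
        unfolding R_def[symmetric] eq using less by (subst diff_less_0_iff_less)
    qed (use Fp in auto)
  qed
  then show ?thesis by (simp add: w_def)
qed

end

section \<open>Behaviour near an exceptional boundary point\<close>

text \<open>
  A Euclidean sphere with centre \<open>a\<close> and radius \<open>r\<close> meets the unit sphere orthogonally exactly when
  \<open>|a|^2 = 1 + r^2\<close>, and is then a hyperplane of hyperbolic space. The two signs of the parameters choose its
  outer and its inner side.
\<close>
lemma lorentz_sphere:
  fixes a x :: "'a::euclidean_space"
  assumes r: "r > 0" "(norm a)\<^sup>2 = 1 + r\<^sup>2"
  shows "x \<in> \<H> \<Longrightarrow> lorentz (1 / r) (a /\<^sub>R r) x = ((norm (x - a))\<^sup>2 - r\<^sup>2) / (r * (1 - (norm x)\<^sup>2))"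
    and "x \<in> \<H> \<Longrightarrow> lorentz (- 1 / r) (- (a /\<^sub>R r)) x = (r\<^sup>2 - (norm (x - a))\<^sup>2) / (r * (1 - (norm x)\<^sup>2))"
    and "(norm (a /\<^sub>R r))\<^sup>2 - (1 / r)\<^sup>2 = 1" "(norm (- (a /\<^sub>R r)))\<^sup>2 - (- 1 / r)\<^sup>2 = 1"
proof -
  have d: "(norm (x - a))\<^sup>2 = (norm x)\<^sup>2 - 2 * (a \<bullet> x) + (1 + r\<^sup>2)"
    by (simp add: r(2)[symmetric]) (simp add: power2_norm_eq_inner inner_diff_left inner_diff_right inner_commute)
  have u: "1 - (norm x)\<^sup>2 > 0" if "x \<in> \<H>" using that by (simp add: power_less_one_iff)
  show "lorentz (1 / r) (a /\<^sub>R r) x = ((norm (x - a))\<^sup>2 - r\<^sup>2) / (r * (1 - (norm x)\<^sup>2))" if "x \<in> \<H>"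
    unfolding lorentz_eq[OF that] d inner_scaleR_left using u[OF that] r(1)
    by (simp add: divide_simps)
  show "lorentz (- 1 / r) (- (a /\<^sub>R r)) x = (r\<^sup>2 - (norm (x - a))\<^sup>2) / (r * (1 - (norm x)\<^sup>2))" if "x \<in> \<H>"
    unfolding lorentz_eq[OF that] d inner_scaleR_left inner_minus_left using u[OF that] r(1)
    by (simp add: divide_simps)
  show "(norm (a /\<^sub>R r))\<^sup>2 - (1 / r)\<^sup>2 = 1" "(norm (- (a /\<^sub>R r)))\<^sup>2 - (- 1 / r)\<^sup>2 = 1"
    using r by (simp_all add: power_mult_distrib power_divide field_simps)
qed

lemma sqrt_one_plus_square:
  fixes r :: real
  assumes "0 < r" "r \<le> 1 / 2"
  shows "1 \<le> sqrt (1 + r\<^sup>2)" "sqrt (1 + r\<^sup>2) - 1 \<le> r / 4"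
proof -
  have "r * r \<le> r * (1 / 2)" using assms by (intro mult_left_mono) auto
  then have "r\<^sup>2 \<le> r / 2" by (simp add: power2_eq_square)
  moreover have "(1 + r / 4)\<^sup>2 = 1 + r / 2 + r\<^sup>2 / 16" by (simp add: power2_eq_square algebra_simps)
  ultimately have "1 + r\<^sup>2 \<le> (1 + r / 4)\<^sup>2" using zero_le_power2[of r] by linarith
  then show "sqrt (1 + r\<^sup>2) - 1 \<le> r / 4" using assms real_le_lsqrt[of "1 + r / 4" "1 + r\<^sup>2"] by simp
qed simp

text \<open>
  Rotate \<open>p\<close> towards an orthogonal direction until the chord has length \<open>e\<close>.
\<close>
lemma sphere_point_at_distance:
  fixes p :: "'a::euclidean_space"
  assumes "DIM('a) \<ge> 2" "norm p = 1" "0 < e" "e \<le> 1"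
  obtains \<xi> where "norm \<xi> = 1" "norm (\<xi> - p) = e"
proof -
  obtain q0 :: 'a where q0: "q0 \<noteq> 0" "orthogonal p q0"
    using orthogonal_to_vector_exists[OF assms(1), of p] by blast
  define q where "q = q0 /\<^sub>R norm q0"
  have q: "q \<bullet> q = 1" "p \<bullet> q = 0" "q \<bullet> p = 0" "p \<bullet> p = 1"
    using q0 assms(2) by (auto simp: q_def orthogonal_def inner_commute dot_square_norm power2_eq_square norm_eq_1)
  define c where "c = 1 - e\<^sup>2 / 2"
  define s where "s = sqrt (1 - c\<^sup>2)"
  have "e\<^sup>2 \<le> 1" using assms by (simp add: power_le_one)
  then have "c\<^sup>2 \<le> 1" by (simp add: c_def power_le_one)
  then have s: "s * s = 1 - c * c" by (simp add: s_def power2_eq_square)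
  let ?\<xi> = "c *\<^sub>R p + s *\<^sub>R q"
  have 1: "?\<xi> \<bullet> ?\<xi> = 1"
    by (simp add: inner_add_left inner_add_right q s)
  have 2: "(?\<xi> - p) \<bullet> (?\<xi> - p) = e\<^sup>2"
    by (simp add: inner_add_left inner_add_right inner_diff_left inner_diff_right q s)
       (simp add: c_def algebra_simps)
  show thesis
    using that[of ?\<xi>] 1 2 assms(3) by (simp add: norm_eq_sqrt_inner)
qed

lemma pointwise_solution_uminus:
  assumes "pointwise_solution A m"
  shows "pointwise_solution A (\<lambda>x. - m x)"
proof -
  obtain g where g: "\<And>x. x \<in> \<H> \<Longrightarrow> (m has_derivative (\<lambda>h. g x \<bullet> h)) (at x)"
    "\<And>x. x \<in> \<H> \<Longrightarrow> g differentiable (at x)"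
    "\<And>x T. x \<in> \<H> \<Longrightarrow> g x \<noteq> 0 \<Longrightarrow> ((\<lambda>z. euclid_flux A z (g z)) has_derivative T) (at x) \<Longrightarrow>
        (\<Sum>b\<in>Basis. T b \<bullet> b) = 0"
    using assms unfolding pointwise_solution_def by blast
  show ?thesis unfolding pointwise_solution_def
  proof (intro exI[of _ "\<lambda>x. - g x"] conjI ballI allI impI)
    fix x :: 'a assume x: "x \<in> \<H>"
    show "((\<lambda>x. - m x) has_derivative (\<lambda>h. - g x \<bullet> h)) (at x)"
      using has_derivative_minus[OF g(1)[OF x]] by simp
    show "(\<lambda>x. - g x) differentiable (at x)" using g(2)[OF x] by (rule differentiable_minus)
    fix T assume "- g x \<noteq> 0" and T: "((\<lambda>z. euclid_flux A z (- g z)) has_derivative T) (at x)"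
    have "((\<lambda>z. euclid_flux A z (g z)) has_derivative (\<lambda>h. - T h)) (at x)"
      using has_derivative_minus[OF T] by (simp add: euclid_flux_def)
    from g(3)[OF x _ this] \<open>- g x \<noteq> 0\<close> show "(\<Sum>b\<in>Basis. T b \<bullet> b) = 0"
      by (simp add: sum_negf)
  qed
qed

context scherk_law
begin

lemma G_small: "\<epsilon> > 0 \<Longrightarrow> \<exists>T\<ge>1. \<forall>t\<ge>T. G t \<le> \<epsilon>"
proof -
  assume "\<epsilon> > 0"
  then have "\<forall>\<^sub>F t in at_top. G t < \<epsilon>" using order_tendstoD(2)[OF G_top] by blast
  then obtain T where "\<And>t. t \<ge> T \<Longrightarrow> G t < \<epsilon>" by (auto simp: eventually_at_top_linorder)
  then show ?thesis by (intro exI[of _ "max T 1"]) (auto intro: less_imp_le)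
qed

text \<open>
  The barrier sits outside a hyperplane around \<open>p\<close> of Euclidean radius \<open>r\<close>, so \<open>p\<close> itself is cut away. As
  \<open>r \<rightarrow> 0\<close> the distance from a fixed \<open>x\<close> to the hyperplane tends to infinity and the barrier at \<open>x\<close> to zero.
\<close>
lemma bounded_near:
  fixes m :: "'a::euclidean_space \<Rightarrow> real"
  assumes dim: "DIM('a) \<ge> 2" and sol: "pointwise_solution A m"
    and p: "norm p = 1" and \<rho>: "\<rho> > 0"
    and m: "continuous_on (cball 0 1 \<inter> cball p \<rho> - {p}) m"
    and bd: "\<And>x. norm x = 1 \<Longrightarrow> x \<noteq> p \<Longrightarrow> norm (x - p) \<le> \<rho> \<Longrightarrow> m x \<le> C0"
  obtains M where "\<And>x. norm x < 1 \<Longrightarrow> norm (x - p) < \<rho> \<Longrightarrow> m x \<le> M"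
proof -
  have "compact (cball 0 1 \<inter> sphere p \<rho>)" by (simp add: closed_Int_compact)
  moreover have "continuous_on (cball 0 1 \<inter> sphere p \<rho>) m"
    by (rule continuous_on_subset[OF m]) (use \<rho> in auto)
  ultimately have "bounded (m ` (cball 0 1 \<inter> sphere p \<rho>))"
    using compact_continuous_image compact_imp_bounded by blast
  then obtain C1 where C1: "\<And>z. z \<in> cball 0 1 \<inter> sphere p \<rho> \<Longrightarrow> m z \<le> C1"
    unfolding bounded_iff by (metis abs_le_D1 imageI real_norm_def)
  define C where "C = max C0 C1"
  have "m x \<le> C" if x: "norm x < 1" "norm (x - p) < \<rho>" for x
  proof (rule ccontr)
    assume "\<not> m x \<le> C"
    then have "(m x - C) / 2 > 0" by simp
    then obtain T where T: "T \<ge> 1" "\<And>t. t \<ge> T \<Longrightarrow> G t \<le> (m x - C) / 2" using G_small by blast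
    define d where "d = norm (x - p)"
    have "x \<noteq> p" using x p by auto
    then have d: "d > 0" by (simp add: d_def)
    have d2: "d < 2" using norm_triangle_ineq4[of x p] x p by (simp add: d_def)
    \<comment> \<open>The first bound keeps \<open>x\<close> outside the hyperplane; the second makes \<open>F x \<ge> T\<close>.\<close>
    define r where "r = min (d / 4) (d\<^sup>2 / (2 * T))"
    have r: "0 < r" "r \<le> d / 4" "r \<le> d\<^sup>2 / (2 * T)" using d T by (auto simp: r_def)
    have r1: "r \<le> 1 / 2" using r d2 by simp
    define t where "t = sqrt (1 + r\<^sup>2)"
    have t: "1 \<le> t" "t - 1 \<le> r / 4" using sqrt_one_plus_square[OF r(1) r1] by (simp_all add: t_def)
    define a where "a = t *\<^sub>R p"
    have na: "(norm a)\<^sup>2 = 1 + r\<^sup>2" using p by (simp add: a_def t_def power_mult_distrib)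
    have "p - a = (1 - t) *\<^sub>R p" by (simp add: a_def algebra_simps)
    then have pa: "norm (p - a) = t - 1" using t p by simp
    define K where "K = cball 0 1 \<inter> cball p \<rho> - ball a r"
    note ls = lorentz_sphere[OF r(1) na]
    have u: "0 < r * (1 - (norm z)\<^sup>2)" if "z \<in> \<H>" for z :: 'a
      using that r(1) by (simp add: power_less_one_iff)
    have Kp: "K \<subseteq> cball 0 1 \<inter> cball p \<rho> - {p}"
      using pa t r(1) by (auto simp: K_def dist_norm norm_minus_commute)
    have "d \<le> norm (x - a) + (t - 1)"
      using norm_triangle_ineq[of "x - a" "a - p"] pa by (simp add: d_def norm_minus_commute)
    then have xa: "norm (x - a) \<ge> 3 / 4 * d" using t(2) r(2) d by simp
    have "(norm (x - a))\<^sup>2 \<ge> 9 / 16 * d\<^sup>2" using power_mono[OF xa, of 2] d by (simp add: power2_eq_square)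
    moreover have "r\<^sup>2 \<le> d\<^sup>2 / 16" using power_mono[OF r(2), of 2] r(1) by (simp add: power_divide)
    ultimately have num: "d\<^sup>2 / 2 \<le> (norm (x - a))\<^sup>2 - r\<^sup>2" by linarith
    then have num0: "0 \<le> (norm (x - a))\<^sup>2 - r\<^sup>2" using zero_le_power2[of d] by linarith
    have xH: "x \<in> \<H>" using x by simp
    have "T \<le> (d\<^sup>2 / 2) / r" using r T by (simp add: field_simps)
    also have "\<dots> \<le> ((norm (x - a))\<^sup>2 - r\<^sup>2) / (r * (1 - (norm x)\<^sup>2))"
      by (rule frac_le[OF num0 num u[OF xH]]) (use r(1) in \<open>simp add: mult_left_le\<close>)
    finally have TF: "T \<le> lorentz (1 / r) (a /\<^sub>R r) x" using ls(1)[of x] x by simp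
    have "m x \<le> C + G (lorentz (1 / r) (a /\<^sub>R r) x)"
    proof (rule hyperplane_bound[OF dim sol ls(3), of K])
      show "compact K" unfolding K_def by (intro compact_diff compact_Int_closed) auto
      show "K \<subseteq> cball 0 1" by (auto simp: K_def)
      show "continuous_on K m" by (rule continuous_on_subset[OF m Kp])
      show "m z \<le> C" if "z \<in> K" "norm z = 1" for z
      proof -
        have "z \<noteq> p" "norm (z - p) \<le> \<rho>"
          using subsetD[OF Kp that(1)] by (auto simp: dist_norm norm_minus_commute)
        then show ?thesis using bd[OF that(2)] by (simp add: C_def le_max_iff_disj)
      qed
      show "z \<in> interior K \<or> m z \<le> C" if z: "z \<in> K" "norm z < 1" "lorentz (1 / r) (a /\<^sub>R r) z > 0" for z
      proof (cases "dist p z = \<rho>")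
        case True
        then show ?thesis using C1[of z] z by (auto simp: C_def)
      next
        case False
        have "(norm (z - a))\<^sup>2 > r\<^sup>2"
          using z ls(1)[of z] u[of z] by (simp add: zero_less_divide_iff)
        then have "r < norm (z - a)" using r(1) by (simp add: power2_less_imp_less)
        then have "z \<in> ball 0 1 \<inter> ball p \<rho> - cball a r"
          using z False by (auto simp: K_def dist_norm norm_minus_commute)
        moreover have "ball 0 1 \<inter> ball p \<rho> - cball a r \<subseteq> interior K"
          by (rule interior_maximal) (auto simp: K_def)
        ultimately show ?thesis by blast
      qed
      show "x \<in> K" using x xa r d by (auto simp: K_def dist_norm norm_minus_commute)
      show "lorentz (1 / r) (a /\<^sub>R r) x > 0" using TF T by simp
    qed (rule x)
    also have "\<dots> \<le> C + (m x - C) / 2" using T(2)[OF TF] by simp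
    finally show False using \<open>\<not> m x \<le> C\<close> by (simp add: field_simps)
  qed
  then show thesis using that by blast
qed

text \<open>
  Take the half space with centre near \<open>\<xi>\<close> whose Euclidean radius \<open>r\<close> is half the distance \<open>w\<close> from \<open>\<xi>\<close> to \<open>p\<close>; it
  stays away from \<open>p\<close>. Points at Euclidean distance of order \<open>\<theta> w\<close> from \<open>\<xi>\<close> have \<open>F\<close> of order at least
  \<open>1 / \<theta>\<close>, where the barrier is at most \<open>\<epsilon>\<close>. The constant \<open>\<theta>\<close> is independent of the scale \<open>w\<close>.
\<close>
lemma deep_bound:
  fixes m :: "'a::euclidean_space \<Rightarrow> real"
  assumes dim: "DIM('a) \<ge> 2" and sol: "pointwise_solution A m" and p: "norm p = 1"
    and m: "continuous_on (cball 0 1 \<inter> cball p \<rho> - {p}) m"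
    and bd: "\<And>x. norm x = 1 \<Longrightarrow> x \<noteq> p \<Longrightarrow> norm (x - p) \<le> \<rho> \<Longrightarrow> m x \<le> L"
    and \<epsilon>: "\<epsilon> > 0"
  obtains \<theta> where "0 < \<theta>" "\<theta> \<le> 1 / 16"
    "\<And>\<xi> w z. norm \<xi> = 1 \<Longrightarrow> norm (\<xi> - p) = w \<Longrightarrow> 0 < w \<Longrightarrow> w \<le> 1 \<Longrightarrow> 2 * w \<le> \<rho> \<Longrightarrow>
       norm z < 1 \<Longrightarrow> norm (z - \<xi>) \<le> 2 * \<theta> * w \<Longrightarrow> 1 - (norm z)\<^sup>2 \<le> 4 * \<theta> * w \<Longrightarrow> m z \<le> L + \<epsilon>"
proof -
  obtain T where T: "T \<ge> 1" "\<And>t. t \<ge> T \<Longrightarrow> G t \<le> \<epsilon>" using G_small[OF \<epsilon>] by blast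
  define \<theta> where "\<theta> = 1 / (16 * T)"
  have \<theta>: "0 < \<theta>" "\<theta> \<le> 1 / 16" using T by (auto simp: \<theta>_def field_simps)
  have "m z \<le> L + \<epsilon>"
    if \<xi>: "norm \<xi> = 1" "norm (\<xi> - p) = w" and w: "0 < w" "w \<le> 1" "2 * w \<le> \<rho>"
      and z: "norm z < 1" "norm (z - \<xi>) \<le> 2 * \<theta> * w" "1 - (norm z)\<^sup>2 \<le> 4 * \<theta> * w" for \<xi> w z
  proof -
    define r where "r = w / 2"
    have r: "0 < r" "r \<le> 1 / 2" using w by (auto simp: r_def)
    define t where "t = sqrt (1 + r\<^sup>2)"
    have t: "1 \<le> t" "t - 1 \<le> r / 4" using sqrt_one_plus_square[OF r] by (simp_all add: t_def)
    define a where "a = t *\<^sub>R \<xi>"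
    have na: "(norm a)\<^sup>2 = 1 + r\<^sup>2" using \<xi> by (simp add: a_def t_def power_mult_distrib)
    have "\<xi> - a = (1 - t) *\<^sub>R \<xi>" by (simp add: a_def algebra_simps)
    then have \<xi>a: "norm (\<xi> - a) = t - 1" using t \<xi> by simp
    note ls = lorentz_sphere[OF r(1) na]
    have u: "0 < r * (1 - (norm z)\<^sup>2)" if "z \<in> \<H>" for z :: 'a
      using that r(1) by (simp add: power_less_one_iff)
    define K where "K = cball 0 1 \<inter> cball a r"
    have Kp: "K \<subseteq> cball 0 1 \<inter> cball p \<rho> - {p}"
    proof
      fix y assume y: "y \<in> K"
      have ya: "norm (y - a) \<le> r" using y by (simp add: K_def dist_norm norm_minus_commute)
      have "norm (y - \<xi>) \<le> norm (y - a) + norm (\<xi> - a)"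
        using norm_triangle_ineq4[of "y - a" "\<xi> - a"] by simp
      then have y\<xi>: "norm (y - \<xi>) \<le> 5 / 4 * r" using ya \<xi>a t by simp
      have "norm (y - p) \<le> norm (y - \<xi>) + w"
        using norm_triangle_ineq[of "y - \<xi>" "\<xi> - p"] \<xi> by simp
      then have "norm (y - p) \<le> \<rho>" using y\<xi> w by (simp add: r_def)
      moreover have "y \<noteq> p" using y\<xi> \<xi> r by (auto simp: r_def norm_minus_commute)
      ultimately show "y \<in> cball 0 1 \<inter> cball p \<rho> - {p}"
        using y by (simp add: K_def dist_norm norm_minus_commute)
    qed
    have zH: "z \<in> \<H>" using z by simp
    have "norm (z - a) \<le> norm (z - \<xi>) + norm (\<xi> - a)"
      using norm_triangle_ineq[of "z - \<xi>" "\<xi> - a"] by simp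
    also have "\<dots> \<le> r / 2"
    proof -
      have "\<theta> * w \<le> 1 / 16 * w" using \<theta> w by (intro mult_right_mono) auto
      then show ?thesis using z(2) \<xi>a t by (simp add: r_def)
    qed
    finally have za: "norm (z - a) \<le> r / 2" .
    have "(norm (z - a))\<^sup>2 \<le> r\<^sup>2 / 4" using power_mono[OF za, of 2] by (simp add: power_divide)
    then have num: "r\<^sup>2 / 2 \<le> r\<^sup>2 - (norm (z - a))\<^sup>2" "0 \<le> r\<^sup>2 - (norm (z - a))\<^sup>2"
      using zero_le_power2[of r] by linarith+
    have "T = (r\<^sup>2 / 2) / (r * (4 * \<theta> * w))"
      using r T by (simp add: \<theta>_def r_def power2_eq_square field_simps)
    also have "\<dots> \<le> (r\<^sup>2 - (norm (z - a))\<^sup>2) / (r * (1 - (norm z)\<^sup>2))"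
      by (rule frac_le[OF num(2,1) u[OF zH]]) (use z(3) r in \<open>intro mult_left_mono, auto\<close>)
    finally have TF: "T \<le> lorentz (- 1 / r) (- (a /\<^sub>R r)) z" using ls(2)[OF zH] by simp
    have "m z \<le> L + G (lorentz (- 1 / r) (- (a /\<^sub>R r)) z)"
    proof (rule hyperplane_bound[OF dim sol ls(4), of K])
      show "compact K" "K \<subseteq> cball 0 1" by (auto simp: K_def intro: compact_Int)
      show "continuous_on K m" by (rule continuous_on_subset[OF m Kp])
      show "m y \<le> L" if "y \<in> K" "norm y = 1" for y
      proof -
        have "y \<noteq> p" "norm (y - p) \<le> \<rho>"
          using subsetD[OF Kp that(1)] by (auto simp: dist_norm norm_minus_commute)
        then show ?thesis using bd[OF that(2)] by simp
      qed
      show "y \<in> interior K \<or> m y \<le> L" if y: "y \<in> K" "norm y < 1" "lorentz (- 1 / r) (- (a /\<^sub>R r)) y > 0" for y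
      proof -
        have "(norm (y - a))\<^sup>2 < r\<^sup>2"
          using y ls(2)[of y] u[of y] by (simp add: zero_less_divide_iff)
        then have "norm (y - a) < r" using r(1) by (simp add: power2_less_imp_less)
        then have "y \<in> ball 0 1 \<inter> ball a r"
          using y by (auto simp: dist_norm norm_minus_commute)
        moreover have "ball 0 1 \<inter> ball a r \<subseteq> interior K"
          by (rule interior_maximal) (auto simp: K_def)
        ultimately show ?thesis by blast
      qed
      show "z \<in> K" using z za r by (auto simp: K_def dist_norm norm_minus_commute)
      show "lorentz (- 1 / r) (- (a /\<^sub>R r)) z > 0" using TF T by simp
    qed (rule z)
    also have "\<dots> \<le> L + \<epsilon>" using T(2)[OF TF] by simp
    finally show ?thesis .
  qed
  then show thesis using that \<theta> by blast
qed

text \<open>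
  For \<open>x\<close> at distance \<open>e\<close> from \<open>p\<close> there are two cases. If \<open>x\<close> is closer than \<open>\<theta> e\<close> to the sphere, it lies deep in
  a half space around its radial projection. Otherwise the point \<open>y = (1 - \<theta> e) \<xi>\<close>, with \<open>\<xi>\<close> on the sphere at distance
  \<open>e\<close> from \<open>p\<close>, is the centre of a ball of fixed hyperbolic radius deep in a half space, and the distance from \<open>x\<close>
  to \<open>y\<close> is bounded by a constant that depends on \<open>\<theta>\<close> only, because both points have Euclidean distance of
  order \<open>e\<close> from each other and at least \<open>\<theta> e\<close> from the sphere. The strong maximum principle yields a gain
  \<open>\<eta>\<close> that does not depend on \<open>N\<close>.
\<close>
lemma improve_bound:
  fixes m :: "'a::euclidean_space \<Rightarrow> real"
  assumes dim: "DIM('a) \<ge> 2" and sol: "pointwise_solution A m" and p: "norm p = 1"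
    and \<rho>: "\<rho> > 0" and m: "continuous_on (cball 0 1 \<inter> cball p \<rho> - {p}) m"
    and bd: "\<And>x. norm x = 1 \<Longrightarrow> x \<noteq> p \<Longrightarrow> norm (x - p) \<le> \<rho> \<Longrightarrow> m x \<le> L"
    and M: "L < M"
  obtains \<eta> where "\<eta> > 0"
    "\<And>N d. M \<le> N \<Longrightarrow> d > 0 \<Longrightarrow> (\<And>x. norm x < 1 \<Longrightarrow> norm (x - p) < d \<Longrightarrow> m x \<le> N) \<Longrightarrow>
      \<exists>d'>0. \<forall>x. norm x < 1 \<longrightarrow> norm (x - p) < d' \<longrightarrow> m x \<le> max (N - \<eta>) ((L + M) / 2)"
proof -
  define gap where "gap = (M - L) / 2"
  have gap: "gap > 0" using M by (simp add: gap_def)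
  have eqm: "L + gap = (L + M) / 2" "M - gap = (L + M) / 2" by (simp_all add: gap_def field_simps)
  obtain \<theta> where \<theta>: "0 < \<theta>" "\<theta> \<le> 1 / 16"
    and deep: "\<And>\<xi> w z. norm \<xi> = 1 \<Longrightarrow> norm (\<xi> - p) = w \<Longrightarrow> 0 < w \<Longrightarrow> w \<le> 1 \<Longrightarrow> 2 * w \<le> \<rho> \<Longrightarrow>
       norm z < 1 \<Longrightarrow> norm (z - \<xi>) \<le> 2 * \<theta> * w \<Longrightarrow> 1 - (norm z)\<^sup>2 \<le> 4 * \<theta> * w \<Longrightarrow> m z \<le> L + gap"
    by (rule deep_bound[OF dim sol p m bd gap]) blast+
  \<comment> \<open>With \<open>|x - y| \<le> 3 e\<close> and both factors \<open>1 - |x|^2\<close>, \<open>1 - |y|^2\<close> at least \<open>\<theta> e\<close>, the number \<open>b\<close> bounds the hyperbolic cosine of the distance from \<open>x\<close> to \<open>y\<close>.\<close>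
  define b where "b = 1 + 18 / \<theta>\<^sup>2"
  have b: "9 / 8 \<le> b"
  proof -
    have "\<theta>\<^sup>2 \<le> 1" using \<theta> by (simp add: power_le_one)
    then have "18 / \<theta>\<^sup>2 \<ge> 18 / 1" using \<theta> by (intro divide_left_mono) auto
    then show ?thesis by (simp add: b_def)
  qed
  obtain \<eta> where \<eta>: "\<eta> > 0"
    "\<And>(m::'a \<Rightarrow> real) y N x.
      pointwise_solution A m \<Longrightarrow> y \<in> \<H> \<Longrightarrow>
      (\<And>z. z \<in> \<H> \<Longrightarrow> lorentz (conf_factor y - 1) (conf_factor y *\<^sub>R y) z \<le> b + 1 \<Longrightarrow> m z \<le> N) \<Longrightarrow>
      (\<And>z. z \<in> \<H> \<Longrightarrow> lorentz (conf_factor y - 1) (conf_factor y *\<^sub>R y) z \<le> 9 / 8 \<Longrightarrow> m z \<le> N - gap) \<Longrightarrow>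
      x \<in> \<H> \<Longrightarrow> lorentz (conf_factor y - 1) (conf_factor y *\<^sub>R y) x \<le> b \<Longrightarrow> m x \<le> N - \<eta>"
    by (rule interior_gap[of "9 / 8" b gap, OF _ b gap]) (simp, blast)
  have "\<exists>d'>0. \<forall>x. norm x < 1 \<longrightarrow> norm (x - p) < d' \<longrightarrow> m x \<le> max (N - \<eta>) ((L + M) / 2)"
    if N: "M \<le> N" and d: "d > 0" and ub: "\<And>x. norm x < 1 \<Longrightarrow> norm (x - p) < d \<Longrightarrow> m x \<le> N" for N d
  proof -
    define d' where "d' = Min {1 / 2 :: real, \<rho> / 4, d / 4, d\<^sup>2 / (4 * b)}"
    have d': "0 < d'" "d' \<le> 1 / 2" "d' \<le> \<rho> / 4" "d' \<le> d / 4" "d' \<le> d\<^sup>2 / (4 * b)"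
      using \<rho> d b by (auto simp: d'_def)
    have "m x \<le> max (N - \<eta>) ((L + M) / 2)" if x: "norm x < 1" "norm (x - p) < d'" for x
    proof -
      define e where "e = norm (x - p)"
      have "x \<noteq> p" using x p by auto
      then have e: "0 < e" "e < d'" using x by (simp_all add: e_def)
      have nx: "norm x > 1 / 2" using norm_triangle_ineq2[of p x] x d' p by (simp add: norm_minus_commute)
      have xH: "x \<in> \<H>" using x by simp
      define c where "c = \<theta> * e"
      have c: "0 < c" "c \<le> e / 16"
        using \<theta> e mult_right_mono[OF \<theta>(2), of e] by (auto simp: c_def)
      show ?thesis
      proof (cases "1 - norm x < c")
        case True
        define \<xi> where "\<xi> = x /\<^sub>R norm x"
        have x0: "x \<noteq> 0" using nx by auto
        then have \<xi>: "norm \<xi> = 1" by (simp add: \<xi>_def)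
        have "x - \<xi> = (norm x - 1) *\<^sub>R \<xi>" using x0 by (simp add: \<xi>_def algebra_simps)
        then have x\<xi>: "norm (x - \<xi>) = 1 - norm x" using \<xi> x by simp
        define w where "w = norm (\<xi> - p)"
        have "e \<le> (1 - norm x) + w" "w \<le> (1 - norm x) + e"
          using norm_triangle_ineq[of "x - \<xi>" "\<xi> - p"] norm_triangle_ineq[of "\<xi> - x" "x - p"] x\<xi>
          by (simp_all add: e_def w_def norm_minus_commute)
        then have w: "e / 2 \<le> w" "w \<le> 2 * e" using True c e by auto
        have \<theta>w: "c \<le> 2 * \<theta> * w" using mult_left_mono[OF w(1), of \<theta>] \<theta>(1) by (simp add: c_def)
        have "1 - (norm x)\<^sup>2 = (1 - norm x) * (1 + norm x)" by (simp add: power2_eq_square algebra_simps)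
        also have "\<dots> \<le> (1 - norm x) * 2" using x by (intro mult_left_mono) auto
        finally have "1 - (norm x)\<^sup>2 \<le> 4 * \<theta> * w" using True \<theta>w by simp
        then have "m x \<le> L + gap"
          using w e d' x\<xi> True \<theta>w x by (intro deep[OF \<xi> w_def[symmetric]]) auto
        then have "m x \<le> (L + M) / 2" by (simp only: eqm(1))
        then show ?thesis by (simp add: le_max_iff_disj)
      next
        case False
        obtain \<xi> where \<xi>: "norm \<xi> = 1" "norm (\<xi> - p) = e"
          using sphere_point_at_distance[OF dim p e(1)] e d' by auto
        define y where "y = (1 - c) *\<^sub>R \<xi>"
        have c1: "0 < c" "c < 1" using c e d'(2) by auto
        have ny: "norm y = 1 - c" using \<xi> c1 by (simp add: y_def)
        have yH: "y \<in> \<H>" using ny c1 by simp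
        define v where "v = 1 - (norm y)\<^sup>2"
        have v: "c \<le> v" "v \<le> 2 * c"
        proof -
          have "v = c * (2 - c)" unfolding v_def ny by (simp add: power2_eq_square algebra_simps)
          moreover have "c * 1 \<le> c * (2 - c)" "c * (2 - c) \<le> c * 2"
            using c1 by (intro mult_left_mono; simp)+
          ultimately show "c \<le> v" "v \<le> 2 * c" by simp_all
        qed
        have vp: "v > 0" using v c1 by simp
        have "y - \<xi> = - c *\<^sub>R \<xi>" by (simp add: y_def algebra_simps)
        then have y\<xi>: "norm (y - \<xi>) = c" using \<xi> c1 by simp
        have F: "lorentz (conf_factor y - 1) (conf_factor y *\<^sub>R y) z \<le> 1 + k \<Longrightarrow>
            2 * (norm (z - y))\<^sup>2 \<le> k * (v * (1 - (norm z)\<^sup>2))" if "z \<in> \<H>" for z k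
        proof -
          have "1 - (norm z)\<^sup>2 > 0" using that by (simp add: power_less_one_iff)
          then have "v * (1 - (norm z)\<^sup>2) > 0" using vp by simp
          moreover assume "lorentz (conf_factor y - 1) (conf_factor y *\<^sub>R y) z \<le> 1 + k"
          ultimately show ?thesis
            unfolding lorentz_point(1)[OF yH that] v_def[symmetric] by (simp add: pos_divide_le_eq)
        qed
        define Q where "Q = d\<^sup>2 / (4 * b)"
        have bQ: "b * Q = d\<^sup>2 / 4" using b by (simp add: Q_def)
        have cQ: "c \<le> Q / 16" using c e d'(5)[folded Q_def] by linarith
        have "m x \<le> N - \<eta>"
        proof (rule \<eta>(2)[OF sol yH _ _ xH])
          show "m z \<le> N" if z: "z \<in> \<H>" "lorentz (conf_factor y - 1) (conf_factor y *\<^sub>R y) z \<le> b + 1" for z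
          proof (rule ub)
            show "norm z < 1" using z by simp
            have "2 * (norm (z - y))\<^sup>2 \<le> b * (v * (1 - (norm z)\<^sup>2))" using F[OF z(1), of b] z(2) by simp
            also have "\<dots> \<le> b * (v * 1)" using b vp by (intro mult_left_mono) auto
            also have "\<dots> \<le> b * (2 * c)" using v b by (intro mult_left_mono) auto
            also have "\<dots> \<le> b * (2 * (Q / 16))" using cQ b by (intro mult_left_mono) auto
            also have "\<dots> = b * Q / 8" by simp
            finally have "2 * (norm (z - y))\<^sup>2 \<le> d\<^sup>2 / 4 / 8" unfolding bQ .
            then have "(norm (z - y))\<^sup>2 \<le> d\<^sup>2 / 16" using zero_le_power2[of d] by linarith
            then have "(norm (z - y))\<^sup>2 \<le> (d / 4)\<^sup>2" by (simp add: power_divide)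
            then have "norm (z - y) \<le> d / 4" by (rule power2_le_imp_le) (use d in simp)
            moreover have "norm (z - p) \<le> norm (z - y) + norm (y - \<xi>) + norm (\<xi> - p)"
              using norm_triangle_ineq[of "z - y" "y - \<xi>"] norm_triangle_ineq[of "z - \<xi>" "\<xi> - p"] by simp
            ultimately show "norm (z - p) < d" using \<xi> y\<xi> c e d' by simp
          qed
          \<comment> \<open>The inner ball has \<open>cosh d \<le> 9 / 8\<close>, small enough that \<open>1 - |z|^2\<close> at most doubles compared with \<open>y\<close> and \<open>z\<close> stays deep in the half space.\<close>
          show "m z \<le> N - gap" if z: "z \<in> \<H>" "lorentz (conf_factor y - 1) (conf_factor y *\<^sub>R y) z \<le> 9 / 8" for z
          proof -
            define u where "u = 1 - (norm z)\<^sup>2"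
            define \<delta> where "\<delta> = norm (z - y)"
            have up: "u > 0" using z by (simp add: u_def power_less_one_iff)
            have \<delta>: "\<delta> * \<delta> \<le> u * v / 16" using F[OF z(1), of "1 / 8"] z(2) by (simp add: u_def \<delta>_def power2_eq_square mult.commute[of v])
            have "u - v = (norm y - norm z) * (norm y + norm z)" by (simp add: u_def v_def power2_eq_square algebra_simps)
            also have "\<dots> \<le> \<delta> * 2"
              using norm_triangle_ineq3[of y z] z(1) yH
              by (intro mult_mono) (auto simp: \<delta>_def norm_minus_commute)
            finally have uv: "u - v \<le> 2 * \<delta>" by simp
            have u2: "u \<le> 2 * v"
            proof (rule ccontr)
              assume "\<not> u \<le> 2 * v"
              then have 1: "u / 4 < \<delta>" and 2: "v < u" using uv vp by auto
              have "u / 4 * (u / 4) < \<delta> * \<delta>" using 1 up by (intro mult_strict_mono) auto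
              moreover have "u * v \<le> u * u" using 2 up by simp
              ultimately show False using \<delta> by simp
            qed
            have "\<delta> * \<delta> \<le> (2 * v) * v / 16" using \<delta> mult_right_mono[OF u2, of v] vp by linarith
            also have "\<dots> \<le> (v / 2) * (v / 2)" using vp by simp
            finally have "\<delta>\<^sup>2 \<le> (v / 2)\<^sup>2" by (simp add: power2_eq_square)
            then have "\<delta> \<le> v / 2" by (rule power2_le_imp_le) (use vp in simp)
            moreover have "norm (z - \<xi>) \<le> \<delta> + norm (y - \<xi>)"
              using norm_triangle_ineq[of "z - y" "y - \<xi>"] by (simp add: \<delta>_def)
            ultimately have "norm (z - \<xi>) \<le> 2 * \<theta> * e" using v y\<xi> by (simp add: c_def)
            moreover have "1 - (norm z)\<^sup>2 \<le> 4 * \<theta> * e" using u2 v by (simp add: u_def c_def)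
            ultimately have "m z \<le> L + gap"
              using z(1) e d' by (intro deep[OF \<xi>]) auto
            then show ?thesis using eqm N by linarith
          qed
          have "norm (x - y) \<le> norm (x - p) + norm (\<xi> - p) + norm (y - \<xi>)"
            using norm_triangle_ineq4[of "x - p" "\<xi> - p"] norm_triangle_ineq4[of "x - \<xi>" "y - \<xi>"] by simp
          then have "norm (x - y) \<le> 3 * e" using \<xi> y\<xi> c e by (simp add: e_def)
          then have "(norm (x - y))\<^sup>2 \<le> (3 * e)\<^sup>2" by (intro power_mono) auto
          moreover have "c \<le> 1 - (norm x)\<^sup>2"
          proof -
            have "norm x * norm x \<le> norm x * 1" using x by (intro mult_left_mono) auto
            then show ?thesis using False by (simp add: power2_eq_square)
          qed
          then have "c * c \<le> v * (1 - (norm x)\<^sup>2)"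
            using v c1 by (intro mult_mono) auto
          ultimately have "2 * (norm (x - y))\<^sup>2 / (v * (1 - (norm x)\<^sup>2)) \<le> (2 * (3 * e)\<^sup>2) / (c * c)"
            using c1 by (intro frac_le mult_left_mono) auto
          also have "\<dots> = 18 / \<theta>\<^sup>2" using e(1) by (simp add: c_def power2_eq_square)
          finally show "lorentz (conf_factor y - 1) (conf_factor y *\<^sub>R y) x \<le> b"
            unfolding lorentz_point(1)[OF yH xH] v_def[symmetric] b_def by simp
        qed
        then show ?thesis by simp
      qed
    qed
    then show ?thesis using d'(1) by blast
  qed
  then show thesis using that \<eta>(1) by blast
qed

text \<open>
  The infimum of the upper bounds that are valid near \<open>p\<close> cannot exceed \<open>L\<close>: an almost optimal bound could be
  improved by more than its distance to the infimum. Bounds below \<open>L\<close> are ignored so that the infimum exists.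
\<close>
lemma limsup_le_boundary_limit:
  fixes m :: "'a::euclidean_space \<Rightarrow> real"
  assumes dim: "DIM('a) \<ge> 2" and sol: "pointwise_solution A m" and p: "norm p = 1"
    and \<rho>: "\<rho> > 0" and m: "continuous_on (cball 0 1 \<inter> cball p \<rho> - {p}) m"
    and bd: "\<And>x. norm x = 1 \<Longrightarrow> x \<noteq> p \<Longrightarrow> norm (x - p) \<le> \<rho> \<Longrightarrow> m x \<le> L"
    and \<epsilon>: "\<epsilon> > 0"
  shows "\<exists>d>0. \<forall>x. norm x < 1 \<longrightarrow> norm (x - p) < d \<longrightarrow> m x \<le> L + \<epsilon>"
proof -
  define bound_at where "bound_at N \<longleftrightarrow> (\<exists>d>0. \<forall>x. norm x < 1 \<longrightarrow> norm (x - p) < d \<longrightarrow> m x \<le> N)" for N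
  have mono: "bound_at N \<Longrightarrow> N \<le> N' \<Longrightarrow> bound_at N'" for N N'
    unfolding bound_at_def by (meson order_trans)
  define S where "S = {N. L \<le> N \<and> bound_at N}"
  obtain M0 where "\<And>x. norm x < 1 \<Longrightarrow> norm (x - p) < \<rho> \<Longrightarrow> m x \<le> M0"
    by (rule bounded_near[OF dim sol p \<rho> m bd]) blast+
  then have "bound_at M0" using \<rho> by (auto simp: bound_at_def)
  then have ne: "max L M0 \<in> S" using mono by (auto simp: S_def)
  have bb: "bdd_below S" by (auto simp: S_def bdd_below_def)
  define M where "M = Inf S"
  have "M \<le> L"
  proof (rule ccontr)
    assume "\<not> M \<le> L"
    then have LM: "L < M" by simp
    obtain \<eta> where \<eta>: "\<eta> > 0"
      "\<And>N d. M \<le> N \<Longrightarrow> d > 0 \<Longrightarrow> (\<And>x. norm x < 1 \<Longrightarrow> norm (x - p) < d \<Longrightarrow> m x \<le> N) \<Longrightarrow>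
      \<exists>d'>0. \<forall>x. norm x < 1 \<longrightarrow> norm (x - p) < d' \<longrightarrow> m x \<le> max (N - \<eta>) ((L + M) / 2)"
      using improve_bound[OF dim sol p \<rho> m bd LM] by blast
    have "Inf S < M + \<eta>" using \<eta>(1) by (simp add: M_def)
    then obtain N where N: "N \<in> S" "N < M + \<eta>" using cInf_less_iff[OF _ bb] ne by blast
    have MN: "M \<le> N" unfolding M_def by (rule cInf_lower[OF N(1) bb])
    obtain d where d: "d > 0" "\<And>x. norm x < 1 \<Longrightarrow> norm (x - p) < d \<Longrightarrow> m x \<le> N"
      using N(1) by (auto simp: S_def bound_at_def)
    have "bound_at (max (N - \<eta>) ((L + M) / 2))"
      unfolding bound_at_def by (rule \<eta>(2)[OF MN d])
    moreover have "L \<le> (L + M) / 2" using LM by (simp add: field_simps)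
    ultimately have "max (N - \<eta>) ((L + M) / 2) \<in> S" by (simp add: S_def le_max_iff_disj)
    then have "M \<le> max (N - \<eta>) ((L + M) / 2)" unfolding M_def by (rule cInf_lower[OF _ bb])
    then show False using N(2) LM by (auto simp: max_def split: if_splits)
  qed
  then have "Inf S < L + \<epsilon>" using \<epsilon> by (simp add: M_def)
  then obtain N where "N \<in> S" "N < L + \<epsilon>" using cInf_less_iff[OF _ bb] ne by blast
  then have "bound_at (L + \<epsilon>)" using mono by (auto simp: S_def)
  then show ?thesis by (simp add: bound_at_def)
qed

end

section \<open>Removability of the exceptional points\<close>

theorem theorem1p3:
  fixes A A' :: "real \<Rightarrow> real"
    and P :: "(real ^ 'n) set"
    and m :: "real ^ 'n \<Rightarrow> real"
  assumes dim: "CARD('n) \<ge> 2"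
    and A_deriv: "\<And>s. s \<ge> 0 \<Longrightarrow> (A has_real_derivative A' s) (at s within {0..})"
    and A_C1: "continuous_on {0..} A'"
    and i: "A 0 = 0" "\<And>s. s > 0 \<Longrightarrow> A' s > 0"
    and ii: "\<exists>C p. C > 0 \<and> p \<ge> 1 \<and> (\<forall>s>0. A s \<le> C * (s powr (p - 1) + 1))"
    and iii: "\<exists>q \<delta>\<^sub>0 D. q > 0 \<and> \<delta>\<^sub>0 > 0 \<and> D > 0 \<and> (\<forall>s\<in>{0<..\<delta>\<^sub>0}. A s > D * s powr q)"
    and iv: "\<exists>K\<^sub>0>0. ereal K\<^sub>0 \<le> (SUP s\<in>{0..}. ereal (A s)) \<and>
               (\<integral>\<^sup>+t\<in>{0..<K\<^sub>0}. ennreal (inv_into {0..} A t / sqrt (K\<^sub>0 - t)) \<partial>lborel) = \<infinity>"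
    and P: "finite P" "P \<subseteq> \<partial>\<H>"
    and m_smooth: "smooth_on \<H> m"
    and m_cont: "continuous_on (cl\<H> - P) m"
    and m_sol: "has_weak_div (flux A m) (\<lambda>_. 0)"
    and m_boundary: "\<And>p. p \<in> P \<Longrightarrow> extends_continuously m (\<partial>\<H> - P) (insert p (\<partial>\<H> - P))"
  shows "extends_continuously m (cl\<H> - P) cl\<H>"
proof -
  have s_deriv: "(A has_real_derivative A' s) (at s)" if "s > 0" for s
  proof -
    have "(A has_real_derivative A' s) (at s within {0<..})"
      by (rule DERIV_subset[OF A_deriv]) (use that in auto)
    then show ?thesis using that by (simp add: at_within_open[of s "{0<..}"])
  qed
  have A_cont: "continuous_on {0..} A"
    using A_deriv by (intro DERIV_continuous_on) auto
  interpret flux_law A A'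
    using s_deriv i A_cont by unfold_locales auto
  obtain K\<^sub>0 where K0: "K\<^sub>0 > 0" "ereal K\<^sub>0 \<le> (SUP s\<in>{0..}. ereal (A s))"
    and inf: "(\<integral>\<^sup>+t\<in>{0..<K\<^sub>0}. ennreal (A_inv t / sqrt (K\<^sub>0 - t)) \<partial>lborel) = \<infinity>"
    using iv unfolding A_inv_def by blast
  have reach: "\<exists>s\<ge>0. t < A s" if "t < K\<^sub>0" for t
  proof -
    have "ereal t < (SUP s\<in>{0..}. ereal (A s))"
      by (rule less_le_trans[OF _ K0(2)]) (use that in simp)
    then show ?thesis by (auto simp: less_SUP_iff)
  qed
  obtain q \<delta> D where q: "q > 0" "\<delta> > 0" "D > 0" "\<And>s. s \<in> {0<..\<delta>} \<Longrightarrow> A s > D * s powr q"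
    using iii by blast
  obtain G h h' where G: "\<And>t. t > 0 \<Longrightarrow> (G has_real_derivative - h t) (at t)"
    "\<And>t. t > 0 \<Longrightarrow> h t > 0"
    "\<And>t. t > 0 \<Longrightarrow> (h has_real_derivative h' t) (at t)"
    "\<And>t. t > 0 \<Longrightarrow> A (h t * sqrt (t\<^sup>2 + 1)) = 2 * K\<^sub>0 / sqrt (4 + t\<^sup>2)"
    "\<And>t. t > 0 \<Longrightarrow> G t > 0"
    "(G \<longlongrightarrow> 0) at_top" "filterlim G at_top (at_right 0)"
    by (rule hyperplane_barrier[OF K0(1) reach q inf]) blast+
  interpret scherk_law A A' K\<^sub>0 G h h'
    by unfold_locales (use K0 G in auto)
  have sol: "pointwise_solution A m"
    by (rule smooth_weak_imp_pointwise_solution[OF m_smooth m_sol])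
  have dim': "DIM(real ^ 'n) \<ge> 2" using dim by simp
  have "\<exists>l. \<forall>\<epsilon>>0. \<exists>d>0. \<forall>x\<in>cl\<H> - P. norm (x - p) < d \<longrightarrow> \<bar>m x - l\<bar> \<le> \<epsilon>" if p: "p \<in> P" for p
  proof -
    obtain f where f: "continuous_on (insert p (\<partial>\<H> - P)) f" "\<And>x. x \<in> \<partial>\<H> - P \<Longrightarrow> f x = m x"
      using m_boundary[OF p] unfolding extends_continuously_def by blast
    have np: "norm p = 1" using P(2) p by auto
    have "finite (P - {p})" using P(1) by simp
    then obtain \<rho>0 where \<rho>0: "\<rho>0 > 0" "\<And>x. x \<in> P \<Longrightarrow> x \<noteq> p \<Longrightarrow> \<rho>0 \<le> dist p x"
      using finite_set_avoid[of "P - {p}" p] by auto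
    have "\<exists>d>0. \<forall>x\<in>cl\<H> - P. norm (x - p) < d \<longrightarrow> \<bar>m x - f p\<bar> \<le> \<epsilon>" if \<epsilon>: "\<epsilon> > 0" for \<epsilon>
    proof -
      have "\<epsilon> / 2 > 0" using \<epsilon> by simp
      then obtain \<rho>1 where \<rho>1: "\<rho>1 > 0"
        "\<And>x. x \<in> insert p (\<partial>\<H> - P) \<Longrightarrow> dist x p < \<rho>1 \<Longrightarrow> dist (f x) (f p) < \<epsilon> / 2"
        using f(1) unfolding continuous_on_iff by blast
      \<comment> \<open>Within distance \<open>\<rho>\<close> there is no exceptional point other than \<open>p\<close>, and the boundary values are close to \<open>f p\<close>.\<close>
      define \<rho> where "\<rho> = min \<rho>0 \<rho>1 / 2"
      have \<rho>: "0 < \<rho>" "\<rho> < \<rho>0" "\<rho> < \<rho>1" using \<rho>0(1) \<rho>1(1) by (auto simp: \<rho>_def min_def)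
      have notP: "x \<notin> P" if "x \<noteq> p" "norm (x - p) \<le> \<rho>" for x
        using \<rho>0(2)[of x] that \<rho> by (auto simp: dist_norm norm_minus_commute)
      have cont: "continuous_on (cball 0 1 \<inter> cball p \<rho> - {p}) m"
        by (rule continuous_on_subset[OF m_cont]) (auto simp: dist_norm norm_minus_commute dest: notP)
      have bd: "\<bar>m x - f p\<bar> \<le> \<epsilon> / 2" if "norm x = 1" "x \<noteq> p" "norm (x - p) \<le> \<rho>" for x
      proof -
        have "x \<in> \<partial>\<H> - P" using that notP by auto
        then show ?thesis using \<rho>1(2)[of x] f(2)[of x] that \<rho> by (auto simp: dist_norm)
      qed
      have "m x \<le> f p + \<epsilon> / 2" "- m x \<le> - f p + \<epsilon> / 2" if "norm x = 1" "x \<noteq> p" "norm (x - p) \<le> \<rho>" for x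
        using bd[OF that] unfolding abs_le_iff by linarith+
      note b = this
      obtain d1 where d1: "d1 > 0" "\<And>x. norm x < 1 \<Longrightarrow> norm (x - p) < d1 \<Longrightarrow> m x \<le> (f p + \<epsilon> / 2) + \<epsilon> / 2"
        using limsup_le_boundary_limit[OF dim' sol np \<rho>(1) cont b(1) \<open>\<epsilon> / 2 > 0\<close>] by blast
      obtain d2 where d2: "d2 > 0" "\<And>x. norm x < 1 \<Longrightarrow> norm (x - p) < d2 \<Longrightarrow> - m x \<le> (- f p + \<epsilon> / 2) + \<epsilon> / 2"
        using limsup_le_boundary_limit[OF dim' pointwise_solution_uminus[OF sol] np \<rho>(1)
            continuous_on_minus[OF cont] b(2) \<open>\<epsilon> / 2 > 0\<close>] by blast
      have "\<bar>m x - f p\<bar> \<le> \<epsilon>" if x: "x \<in> cl\<H> - P" "norm (x - p) < min \<rho> (min d1 d2)" for x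
      proof (cases "norm x = 1")
        case True
        then show ?thesis using bd[of x] x p \<epsilon> by fastforce
      next
        case False
        then have "norm x < 1" using x by simp
        then have "m x \<le> (f p + \<epsilon> / 2) + \<epsilon> / 2" "- m x \<le> (- f p + \<epsilon> / 2) + \<epsilon> / 2"
          using d1(2)[of x] d2(2)[of x] x by auto
        then show ?thesis unfolding abs_le_iff by linarith
      qed
      then show ?thesis using \<rho> d1 d2 by (intro exI[of _ "min \<rho> (min d1 d2)"]) auto
    qed
    then show ?thesis by blast
  qed
  then obtain l where l: "\<And>p \<epsilon>. p \<in> P \<Longrightarrow> \<epsilon> > 0 \<Longrightarrow>
      \<exists>d>0. \<forall>x\<in>cl\<H> - P. norm (x - p) < d \<longrightarrow> \<bar>m x - l p\<bar> \<le> \<epsilon>"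
    by metis
  define f where "f x = (if x \<in> P then l x else m x)" for x
  have "continuous_on cl\<H> f"
    unfolding continuous_on_iff
  proof (intro ballI allI impI)
    fix x :: "real ^ 'n" and \<epsilon> :: real
    assume x: "x \<in> cl\<H>" and \<epsilon>: "\<epsilon> > 0"
    obtain \<rho>0 where \<rho>0: "\<rho>0 > 0" "\<And>y. y \<in> P \<Longrightarrow> y \<noteq> x \<Longrightarrow> \<rho>0 \<le> dist x y"
      using finite_set_avoid[OF P(1), of x] by auto
    have "\<exists>d>0. \<forall>y\<in>cl\<H> - P. dist y x < d \<longrightarrow> dist (m y) (f x) < \<epsilon>"
    proof (cases "x \<in> P")
      case True
      have "\<epsilon> / 2 > 0" using \<epsilon> by simp
      then obtain d where d: "d > 0" "\<And>y. y \<in> cl\<H> - P \<Longrightarrow> norm (y - x) < d \<Longrightarrow> \<bar>m y - l x\<bar> \<le> \<epsilon> / 2"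
        using l[OF True] by blast
      have "dist (m y) (f x) < \<epsilon>" if "y \<in> cl\<H> - P" "dist y x < d" for y
        using d(2)[OF that(1)] that(2) True \<epsilon> by (simp add: f_def dist_norm)
      then show ?thesis using d(1) by blast
    next
      case False
      then show ?thesis using m_cont x \<epsilon> unfolding continuous_on_iff f_def by simp
    qed
    then obtain d where d: "d > 0" "\<And>y. y \<in> cl\<H> - P \<Longrightarrow> dist y x < d \<Longrightarrow> dist (m y) (f x) < \<epsilon>" by blast
    show "\<exists>d>0. \<forall>y\<in>cl\<H>. dist y x < d \<longrightarrow> dist (f y) (f x) < \<epsilon>"
    proof (intro exI[of _ "min d \<rho>0"] conjI ballI impI)
      fix y assume y: "y \<in> cl\<H>" "dist y x < min d \<rho>0"
      show "dist (f y) (f x) < \<epsilon>"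
      proof (cases "y = x")
        case False
        then have "y \<notin> P" using \<rho>0(2)[of y] y(2) by (auto simp: dist_commute)
        then show ?thesis using d(2)[of y] y by (simp add: f_def)
      qed (use \<epsilon> in simp)
    qed (use d \<rho>0 in simp)
  qed
  then show ?thesis
    unfolding extends_continuously_def by (intro exI[of _ f]) (auto simp: f_def)
qed

end
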